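(* Let $d\ge 2$ and $m,n\ge 1$ be integers with $m+n=d$, let $\omega$ be an $(m,n)$-weight vector and let $k\in\{1,\dots,d-1\}$. Let $\mathcal{M}$ be a connected analytic submanifold of $M_{m,n}$. Assume that $\mathcal{M}$ is not contained in any proper rational weakly constraining $k$-pencil. Then for Lebesgue almost every $x\in\mathcal{M}$, $\boldsymbol{L}^{\omega}(\Lambda_x,\cdot)$ is connected at $k$.
   Context: $M_{m,n}$ denotes the space of real $m\times n$ matrices. Lebesgue measure on an analytic submanifold means its natural volume measure. Vectors of $\mathbb{R}^d$ are column vectors; $e_1,\dots,e_d$ is the standard basis. A vector $\omega=(\omega_1,\dots,\omega_d)\in\mathbb{R}^d$ is an $(m,n)$-weight vector if $\omega_1\ge\cdots\ge\omega_m>0$, $\omega_{m+1}\ge\cdots\ge\omega_d>0$ and $\sum_{i=1}^m\omega_i=\sum_{j=m+1}^d\omega_j=1$. For $t\in\mathbb{R}$ put $a^{\omega}_t=\mathrm{diag}(e^{\omega_1 t},\dots,e^{\omega_m t},e^{-\omega_{m+1}t},\dots,e^{-\omega_d t})$. For $x\in M_{m,n}$ put $u(x)=\begin{pmatrix}\mathbb{I}_m & x\\ 0&\mathbb{I}_n\end{pmatrix}$, $\Lambda_x=u(x)\mathbb{Z}^d$, and let $\tilde{x}=(\mathbb{I}_m\mid x)\in M_{m,d}$ be the first $m$ rows of $u(x)$, regarded as a linear map $\mathbb{R}^d\to\mathbb{R}^m\cong\langle e_1,\dots,e_m\rangle$. A unimodular lattice is a lattice in $\mathbb{R}^d$ of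 covolume $1$. Let $\mathcal{C}$ be the closed unit cube of $\mathbb{R}^d$ centered at $0$ (its side length is immaterial below: rescaling $\mathcal{C}$ adds the same constant to all $L_i^\omega$). For a unimodular lattice $\Lambda$, $t\ge 0$ and $1\le i\le d$, $\lambda_i(a^{\omega}_t\Lambda)$ is the least $\lambda>0$ such that $\lambda\mathcal{C}$ contains $i$ linearly independent vectors of $a^{\omega}_t\Lambda$. Set $L^{\omega}_i(\Lambda,t)=\log\lambda_i(a^{\omega}_t\Lambda)$ and $\boldsymbol{L}^{\omega}(\Lambda,t)=(L^{\omega}_1(\Lambda,t),\dots,L^{\omega}_d(\Lambda,t))$. $\boldsymbol{L}^{\omega}(\Lambda,\cdot)$ is connected at $k$ if the set $\{t\ge 0: L^{\omega}_k(\Lambda,t)=L^{\omega}_{k+1}(\Lambda,t)\}$ is unbounded above. For linear subspaces $W\subset\mathbb{R}^d$ and $W'\subset\langle e_1,\dots,e_m\rangle$ set $I(W)=\{i\in\{m+1,\dots,d\}:\dim(W\cap\langle e_1,\dots,e_i\rangle)>\dim(W\cap\langle e_1,\dots,e_{i-1}\rangle)\}$, $J(W')=\{j\in\{1,\dots,m\}:\dim(W'\cap\langle e_{j+1},\dots,e_m\rangle)<\dim(W'\cap\langle e_j,\dots,e_m\rangle)\}$ (with $\langle e_{j+1},\dots,e_m\rangle=0$ if $j=m$), and $\psi(W)=\sum_{i\in I(W)}\omega_i$, $\phi(W')=\sum_{j\in J(W')}\omega_j$ (empty sums are $0$). For $a,b\in\mathbb{R}$ and a $k$-dimensional subspace $W\subset\mathbb{R}^d$,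 the $k$-pencil $\mathcal{P}^{\omega}_{W,a,b}$ is $\{x\in M_{m,n}:\psi(\ker\tilde{x}\cap W)\ge a\text{ and }\phi(\tilde{x}W)\le b\}$. It is rational if $W$ has a basis in $\mathbb{Q}^d$, weakly constraining if $b\le a$, and proper if $\mathcal{P}^{\omega}_{W,a,b}\ne M_{m,n}$. *)

theory Defs
  imports "HOL-Analysis.Analysis"
begin

section \<open>Weights, the diagonal flow and the lattices\<close>

text \<open>
  The dimensions \<open>m\<close> and \<open>n\<close> are the cardinalities of linearly ordered finite types \<open>'m\<close> and \<open>'n\<close>;
  \<open>\<real>\<^sup>d\<close> is \<open>real ^ ('m + 'n)\<close>. The indices \<open>1 < \<dots> < d\<close> are the indices \<open>Inl i\<close> in the order
  of \<open>'m\<close>, followed by the indices \<open>Inr j\<close> in the order of \<open>'n\<close>.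
\<close>

definition weight_vector :: "real ^ ('m::{finite,linorder} + 'n::{finite,linorder}) \<Rightarrow> bool" where
  "weight_vector \<omega> \<longleftrightarrow>
     (\<forall>i j. i \<le> j \<longrightarrow> \<omega> $ Inl i \<ge> \<omega> $ Inl j) \<and> (\<forall>i. \<omega> $ Inl i > 0) \<and>
     (\<forall>i j. i \<le> j \<longrightarrow> \<omega> $ Inr i \<ge> \<omega> $ Inr j) \<and> (\<forall>j. \<omega> $ Inr j > 0) \<and>
     (\<Sum>i\<in>UNIV. \<omega> $ Inl i) = 1 \<and> (\<Sum>j\<in>UNIV. \<omega> $ Inr j) = 1"

definition diag_flow :: "real ^ ('m::finite + 'n::finite) \<Rightarrow> real \<Rightarrow> real ^ ('m + 'n) ^ ('m + 'n)" where
  "diag_flow \<omega> t =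
     (\<chi> i j. if i = j then (case i of Inl _ \<Rightarrow> exp (\<omega> $ i * t) | Inr _ \<Rightarrow> exp (- \<omega> $ i * t)) else 0)"

definition u_mat :: "real ^ 'n::finite ^ 'm::finite \<Rightarrow> real ^ ('m + 'n) ^ ('m + 'n)" where
  "u_mat x = (\<chi> i j. case (i, j) of (Inl a, Inr b) \<Rightarrow> x $ a $ b | _ \<Rightarrow> if i = j then 1 else 0)"

definition integer_lattice :: "(real ^ 'd::finite) set" where
  "integer_lattice = {v. \<forall>i. v $ i \<in> \<int>}"

definition Lambda :: "real ^ 'n::finite ^ 'm::finite \<Rightarrow> (real ^ ('m + 'n)) set" where
  "Lambda x = (*v) (u_mat x) ` integer_lattice"

definition x_tilde :: "real ^ 'n::finite ^ 'm::finite \<Rightarrow> real ^ ('m + 'n) ^ 'm" where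
  "x_tilde x = (\<chi> i. u_mat x $ Inl i)"


section \<open>Successive minima functions\<close>

definition unit_cube :: "(real ^ 'd::finite) set" where
  "unit_cube = cbox (\<chi> i. - 1 / 2) (\<chi> i. 1 / 2)"

definition successive_minimum :: "nat \<Rightarrow> (real ^ 'd::finite) set \<Rightarrow> real" where
  "successive_minimum i \<Lambda> =
     (LEAST r. r > 0 \<and> (\<exists>S. S \<subseteq> (*\<^sub>R) r ` unit_cube \<inter> \<Lambda> \<and> independent S \<and> finite S \<and> card S = i))"

definition L_fun :: "real ^ ('m::finite + 'n::finite) \<Rightarrow> (real ^ ('m + 'n)) set \<Rightarrow> nat \<Rightarrow> real \<Rightarrow> real" where
  "L_fun \<omega> \<Lambda> i t = ln (successive_minimum i ((*v) (diag_flow \<omega> t) ` \<Lambda>))"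

definition connected_at :: "(nat \<Rightarrow> real \<Rightarrow> real) \<Rightarrow> nat \<Rightarrow> bool" where
  "connected_at L k \<longleftrightarrow> \<not> bdd_above {t. t \<ge> 0 \<and> L k t = L (Suc k) t}"


section \<open>Pencils\<close>

definition coord_span :: "'d::finite set \<Rightarrow> (real ^ 'd) set" where
  "coord_span S = span ((\<lambda>i. axis i 1) ` S)"

text \<open>
  The sets \<open>I(W) \<subseteq> {m+1,\<dots>,d}\<close> and \<open>J(W') \<subseteq> {1,\<dots>,m}\<close> are sets of elements of \<open>'n\<close> and \<open>'m\<close>.
  The subspace \<open>\<langle>e\<^sub>1,\<dots>,e\<^sub>m\<rangle>\<close> is identified with \<open>real ^ 'm\<close>.
\<close>

definition I_set :: "(real ^ ('m::finite + 'n::{finite,linorder})) set \<Rightarrow> 'n set" where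
  "I_set W = {j. dim (W \<inter> coord_span (range Inl \<union> Inr ` {..j}))
               > dim (W \<inter> coord_span (range Inl \<union> Inr ` {..<j}))}"

definition J_set :: "(real ^ 'm::{finite,linorder}) set \<Rightarrow> 'm set" where
  "J_set W' = {j. dim (W' \<inter> coord_span {j<..}) < dim (W' \<inter> coord_span {j..})}"

definition psi :: "real ^ ('m::finite + 'n::{finite,linorder}) \<Rightarrow> (real ^ ('m + 'n)) set \<Rightarrow> real" where
  "psi \<omega> W = (\<Sum>j\<in>I_set W. \<omega> $ Inr j)"

definition phi :: "real ^ ('m::{finite,linorder} + 'n::finite) \<Rightarrow> (real ^ 'm::{finite,linorder}) set \<Rightarrow> real" where
  "phi \<omega> W' = (\<Sum>j\<in>J_set W'. \<omega> $ Inl j)"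

definition pencil ::
    "real ^ ('m::{finite,linorder} + 'n::{finite,linorder}) \<Rightarrow> (real ^ ('m + 'n)) set \<Rightarrow> real \<Rightarrow> real
      \<Rightarrow> (real ^ 'n::{finite,linorder} ^ 'm::{finite,linorder}) set" where
  "pencil \<omega> W a b =
     {x. psi \<omega> ({v. x_tilde x *v v = 0} \<inter> W) \<ge> a \<and> phi \<omega> ((*v) (x_tilde x) ` W) \<le> b}"

definition rational_subspace :: "(real ^ 'd::finite) set \<Rightarrow> bool" where
  "rational_subspace W \<longleftrightarrow> (\<exists>B. B \<subseteq> {v. \<forall>i. v $ i \<in> \<rat>} \<and> independent B \<and> span B = W)"


section \<open>Real analytic submanifolds\<close>

text \<open>
  Real analyticity: \<open>f\<close> is near \<open>x\<close> the sum of an (unconditionally) convergent power series.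
  A multi-index is a function on \<^term>\<open>Basis\<close>.
\<close>

definition real_analytic_at :: "('a::euclidean_space \<Rightarrow> 'b::euclidean_space) \<Rightarrow> 'a \<Rightarrow> bool" where
  "real_analytic_at f x \<longleftrightarrow>
     (\<exists>r>0. \<exists>c :: ('a \<Rightarrow> nat) \<Rightarrow> 'b. \<forall>y\<in>ball x r.
        ((\<lambda>\<alpha>. (\<Prod>b\<in>Basis. ((y - x) \<bullet> b) ^ \<alpha> b) *\<^sub>R c \<alpha>) has_sum f y) (Basis \<rightarrow>\<^sub>E UNIV))"

text \<open>
  A \<open>p\<close>-dimensional local parametrization of \<open>M\<close> is an analytic immersion that is a homeomorphism
  onto a relatively open subset of \<open>M\<close>. As \<open>p\<close> is a number (and may be 0), its domain is an
  open subset of a coordinate copy \<open>span B\<close> of \<open>\<real>\<^sup>p\<close> in the ambient space, where \<open>B\<close> is a set of \<open>p\<close>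
  standard basis vectors. Asking for analyticity on an open set \<open>V\<close> of the ambient space
  is no restriction, since an analytic map on an open subset of \<open>span B\<close> can be composed with the
  orthogonal projection to \<open>span B\<close>; only the values on \<open>V \<inter> span B\<close> matter.
\<close>

definition local_parametrization ::
    "nat \<Rightarrow> 'a::euclidean_space set \<Rightarrow> 'a set \<times> 'a set \<times> ('a \<Rightarrow> 'a) \<Rightarrow> bool" where
  "local_parametrization p M = (\<lambda>(B, V, \<phi>).
     B \<subseteq> Basis \<and> card B = p \<and> open V \<and> (\<forall>y\<in>V. real_analytic_at \<phi> y) \<and>
     (\<forall>y\<in>V \<inter> span B. inj_on (frechet_derivative \<phi> (at y)) (span B)) \<and>
     openin (top_of_set M) (\<phi> ` (V \<inter> span B)) \<and>
     (\<exists>\<psi>. homeomorphism (V \<inter> span B) (\<phi> ` (V \<inter> span B)) \<phi> \<psi>))"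

definition analytic_submanifold :: "nat \<Rightarrow> 'a::euclidean_space set \<Rightarrow> bool" where
  "analytic_submanifold p M \<longleftrightarrow>
     (\<forall>x\<in>M. \<exists>B V \<phi>. local_parametrization p M (B, V, \<phi>) \<and> x \<in> \<phi> ` (V \<inter> span B))"


section \<open>The volume measure of a submanifold\<close>

text \<open>Lebesgue measure on the coordinate subspace \<open>span B\<close>; compare the definition of \<^term>\<open>lborel\<close>.\<close>

definition coord_lborel :: "'a::euclidean_space set \<Rightarrow> 'a measure" where
  "coord_lborel B = distr (\<Pi>\<^sub>M b\<in>B. lborel) borel (\<lambda>f. \<Sum>b\<in>B. f b *\<^sub>R b)"

text \<open>The determinant of the Gram matrix of the family \<open>D b\<close>, \<open>b \<in> B\<close> (Leibniz formula).\<close>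

definition gram_det :: "'a::euclidean_space set \<Rightarrow> ('a \<Rightarrow> 'a) \<Rightarrow> real" where
  "gram_det B D = (\<Sum>\<sigma> | \<sigma> permutes B. of_int (sign \<sigma>) * (\<Prod>b\<in>B. D b \<bullet> D (\<sigma> b)))"

text \<open>
  The volume measure in a local parametrization has density \<open>\<surd>(det (D\<phi>\<^sup>T D\<phi>))\<close> with respect to
  Lebesgue measure on the parameter domain. It is extended by 0 to a measure on the Borel sets of \<open>M\<close>.
\<close>

definition chart_volume :: "'a::euclidean_space set \<Rightarrow> 'a set \<times> 'a set \<times> ('a \<Rightarrow> 'a) \<Rightarrow> 'a measure" where
  "chart_volume M = (\<lambda>(B, V, \<phi>).
     distr
       (density (restrict_space (coord_lborel B) (V \<inter> span B))
         (\<lambda>y. ennreal (sqrt (gram_det B (frechet_derivative \<phi> (at y))))))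
       (restrict_space borel M) \<phi>)"

text \<open>
  The volume measure of \<open>M\<close> is the measure on the Borel sets of \<open>M\<close> whose restriction to the
  image of each local parametrization is the measure above. It is the supremum of these measures in
  the lattice of measures on \<open>M\<close>, because \<open>M\<close> is covered by countably many local parametrizations.
\<close>

definition volume_measure :: "nat \<Rightarrow> 'a::euclidean_space set \<Rightarrow> 'a measure" where
  "volume_measure p M = (SUP c\<in>{c. local_parametrization p M c}. chart_volume M c)"

lemma sets_chart_volume: "sets (chart_volume M c) = sets (restrict_space borel M)"
  by (simp add: chart_volume_def split: prod.splits)

lemma sets_volume_measure:
  assumes "analytic_submanifold p M" "M \<noteq> {}"
  shows "sets (volume_measure p M) = sets (restrict_space borel M)"
proof -
  from assms have "{c. local_parametrization p M c} \<noteq> {}"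
    by (auto simp: analytic_submanifold_def)
  then show ?thesis
    unfolding volume_measure_def by (subst sets_SUP[OF sets_chart_volume]) auto
qed

lemma space_volume_measure:
  assumes "analytic_submanifold p M" "M \<noteq> {}"
  shows "space (volume_measure p M) = M"
  using sets_eq_imp_space_eq[OF sets_volume_measure[OF assms]] by (simp add: space_restrict_space)

end

theory Submission
  imports Defs "HOL-Complex_Analysis.Complex_Analysis"
begin

text \<open>
  If \<open>\<bold>L\<close> is not connected at \<open>k\<close> for \<open>\<Lambda>\<^sub>x\<close>, then for all large \<open>t\<close> the vectors realizing the first \<open>k\<close> minima of
  \<open>a\<^sub>t \<Lambda>\<^sub>x\<close> are separated by a gap from the remaining vectors, and by continuity their span is
  \<open>a\<^sub>t u(x) W\<close> for one fixed rational subspace \<open>W\<close>. The covolume of the lattice in this span grows like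
  \<open>exp ((\<phi>(x~W) - \<psi>(ker x~ \<inter> W)) t)\<close>; if the exponent were positive, a pigeonhole (Blichfeldt) argument
  would produce a short lattice vector outside the span, so \<open>\<phi>(x~W) \<le> \<psi>(ker x~ \<inter> W)\<close>. There are countably many \<open>W\<close>.
  For each of them \<open>\<phi>\<close> and \<open>\<psi>\<close> are monotone functions of ranks of matrices depending analytically on
  \<open>x\<close>. Hence almost everywhere on \<open>M\<close> they attain their maximum \<open>b\<close> and minimum \<open>a\<close> over \<open>M\<close>, and \<open>b \<le> a\<close>
  would put \<open>M\<close> inside the weakly constraining pencil with bounds \<open>a\<close>, \<open>b\<close>, which is always proper.
\<close>

text \<open>The gap between two minima may be arbitrarily narrow, so it carries no quantitative
  information; its use is to pin down \<open>W\<close>. The estimate comes from integrality. In the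
  rows \<open>jump_coordinates W x\<close>, whose flow exponents add up to \<phi> - \<psi>, the
  Pluecker coordinate of a frame of integer vectors in \<open>W\<close> is zero or bounded below
  independently of the frame, and the flow multiplies it by exp((\<phi> - \<psi>) t). If this grew,
  a frame of short vectors with least nonzero coordinate could be improved by a vector from
  Blichfeldt's theorem. This does the work of Minkowski's second theorem without computing
  covolumes. On the analytic side, functions are restricted to lines in a chart: isolated zeros on
  lines give null sets by Fubini, and the identity theorem along segments. \<phi> and \<psi> are not
  analytic themselves; as the weights decrease, they are controlled by counts on initial segments,
  that is, by kernel dimensions that are generically minimal.\<close>

no_notation fps_nth (infixl \<open>$\<close> 75)

section \<open>Analytic functions of one real variable\<close>

text \<open>
  Real analyticity in one variable, phrased so that the isolation of zeros can be taken from the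
  theory of holomorphic functions.
\<close>

definition analytic_germ :: "(real \<Rightarrow> real) \<Rightarrow> real \<Rightarrow> bool" where
  "analytic_germ g s \<longleftrightarrow>
     (\<exists>G. G analytic_on {of_real s} \<and> (\<forall>\<^sub>F r in nhds s. complex_of_real (g r) = G (of_real r)))"

lemma analytic_germ_const: "analytic_germ (\<lambda>_. c) s"
  unfolding analytic_germ_def by (intro exI[of _ "\<lambda>_. of_real c"]) auto

lemma analytic_germ_add:
  assumes "analytic_germ f s" "analytic_germ g s"
  shows "analytic_germ (\<lambda>r. f r + g r) s"
proof -
  from assms obtain F G where "F analytic_on {of_real s}" "G analytic_on {of_real s}"
    "\<forall>\<^sub>F r in nhds s. complex_of_real (f r) = F (of_real r)"
    "\<forall>\<^sub>F r in nhds s. complex_of_real (g r) = G (of_real r)"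
    unfolding analytic_germ_def by blast
  then show ?thesis
    unfolding analytic_germ_def
    by (intro exI[of _ "\<lambda>z. F z + G z"]) (auto intro!: analytic_intros elim: eventually_elim2)
qed

lemma analytic_germ_mult:
  assumes "analytic_germ f s" "analytic_germ g s"
  shows "analytic_germ (\<lambda>r. f r * g r) s"
proof -
  from assms obtain F G where "F analytic_on {of_real s}" "G analytic_on {of_real s}"
    "\<forall>\<^sub>F r in nhds s. complex_of_real (f r) = F (of_real r)"
    "\<forall>\<^sub>F r in nhds s. complex_of_real (g r) = G (of_real r)"
    unfolding analytic_germ_def by blast
  then show ?thesis
    unfolding analytic_germ_def
    by (intro exI[of _ "\<lambda>z. F z * G z"]) (auto intro!: analytic_intros elim: eventually_elim2)
qed

text \<open>A zero of the holomorphic extension \<open>G\<close> at \<open>s\<close> is either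
  isolated or surrounded by zeros. Both alternatives, and the case of a nonzero value, are carried
  back to the real line along \<open>of_real\<close>.\<close>

lemma analytic_germ_dichotomy:
  assumes "analytic_germ g s"
  shows "(\<forall>\<^sub>F r in nhds s. g r = 0) \<or> (\<forall>\<^sub>F r in at s. g r \<noteq> 0)"
proof -
  obtain G where G: "G analytic_on {of_real s}"
    and ev: "\<forall>\<^sub>F r in nhds s. complex_of_real (g r) = G (of_real r)"
    using assms unfolding analytic_germ_def by blast
  have lim: "filterlim complex_of_real (nhds (of_real s)) (nhds s)"
    by (intro tendsto_of_real tendsto_ident_at filterlim_ident)
  have lim': "filterlim complex_of_real (at (of_real s)) (at s)"
    unfolding filterlim_at using lim
    by (auto simp: eventually_at_filter intro: filterlim_mono[OF _ order.refl at_within_le_nhds])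
  have cont: "isCont G (of_real s)"
    using G by (rule analytic_at_imp_isCont)
  show ?thesis
  proof (cases "G (of_real s) = 0 \<and> \<not> isolated_zero G (of_real s)")
    case True
    then have "\<forall>\<^sub>F z in nhds (of_real s). G z = 0"
      using non_isolated_zero_imp_eventually_zero'[OF G] by blast
    from eventually_compose_filterlim[OF this lim] have "\<forall>\<^sub>F r in nhds s. G (of_real r) = 0" .
    with ev have "\<forall>\<^sub>F r in nhds s. g r = 0" by eventually_elim simp
    then show ?thesis ..
  next
    case False
    have "\<forall>\<^sub>F z in at (of_real s). G z \<noteq> 0"
    proof (cases "G (of_real s) = 0")
      case True
      with False have "isolated_zero G (of_real s)" by blast
      then show ?thesis by (simp add: isolated_zero_def)
    next
      case False
      then show ?thesis using cont tendsto_imp_eventually_ne unfolding isCont_def by blast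
    qed
    from eventually_compose_filterlim[OF this lim'] have "\<forall>\<^sub>F r in at s. G (of_real r) \<noteq> 0" .
    moreover have "\<forall>\<^sub>F r in at s. complex_of_real (g r) = G (of_real r)"
      using ev by (simp add: eventually_at_filter eventually_mono)
    ultimately have "\<forall>\<^sub>F r in at s. g r \<noteq> 0" by eventually_elim auto
    then show ?thesis ..
  qed
qed

text \<open>By the dichotomy, vanishing near a point is a locally constant property on
  \<open>I\<close>, hence constant by connectedness; it fails at \<open>s1\<close>.\<close>

lemma analytic_germ_zeros_isolated:
  assumes an: "\<And>s. s \<in> I \<Longrightarrow> analytic_germ g s" and I: "connected I" "open I"
    and s1: "s1 \<in> I" "g s1 \<noteq> 0" and s: "s \<in> I"
  shows "\<forall>\<^sub>F r in at s. g r \<noteq> 0"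
proof -
  let ?P = "\<lambda>s. \<forall>\<^sub>F r in nhds s. g r = 0"
  have "\<exists>T. openin (top_of_set I) T \<and> a \<in> T \<and> (\<forall>x\<in>T. \<forall>y\<in>T. ?P x \<longrightarrow> ?P y)" if a: "a \<in> I" for a
    using analytic_germ_dichotomy[OF an[OF a]]
  proof
    assume "?P a"
    then obtain T where "open T" "a \<in> T" "\<forall>x\<in>T. g x = 0" unfolding eventually_nhds by blast
    then show ?thesis
      using a by (intro exI[of _ "T \<inter> I"]) (auto simp: eventually_nhds Int_commute openin_open_Int)
  next
    assume "\<forall>\<^sub>F r in at a. g r \<noteq> 0"
    then obtain T where T: "open T" "a \<in> T" "\<forall>x\<in>T. x \<noteq> a \<longrightarrow> g x \<noteq> 0"
      unfolding eventually_at_topological by blast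
    have "\<not> ?P x" if "x \<in> T" for x
    proof
      assume "?P x"
      then obtain U where U: "open U" "x \<in> U" "\<forall>x\<in>U. g x = 0" unfolding eventually_nhds by blast
      have "open (T \<inter> U)" "x \<in> T \<inter> U" using T U that by auto
      moreover have "T \<inter> U \<subseteq> {a}" using T U by blast
      ultimately show False by (metis not_open_singleton subset_singletonD empty_iff)
    qed
    then show ?thesis
      using T a by (intro exI[of _ "T \<inter> I"]) (auto simp: Int_commute openin_open_Int)
  qed
  note ind = connected_induction_simple[of I _ _ ?P, OF I(1) _ _ _ this]
  have "?P s \<Longrightarrow> ?P s1" using ind s s1 by blast
  moreover have "\<not> ?P s1" using s1 eventually_nhds_x_imp_x by blast
  ultimately show ?thesis using analytic_germ_dichotomy[OF an[OF s]] by blast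
qed

lemma analytic_germ_countable_zeros:
  assumes "\<And>s. s \<in> I \<Longrightarrow> analytic_germ g s" "connected I" "open I" "s1 \<in> I" "g s1 \<noteq> 0"
  shows "countable {s\<in>I. g s = 0}"
proof -
  have "\<not> y islimpt {s. g s = 0}" if "y \<in> I" for y
    using analytic_germ_zeros_isolated[OF assms that]
    unfolding islimpt_def eventually_at_topological by auto
  then have "{s. g s = 0} sparse_in I"
    using \<open>open I\<close> by (simp add: sparse_in_open)
  from sparse_imp_countable[OF \<open>open I\<close> this] show ?thesis
    by (simp add: Int_def)
qed

text \<open>Convergence at all real \<open>h\<close> below \<open>\<rho>\<close> bounds the complex
  radius of convergence from below, so the same coefficients define the holomorphic
  extension.\<close>

lemma analytic_germ_powser:
  fixes t :: "nat \<Rightarrow> real"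
  assumes "\<rho> > 0" and "\<And>h. \<bar>h\<bar> < \<rho> \<Longrightarrow> (\<lambda>n. t n * h ^ n) sums g (s + h)"
  shows "analytic_germ g s"
proof -
  define F where "F = Abs_fps (\<lambda>n. complex_of_real (t n))"
  have summ: "(\<lambda>n. complex_of_real (t n) * of_real h ^ n) sums of_real (g (s + h))" if "\<bar>h\<bar> < \<rho>" for h
    using sums_of_real[OF assms(2)[OF that]] by simp
  have R: "fps_conv_radius F \<ge> ereal \<rho>"
    unfolding fps_conv_radius_def F_def
    by (rule conv_radius_geI_ex') (use summ in \<open>auto simp: sums_iff\<close>)
  have "eval_fps F analytic_on {0}"
    using R assms(1) by (intro analytic_on_eval_fps) (auto simp: zero_ereal_def intro: less_le_trans[of _ "ereal \<rho>"])
  then have "(eval_fps F \<circ> (\<lambda>z. z - of_real s)) analytic_on {of_real s}"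
    by (intro analytic_on_compose) (auto intro!: analytic_intros)
  moreover have "\<forall>\<^sub>F r in nhds s. complex_of_real (g r) = (eval_fps F \<circ> (\<lambda>z. z - of_real s)) (of_real r)"
  proof -
    have "complex_of_real (g r) = (eval_fps F \<circ> (\<lambda>z. z - of_real s)) (of_real r)" if "dist r s < \<rho>" for r
      using summ[of "r - s"] that by (simp add: eval_fps_def F_def sums_iff dist_real_def)
    then show ?thesis using assms(1) by (auto simp: eventually_nhds_metric)
  qed
  ultimately show ?thesis unfolding analytic_germ_def by blast
qed

text \<open>On a line through the centre, the monomial with multi-index \<alpha> is a constant times
  \<open>h ^ N \<alpha>\<close>. Unconditional summation permits grouping by the total degree
  \<open>N \<alpha>\<close>, which leaves a power series in \<open>h\<close>.\<close>

lemma analytic_germ_line: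
  fixes f :: "'a::euclidean_space \<Rightarrow> 'b::euclidean_space"
  assumes "real_analytic_at f (y + s *\<^sub>R v)"
  shows "analytic_germ (\<lambda>s. f (y + s *\<^sub>R v) \<bullet> e) s"
proof -
  let ?x = "y + s *\<^sub>R v"
  let ?E = "Basis \<rightarrow>\<^sub>E (UNIV :: nat set) :: ('a \<Rightarrow> nat) set"
  obtain r c where "r > 0" and sum: "\<And>z. z \<in> ball ?x r \<Longrightarrow>
      ((\<lambda>\<alpha>. (\<Prod>b\<in>Basis. ((z - ?x) \<bullet> b) ^ \<alpha> b) *\<^sub>R c \<alpha>) has_sum f z) ?E"
    using assms unfolding real_analytic_at_def by blast
  \<comment> \<open>Keeps the point with parameter \<open>s + h\<close> inside the ball of
    convergence; the \<open>+ 1\<close> covers \<open>v = 0\<close>.\<close>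
  define \<rho> where "\<rho> = r / (norm v + 1)"
  have "\<rho> > 0" using \<open>r > 0\<close> by (simp add: \<rho>_def add_nonneg_pos)
  define t where "t \<alpha> = (\<Prod>b\<in>Basis. (v \<bullet> b) ^ \<alpha> b) * (c \<alpha> \<bullet> e)" for \<alpha>
  define N :: "('a \<Rightarrow> nat) \<Rightarrow> nat" where "N \<alpha> = (\<Sum>b\<in>Basis. \<alpha> b)" for \<alpha>
  have *: "((\<lambda>\<alpha>. h ^ N \<alpha> * t \<alpha>) has_sum (f (y + (s + h) *\<^sub>R v) \<bullet> e)) ?E" if "\<bar>h\<bar> < \<rho>" for h
  proof -
    have "\<bar>h\<bar> * norm v \<le> \<bar>h\<bar> * (norm v + 1)" by (simp add: mult_left_mono)
    also have "\<dots> < \<rho> * (norm v + 1)"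
      using that by (intro mult_strict_right_mono) (auto simp: add_nonneg_pos)
    also have "\<dots> = r" by (simp add: \<rho>_def add_nonneg_eq_0_iff)
    finally have "?x + h *\<^sub>R v \<in> ball ?x r" by (simp add: dist_norm)
    from has_sum_bounded_linear[OF bounded_linear_inner_left sum[OF this], of e]
    show ?thesis
      by (simp add: t_def N_def power_mult_distrib prod.distrib power_sum algebra_simps)
  qed
  define T where "T n = infsum t {\<alpha>\<in>?E. N \<alpha> = n}" for n
  have fib: "(t has_sum T n) {\<alpha>\<in>?E. N \<alpha> = n}" for n
  proof -
    \<comment> \<open>One nonzero parameter suffices: on a fibre of fixed degree the power of
      \<open>\<rho>/2\<close> is a nonzero constant and can be divided out.\<close>
    have "(\<lambda>\<alpha>. (\<rho>/2) ^ N \<alpha> * t \<alpha>) summable_on ?E"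
      using *[of "\<rho>/2"] \<open>\<rho> > 0\<close> by (auto simp: summable_on_def)
    then have "(\<lambda>\<alpha>. (\<rho>/2) ^ N \<alpha> * t \<alpha>) summable_on {\<alpha>\<in>?E. N \<alpha> = n}"
      by (rule summable_on_subset_banach) auto
    then have "(\<lambda>\<alpha>. (\<rho>/2) ^ n * t \<alpha>) summable_on {\<alpha>\<in>?E. N \<alpha> = n}"
      by (rule summable_on_cong[THEN iffD1, rotated]) auto
    then have "(\<lambda>\<alpha>. inverse ((\<rho>/2) ^ n) * ((\<rho>/2) ^ n * t \<alpha>)) summable_on {\<alpha>\<in>?E. N \<alpha> = n}"
      by (rule summable_on_cmult_right)
    then have "t summable_on {\<alpha>\<in>?E. N \<alpha> = n}"
      using \<open>\<rho> > 0\<close> by (simp add: mult.assoc[symmetric])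
    then show ?thesis unfolding T_def by (rule has_sum_infsum)
  qed
  have "(\<lambda>n. T n * h ^ n) sums (f (y + (s + h) *\<^sub>R v) \<bullet> e)" if "\<bar>h\<bar> < \<rho>" for h
  proof -
    have "((\<lambda>(n, \<alpha>). h ^ N \<alpha> * t \<alpha>) has_sum (f (y + (s + h) *\<^sub>R v) \<bullet> e))
        (SIGMA n:UNIV. {\<alpha>\<in>?E. N \<alpha> = n})"
      using *[OF that]
      by (rule has_sum_reindex_bij_witness[where i = snd and j = "\<lambda>\<alpha>. (N \<alpha>, \<alpha>)", THEN iffD1, rotated -1]) auto
    moreover have "((\<lambda>\<alpha>. (\<lambda>(n, \<alpha>). h ^ N \<alpha> * t \<alpha>) (n, \<alpha>)) has_sum (T n * h ^ n)) {\<alpha>\<in>?E. N \<alpha> = n}" for n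
    proof -
      have "((\<lambda>\<alpha>. h ^ n * t \<alpha>) has_sum (h ^ n * T n)) {\<alpha>\<in>?E. N \<alpha> = n}"
        by (intro has_sum_cmult_right fib)
      then show ?thesis
        by (subst has_sum_cong[where g = "\<lambda>\<alpha>. h ^ n * t \<alpha>"]) (auto simp: mult.commute)
    qed
    ultimately have "((\<lambda>n. T n * h ^ n) has_sum (f (y + (s + h) *\<^sub>R v) \<bullet> e)) UNIV"
      by (rule has_sum_SigmaD)
    then show ?thesis by (rule has_sum_imp_sums)
  qed
  then show ?thesis
    by (rule analytic_germ_powser[OF \<open>\<rho> > 0\<close>])
qed

section \<open>Null sets of analytic functions\<close>

text \<open>
  Replaces integration in polar coordinates around \<open>y0\<close>: by Fubini, almost every dilate
  \<open>{v. y0 + s v \<in> Z}\<close> is null, and the dilates are all null or all not null.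
\<close>

lemma null_set_if_lines_countable:
  fixes Z :: "'a::euclidean_space set"
  assumes Z: "Z \<in> sets borel" and lines: "\<And>v. countable {s::real. y0 + s *\<^sub>R v \<in> Z}"
  shows "Z \<in> null_sets lborel"
proof -
  have meas: "{x \<in> space (lborel \<Otimes>\<^sub>M lborel). y0 + fst x *\<^sub>R snd x \<notin> Z} \<in> sets (lborel \<Otimes>\<^sub>M (lborel :: 'a measure))"
    using Z by measurable
  have "AE v in lborel. AE s in lborel. y0 + s *\<^sub>R v \<notin> Z"
  proof (rule AE_I2)
    fix v :: 'a
    have "{s::real. y0 + s *\<^sub>R v \<in> Z} \<in> null_sets lborel"
      using lines by (rule countable_imp_null_set_lborel)
    then show "AE s in lborel. y0 + s *\<^sub>R v \<notin> Z"
      by (rule AE_I') auto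
  qed
  then have "AE s::real in lborel. AE v in lborel. y0 + s *\<^sub>R v \<notin> Z"
    using lborel_pair.AE_commute[where P = "\<lambda>s v. y0 + s *\<^sub>R v \<notin> Z"] meas by simp
  moreover have "AE s::real in lborel. s \<noteq> 0"
    by (rule AE_lborel_singleton)
  ultimately have "AE s::real in lborel. s \<noteq> 0 \<and> (AE v in lborel. y0 + s *\<^sub>R v \<notin> Z)"
    by eventually_elim simp
  moreover have "ae_filter (lborel::real measure) \<noteq> bot"
    by (simp add: ae_filter_eq_bot_iff)
  ultimately obtain s :: real where s: "s \<noteq> 0" "AE v in lborel. y0 + s *\<^sub>R v \<notin> Z"
    using eventually_happens by blast
  then have "emeasure lborel {v. y0 + s *\<^sub>R v \<in> Z} = 0"
    using Z by (subst (asm) AE_iff_measurable[OF _ refl]) auto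
  moreover have "emeasure lborel Z = ennreal (\<bar>s\<bar> ^ DIM('a)) * emeasure lborel {v. y0 + s *\<^sub>R v \<in> Z}"
    using Z by (subst lborel_affine[OF s(1), of y0])
      (simp add: emeasure_density_const emeasure_distr vimage_def)
  ultimately show ?thesis using Z by (auto simp: null_sets_def)
qed

text \<open>Only restrictions to lines are recorded: null sets are detected on the lines through one
  point, and zeros are propagated along segments.\<close>

definition line_analytic_on :: "'a::real_vector set \<Rightarrow> ('a \<Rightarrow> real) \<Rightarrow> bool" where
  "line_analytic_on U h \<longleftrightarrow> (\<forall>y v s. y + s *\<^sub>R v \<in> U \<longrightarrow> analytic_germ (\<lambda>s. h (y + s *\<^sub>R v)) s)"

lemma line_analytic_on_subset: "line_analytic_on U h \<Longrightarrow> T \<subseteq> U \<Longrightarrow> line_analytic_on T h"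
  unfolding line_analytic_on_def by blast

lemma convex_line_vimage:
  fixes C :: "'a::real_normed_vector set"
  assumes "open C" "convex C"
  shows "open {s::real. y + s *\<^sub>R v \<in> C}" "connected {s::real. y + s *\<^sub>R v \<in> C}"
proof -
  show "open {s::real. y + s *\<^sub>R v \<in> C}"
    using assms(1) continuous_open_vimage[of C "\<lambda>s::real. y + s *\<^sub>R v"]
    by (auto simp: vimage_def intro!: continuous_intros)
  have "convex {s::real. y + s *\<^sub>R v \<in> C}"
  proof (rule convexI)
    fix s t a b :: real
    assume *: "s \<in> {s. y + s *\<^sub>R v \<in> C}" "t \<in> {s. y + s *\<^sub>R v \<in> C}" "0 \<le> a" "0 \<le> b" "a + b = 1"
    then have "a *\<^sub>R (y + s *\<^sub>R v) + b *\<^sub>R (y + t *\<^sub>R v) \<in> C"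
      by (intro convexD[OF assms(2)]) auto
    moreover have "a *\<^sub>R (y + s *\<^sub>R v) + b *\<^sub>R (y + t *\<^sub>R v) = (a + b) *\<^sub>R y + (a * s + b * t) *\<^sub>R v"
      by (simp add: algebra_simps)
    ultimately show "a *\<^sub>R s + b *\<^sub>R t \<in> {s. y + s *\<^sub>R v \<in> C}" using * by simp
  qed
  then show "connected {s::real. y + s *\<^sub>R v \<in> C}" by (rule convex_connected)
qed

text \<open>A line through \<open>y0\<close> meets the convex set \<open>C\<close> in an interval,
  and \<open>h\<close> is nonzero at \<open>y0\<close>, so each such line has only countably many
  zeros.\<close>

lemma line_analytic_zero_set_null_convex:
  fixes h :: "'a::euclidean_space \<Rightarrow> real"
  assumes C: "open C" "convex C" and an: "line_analytic_on C h" and cont: "continuous_on C h"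
    and y0: "y0 \<in> C" "h y0 \<noteq> 0"
  shows "{y\<in>C. h y = 0} \<in> null_sets lborel"
proof (rule null_set_if_lines_countable)
  have "closedin (top_of_set C) {y\<in>C. h y = 0}"
    using continuous_closedin_preimage_constant[OF cont] by simp
  then obtain T where "closed T" "{y\<in>C. h y = 0} = C \<inter> T" by (auto simp: closedin_closed)
  then show "{y\<in>C. h y = 0} \<in> sets borel" using \<open>open C\<close> by auto
  fix v
  have "countable {s\<in>{s. y0 + s *\<^sub>R v \<in> C}. h (y0 + s *\<^sub>R v) = 0}"
    by (rule analytic_germ_countable_zeros[where ?s1.0 = 0])
      (use convex_line_vimage[OF C] an y0 in \<open>auto simp: line_analytic_on_def\<close>)
  then show "countable {s. y0 + s *\<^sub>R v \<in> {y\<in>C. h y = 0}}" by simp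
qed

text \<open>\<open>U\<close> may be disconnected, so one nonzero value is not enough:
  \<open>nz\<close> supplies a base point in each of the countably many convex pieces.\<close>

lemma line_analytic_zero_set_null:
  fixes h :: "'a::euclidean_space \<Rightarrow> real"
  assumes U: "open U" and an: "line_analytic_on U h" and cont: "continuous_on U h"
    and nz: "\<And>T. open T \<Longrightarrow> T \<subseteq> U \<Longrightarrow> T \<noteq> {} \<Longrightarrow> \<exists>y\<in>T. h y \<noteq> 0"
  shows "{y\<in>U. h y = 0} \<in> null_sets lborel"
proof -
  define F where "F = {C. open C \<and> convex C \<and> C \<subseteq> U}"
  obtain F' where F': "F' \<subseteq> F" "countable F'" "\<Union>F' = \<Union>F"
    using Lindelof[of F] unfolding F_def by blast
  have "U \<subseteq> \<Union>F"
  proof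
    fix y assume "y \<in> U"
    with U obtain e where "e > 0" "ball y e \<subseteq> U" using open_contains_ball by blast
    then show "y \<in> \<Union>F" unfolding F_def by (intro UnionI[of "ball y e"]) auto
  qed
  then have "U = \<Union>F'" using F'(3) unfolding F_def by blast
  then have eq: "{y\<in>U. h y = 0} = (\<Union>C\<in>F'. {y\<in>C. h y = 0})" by blast
  have "{y\<in>C. h y = 0} \<in> null_sets lborel" if "C \<in> F'" for C
  proof (cases "C = {}")
    case False
    have C: "open C" "convex C" "C \<subseteq> U" using that F' unfolding F_def by auto
    then obtain y0 where "y0 \<in> C" "h y0 \<noteq> 0" using nz False by blast
    then show ?thesis
      using C by (intro line_analytic_zero_set_null_convex line_analytic_on_subset[OF an] continuous_on_subset[OF cont])
  qed auto
  then show ?thesis unfolding eq using F'(2) by (intro null_sets_UN') auto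
qed

text \<open>A nonzero value at parameter 1 would make the zero at parameter 0 isolated on the
  line.\<close>

lemma line_analytic_identity:
  fixes h :: "'a::euclidean_space \<Rightarrow> real"
  assumes C: "open C" "convex C" and an: "\<And>s. y + s *\<^sub>R v \<in> C \<Longrightarrow> analytic_germ (\<lambda>s. h (y + s *\<^sub>R v)) s"
    and y: "y \<in> C" "\<forall>\<^sub>F s in nhds (0::real). h (y + s *\<^sub>R v) = 0" and v: "y + v \<in> C"
  shows "h (y + v) = 0"
proof (rule ccontr)
  assume "h (y + v) \<noteq> 0"
  have "\<forall>\<^sub>F s in at 0. h (y + s *\<^sub>R v) \<noteq> 0"
    by (rule analytic_germ_zeros_isolated[where I = "{s. y + s *\<^sub>R v \<in> C}" and ?s1.0 = 1])
      (use convex_line_vimage[OF C] an y v \<open>h (y + v) \<noteq> 0\<close> in auto)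
  moreover have "\<forall>\<^sub>F s in at (0::real). h (y + s *\<^sub>R v) = 0"
    using y(2) by (simp add: eventually_at_filter eventually_mono)
  ultimately have "\<forall>\<^sub>F s in at (0::real). False" by eventually_elim simp
  then show False by simp
qed

section \<open>Coordinate subspaces and their Lebesgue measure\<close>

definition coord_proj :: "'a::euclidean_space set \<Rightarrow> 'a \<Rightarrow> 'a" where
  "coord_proj B y = (\<Sum>b\<in>B. (y \<bullet> b) *\<^sub>R b)"

lemma linear_coord_proj: "linear (coord_proj B)"
  unfolding coord_proj_def
  by (intro linear_compose_sum ballI linearI) (auto simp: inner_add_left algebra_simps)

lemma coord_proj_in_span: "coord_proj B y \<in> span B"
  unfolding coord_proj_def by (intro span_sum span_scale span_base)

lemma coord_proj_span:
  assumes "B \<subseteq> Basis" "y \<in> span B"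
  shows "coord_proj B y = y"
proof -
  have fin: "finite B" using assms(1) finite_Basis finite_subset by blast
  from assms(2) show ?thesis
  proof (induction rule: span_induct_alt)
    case base
    then show ?case by (simp add: coord_proj_def)
  next
    case (step c x y)
    have "coord_proj B x = (\<Sum>b\<in>B. if b = x then x else 0)"
      unfolding coord_proj_def
      by (intro sum.cong refl) (use step(1) assms(1) in \<open>auto simp: inner_Basis subset_iff\<close>)
    also have "\<dots> = x" using fin step(1) by simp
    finally show ?case
      using step by (simp add: linear_add[OF linear_coord_proj] linear_scale[OF linear_coord_proj])
  qed
qed

lemma continuous_on_coord_proj: "continuous_on A (coord_proj B)"
  using linear_coord_proj by (rule linear_continuous_on[OF linear_linear[THEN iffD2]])

text \<open>Splitting the coordinates into \<open>B\<close> and \<open>C = Basis - B\<close>, the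
  preimage of \<open>N\<close> under the projection is a product of \<open>N\<close> with the full
  space over \<open>C\<close>. The second factor has nonzero measure (infinite, or 1 if
  \<open>C\<close> is empty), so the first must have measure 0. This transfers null sets from the
  ambient space to the domain of a chart.\<close>

lemma coord_lborel_null:
  fixes N :: "'a::euclidean_space set"
  assumes B: "B \<subseteq> Basis" and N: "N \<in> sets borel" and null: "emeasure lborel {y. coord_proj B y \<in> N} = 0"
  shows "emeasure (coord_lborel B) N = 0"
proof -
  interpret product_sigma_finite "\<lambda>_::'a. lborel :: real measure" ..
  have fin: "finite B" using B finite_Basis finite_subset by blast
  define C where "C = Basis - B"
  have finC: "finite C" and BC: "B \<inter> C = {}" "B \<union> C = Basis" using B by (auto simp: C_def)
  let ?PB = "Pi\<^sub>M B (\<lambda>_. lborel :: real measure)" and ?PC = "Pi\<^sub>M C (\<lambda>_. lborel :: real measure)"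
  define N' where "N' = {f\<in>space ?PB. (\<Sum>b\<in>B. f b *\<^sub>R b) \<in> N}"
  have mB: "(\<lambda>f. \<Sum>b\<in>B. f b *\<^sub>R b) \<in> borel_measurable ?PB" by measurable
  have mBasis: "(\<lambda>f. \<Sum>b\<in>Basis. f b *\<^sub>R (b::'a)) \<in> borel_measurable (Pi\<^sub>M Basis (\<lambda>_. lborel :: real measure))"
    by measurable
  have N': "N' \<in> sets ?PB"
    using measurable_sets[OF mB N] by (simp add: N'_def vimage_def Int_def conj_commute)
  have mP: "coord_proj B \<in> borel_measurable borel"
    by (intro borel_measurable_continuous_onI continuous_on_coord_proj)
  have S: "{y. coord_proj B y \<in> N} \<in> sets borel"
    using measurable_sets[OF mP N] by (simp add: vimage_def)
  have "0 = emeasure (distr (Pi\<^sub>M Basis (\<lambda>_. lborel :: real measure)) borel (\<lambda>f. \<Sum>b\<in>Basis. f b *\<^sub>R b)) {y. coord_proj B y \<in> N}"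
    using null by (simp add: lborel_def[where 'a = 'a] lborel_eq_real)
  also have "\<dots> = emeasure (Pi\<^sub>M Basis (\<lambda>_. lborel :: real measure))
      {f\<in>space (Pi\<^sub>M Basis (\<lambda>_. lborel :: real measure)). (\<Sum>b\<in>B. f b *\<^sub>R b) \<in> N}"
  proof (subst emeasure_distr[OF mBasis S], rule arg_cong2[where f = emeasure, OF refl])
    have "coord_proj B (\<Sum>b\<in>Basis. f b *\<^sub>R b) = (\<Sum>b\<in>B. f b *\<^sub>R b)" for f :: "'a \<Rightarrow> real"
      unfolding coord_proj_def using B by (intro sum.cong refl) (auto simp: inner_sum_left_Basis)
    then show "(\<lambda>f. \<Sum>b\<in>Basis. f b *\<^sub>R b) -` {y. coord_proj B y \<in> N} \<inter> space (Pi\<^sub>M Basis (\<lambda>_. lborel))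
      = {f\<in>space (Pi\<^sub>M Basis (\<lambda>_. lborel :: real measure)). (\<Sum>b\<in>B. f b *\<^sub>R b) \<in> N}"
      by auto
  qed
  also have "\<dots> = emeasure (distr (?PB \<Otimes>\<^sub>M ?PC) (Pi\<^sub>M (B \<union> C) (\<lambda>_. lborel :: real measure)) (merge B C))
      {f\<in>space (Pi\<^sub>M Basis (\<lambda>_. lborel :: real measure)). (\<Sum>b\<in>B. f b *\<^sub>R b) \<in> N}"
    using distr_merge[OF BC(1) fin finC] by (simp only: BC(2))
  also have "\<dots> = emeasure (?PB \<Otimes>\<^sub>M ?PC) (N' \<times> space ?PC)"
  proof (subst emeasure_distr)
    have "(\<lambda>f. \<Sum>b\<in>B. f b *\<^sub>R b) \<in> borel_measurable (Pi\<^sub>M Basis (\<lambda>_. lborel :: real measure))"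
      using B by (intro borel_measurable_sum borel_measurable_scaleR measurable_component_singleton) auto
    from measurable_sets[OF this N]
    show "{f\<in>space (Pi\<^sub>M Basis (\<lambda>_. lborel :: real measure)). (\<Sum>b\<in>B. f b *\<^sub>R b) \<in> N}
      \<in> sets (Pi\<^sub>M (B \<union> C) (\<lambda>_. lborel))"
      using BC by (simp add: vimage_def Int_def conj_commute)
    have "(\<Sum>b\<in>B. merge B C (f, g) b *\<^sub>R b) = (\<Sum>b\<in>B. f b *\<^sub>R b)" for f g :: "'a \<Rightarrow> real"
      by (intro sum.cong) (auto simp: merge_def)
    then show "emeasure (?PB \<Otimes>\<^sub>M ?PC) (merge B C -` {f\<in>space (Pi\<^sub>M Basis (\<lambda>_. lborel)). (\<Sum>b\<in>B. f b *\<^sub>R b) \<in> N}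
       \<inter> space (?PB \<Otimes>\<^sub>M ?PC)) = emeasure (?PB \<Otimes>\<^sub>M ?PC) (N' \<times> space ?PC)"
      using BC by (intro arg_cong2[where f = emeasure] refl)
        (auto simp: N'_def space_pair_measure space_PiM PiE_def Pi_def merge_def extensional_def)
  qed measurable
  also have "\<dots> = emeasure ?PB N' * emeasure ?PC (space ?PC)"
  proof -
    interpret PC: sigma_finite_measure ?PC by (rule sigma_finite[OF finC])
    show ?thesis by (rule PC.emeasure_pair_measure_Times[OF N']) auto
  qed
  finally have "emeasure ?PB N' * emeasure ?PC (space ?PC) = 0" by simp
  moreover have "emeasure ?PC (space ?PC) \<noteq> 0"
    using finC by (simp add: space_PiM emeasure_PiM)
  ultimately have "emeasure ?PB N' = 0" by simp
  then show ?thesis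
    unfolding coord_lborel_def by (subst emeasure_distr[OF mB N]) (simp add: N'_def vimage_def Int_def conj_commute)
qed

section \<open>The volume measure and the identity theorem\<close>

text \<open>The supremum lies below every common upper bound, so it suffices to find an upper bound
  that does not charge \<open>N\<close>: the measure that is 0 on measurable subsets of
  \<open>N\<close> and infinite on all other measurable sets.\<close>

lemma emeasure_SUP_null:
  fixes \<mu> :: "'c \<Rightarrow> 'a measure"
  assumes sets: "\<And>c. c \<in> C \<Longrightarrow> sets (\<mu> c) = sets K" and N: "N \<in> sets K"
    and null: "\<And>c. c \<in> C \<Longrightarrow> emeasure (\<mu> c) N = 0"
  shows "emeasure (SUP c\<in>C. \<mu> c) N = 0"
proof (cases "C = {}")
  case False
  define \<kappa> where "\<kappa> = distr (count_space (space K)) K id"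
  \<comment> \<open>the largest measure for which \<open>N\<close> is a null set\<close>
  define \<nu> where "\<nu> = density \<kappa> (\<lambda>x. \<infinity> * indicator (space K - N) x)"
  have sets_\<nu>: "sets \<nu> = sets K" by (simp add: \<nu>_def \<kappa>_def)
  have space_\<nu>: "space \<nu> = space K" by (rule sets_eq_imp_space_eq[OF sets_\<nu>])
  have em: "emeasure \<nu> A = \<infinity> * emeasure (count_space (space K)) (A - N)" if A: "A \<in> sets K" for A
  proof -
    have sub: "A \<subseteq> space K" using A sets.sets_into_space by blast
    have "emeasure \<nu> A = (\<integral>\<^sup>+x. \<infinity> * indicator (A - N) x \<partial>\<kappa>)"
      unfolding \<nu>_def using A N sub
      by (subst emeasure_density) (auto simp: \<kappa>_def indicator_def intro!: nn_integral_cong)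
    also have "\<dots> = \<infinity> * emeasure \<kappa> (A - N)"
      using A N by (subst nn_integral_cmult_indicator) (auto simp: \<kappa>_def)
    also have "emeasure \<kappa> (A - N) = emeasure (count_space (space K)) (A - N)"
      unfolding \<kappa>_def using A N sub
      by (subst emeasure_distr) (auto intro!: arg_cong2[where f = emeasure])
    finally show ?thesis .
  qed
  have "\<mu> c \<le> \<nu>" if c: "c \<in> C" for c
  proof -
    have "emeasure (\<mu> c) A \<le> emeasure \<nu> A" for A
    proof (cases "A \<in> sets K")
      case True
      show ?thesis
      proof (cases "A \<subseteq> N")
        case True
        then have "emeasure (\<mu> c) A \<le> emeasure (\<mu> c) N"
          using N sets[OF c] by (intro emeasure_mono) auto
        then show ?thesis using null[OF c] by simp
      next
        case False
        then have "emeasure (count_space (space K)) (A - N) \<noteq> 0"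
          using sets.sets_into_space[OF \<open>A \<in> sets K\<close>] by (subst emeasure_count_space_eq_0) auto
        then show ?thesis unfolding em[OF \<open>A \<in> sets K\<close>] by (simp add: ennreal_top_mult)
      qed
    qed (use sets[OF c] in \<open>simp add: emeasure_notin_sets\<close>)
    then show ?thesis
      using sets[OF c] sets_\<nu> sets_eq_imp_space_eq[OF sets[OF c]] space_\<nu>
      by (intro less_eq_measure.intros(3)) (auto simp: le_fun_def)
  qed
  then have le: "(SUP c\<in>C. \<mu> c) \<le> \<nu>" by (rule SUP_least)
  have "sets (SUP c\<in>C. \<mu> c) = sets K"
    using sets_SUP[of C \<mu>, OF sets False] .
  with le sets_\<nu> have "emeasure (SUP c\<in>C. \<mu> c) N \<le> emeasure \<nu> N"
    by (intro le_measureD3) (simp_all only:)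
  also have "\<dots> = 0" using em[OF N] by simp
  finally show ?thesis by simp
qed simp

text \<open>Analyticity of \<open>f\<close> tested on curves: exactly the closure property that
  allows \<open>f\<close> to be composed with a chart along a line.\<close>

definition germ_preserving :: "('a::euclidean_space \<Rightarrow> real) \<Rightarrow> bool" where
  "germ_preserving f \<longleftrightarrow>
     (\<forall>\<gamma> s. (\<forall>e\<in>Basis. analytic_germ (\<lambda>r. \<gamma> r \<bullet> e) s) \<longrightarrow> analytic_germ (\<lambda>r. f (\<gamma> r)) s)"

lemma local_parametrizationD:
  assumes "local_parametrization p M (B, V, \<phi>)"
  shows "B \<subseteq> Basis" "open V" "y \<in> V \<Longrightarrow> real_analytic_at \<phi> y"
    "continuous_on (V \<inter> span B) \<phi>" "\<phi> ` (V \<inter> span B) \<subseteq> M"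
    "open T \<Longrightarrow> openin (top_of_set M) (\<phi> ` (V \<inter> T \<inter> span B))"
proof -
  obtain \<psi> where op: "openin (top_of_set M) (\<phi> ` (V \<inter> span B))"
    and hom: "homeomorphism (V \<inter> span B) (\<phi> ` (V \<inter> span B)) \<phi> \<psi>"
    using assms unfolding local_parametrization_def by auto
  show "B \<subseteq> Basis" "open V" "y \<in> V \<Longrightarrow> real_analytic_at \<phi> y"
    using assms unfolding local_parametrization_def by auto
  show "continuous_on (V \<inter> span B) \<phi>" using hom by (simp add: homeomorphism_def)
  show "\<phi> ` (V \<inter> span B) \<subseteq> M" using op by (rule openin_imp_subset)
  assume "open T"
  then have "openin (top_of_set (V \<inter> span B)) (V \<inter> T \<inter> span B)"
    by (auto simp: openin_open)
  from openin_trans[OF homeomorphism_imp_open_map[OF hom this] op]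
  show "openin (top_of_set M) (\<phi> ` (V \<inter> T \<inter> span B))" .
qed

lemma chart_line_analytic:
  assumes lp: "local_parametrization p M (B, V, \<phi>)" and f: "germ_preserving f"
  shows "line_analytic_on {y. coord_proj B y \<in> V} (\<lambda>y. f (\<phi> (coord_proj B y)))"
  unfolding line_analytic_on_def
proof (intro allI impI)
  fix y v :: 'a and s :: real
  let ?P = "coord_proj B"
  assume "y + s *\<^sub>R v \<in> {y. ?P y \<in> V}"
  then have "?P y + s *\<^sub>R ?P v \<in> V"
    by (simp add: linear_add[OF linear_coord_proj] linear_scale[OF linear_coord_proj])
  then have "real_analytic_at \<phi> (?P y + s *\<^sub>R ?P v)"
    using local_parametrizationD(3)[OF lp] by blast
  then have "\<forall>e\<in>Basis. analytic_germ (\<lambda>s. \<phi> (?P y + s *\<^sub>R ?P v) \<bullet> e) s"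
    using analytic_germ_line by blast
  with f have "analytic_germ (\<lambda>s. f (\<phi> (?P y + s *\<^sub>R ?P v))) s"
    unfolding germ_preserving_def by (elim allE[of _ "\<lambda>s. \<phi> (?P y + s *\<^sub>R ?P v)"] allE[of _ s]) blast
  then show "analytic_germ (\<lambda>s. f (\<phi> (?P (y + s *\<^sub>R v)))) s"
    by (simp add: linear_add[OF linear_coord_proj] linear_scale[OF linear_coord_proj])
qed

text \<open>Vanishing on a neighbourhood in \<open>M\<close> is a locally constant property: two
  points in the image of a parameter ball are joined by a segment of parameters, along which zeros
  propagate. Connectedness of \<open>M\<close> does the rest.\<close>

lemma submanifold_identity:
  fixes f :: "'a::euclidean_space \<Rightarrow> real"
  assumes M: "analytic_submanifold p M" "connected M" and f: "germ_preserving f"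
    and T: "openin (top_of_set M) T" "T \<noteq> {}" "\<And>x. x \<in> T \<Longrightarrow> f x = 0" and x: "x \<in> M"
  shows "f x = 0"
proof -
  define Q where "Q x \<longleftrightarrow> (\<exists>T. openin (top_of_set M) T \<and> x \<in> T \<and> (\<forall>z\<in>T. f z = 0))" for x
  obtain x0 where x0: "x0 \<in> T" using T by blast
  have "Q x"
  proof (rule connected_induction_simple[of M x0 x Q])
    show "x0 \<in> M" using T(1) x0 openin_imp_subset by blast
    show "Q x0" unfolding Q_def using T x0 by blast
    fix a assume "a \<in> M"
    with M(1) obtain B V \<phi> where lp: "local_parametrization p M (B, V, \<phi>)" and a: "a \<in> \<phi> ` (V \<inter> span B)"
      unfolding analytic_submanifold_def by blast
    note D = local_parametrizationD[OF lp]
    obtain y where y: "y \<in> V" "y \<in> span B" "a = \<phi> y" using a by blast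
    obtain e where e: "e > 0" "ball y e \<subseteq> V" using D(2) y(1) open_contains_ball by blast
    \<comment> \<open>A ball instead of all of \<open>V\<close>, so that segments between parameters
      stay in the domain.\<close>
    define U where "U = \<phi> ` (V \<inter> ball y e \<inter> span B)"
    have opU: "openin (top_of_set M) U" unfolding U_def by (rule D(6)) simp
    have "Q z" if "u \<in> U" "z \<in> U" "Q u" for u z
    proof -
      obtain T' where T': "openin (top_of_set M) T'" "u \<in> T'" "\<forall>z\<in>T'. f z = 0"
        using \<open>Q u\<close> unfolding Q_def by blast
      obtain y2 where y2: "y2 \<in> ball y e" "y2 \<in> span B" "u = \<phi> y2" using \<open>u \<in> U\<close> unfolding U_def by blast
      have ev: "\<exists>r>0. \<forall>w\<in>span B. dist w y2 < r \<longrightarrow> f (\<phi> w) = 0"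
      proof -
        obtain W where W: "open W" "T' = M \<inter> W" using T'(1) by (auto simp: openin_open)
        have "continuous_on (V \<inter> span B) \<phi>" by (rule D(4))
        then obtain W' where W': "open W'" "W' \<inter> (V \<inter> span B) = \<phi> -` W \<inter> (V \<inter> span B)"
          using W(1) unfolding continuous_on_open_invariant by blast
        have "y2 \<in> \<phi> -` W \<inter> (V \<inter> span B)" using W T' y2 e by auto
        then have "y2 \<in> W' \<inter> V" unfolding W'(2)[symmetric] by blast
        moreover have "open (W' \<inter> V)" using W'(1) D(2) by blast
        ultimately obtain r where r: "r > 0" "ball y2 r \<subseteq> W' \<inter> V" using open_contains_ball by blast
        have "f (\<phi> w) = 0" if "w \<in> span B" "dist w y2 < r" for w
        proof -
          have "w \<in> W' \<inter> V" using that r by (auto simp: dist_commute)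
          then have "\<phi> w \<in> W" "\<phi> w \<in> M" using W'(2) D(5) that(1) by blast+
          then show ?thesis using T' W by blast
        qed
        then show ?thesis using r by blast
      qed
      have zero: "f (\<phi> y1) = 0" if y1: "y1 \<in> ball y e" "y1 \<in> span B" for y1
      proof -
        have span: "y2 + s *\<^sub>R (y1 - y2) \<in> span B" for s
          using y1 y2 by (intro span_add span_scale span_diff)
        have proj: "coord_proj B (y2 + s *\<^sub>R (y1 - y2)) = y2 + s *\<^sub>R (y1 - y2)" for s
          by (rule coord_proj_span[OF D(1) span])
        have "f (\<phi> (y2 + (y1 - y2))) = 0"
        proof (rule line_analytic_identity[where C = "ball y e" and h = "\<lambda>y. f (\<phi> y)"])
          fix s :: real assume "y2 + s *\<^sub>R (y1 - y2) \<in> ball y e"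
          then have "coord_proj B (y2 + s *\<^sub>R (y1 - y2)) \<in> V" using e proj by auto
          then have "analytic_germ (\<lambda>s. f (\<phi> (coord_proj B (y2 + s *\<^sub>R (y1 - y2))))) s"
            using chart_line_analytic[OF lp f] unfolding line_analytic_on_def by blast
          then show "analytic_germ (\<lambda>s. f (\<phi> (y2 + s *\<^sub>R (y1 - y2)))) s"
            unfolding proj .
        next
          obtain r where r: "r > 0" "\<forall>w\<in>span B. dist w y2 < r \<longrightarrow> f (\<phi> w) = 0" using ev by blast
          have "((\<lambda>s. y2 + s *\<^sub>R (y1 - y2)) \<longlongrightarrow> y2 + 0 *\<^sub>R (y1 - y2)) (nhds 0)"
            by (intro tendsto_intros filterlim_ident)
          then have "\<forall>\<^sub>F s in nhds 0. dist (y2 + s *\<^sub>R (y1 - y2)) y2 < r"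
            using r(1) by (auto simp: tendsto_iff)
          then show "\<forall>\<^sub>F s in nhds 0. f (\<phi> (y2 + s *\<^sub>R (y1 - y2))) = 0"
            by eventually_elim (use r span in blast)
        qed (use y1 y2 in auto)
        then show ?thesis by simp
      qed
      then show "Q z" unfolding Q_def using opU \<open>z \<in> U\<close> by (intro exI[of _ U]) (auto simp: U_def)
    qed
    moreover have "a \<in> U" unfolding U_def using y e by auto
    ultimately show "\<exists>T. openin (top_of_set M) T \<and> a \<in> T \<and> (\<forall>x\<in>T. \<forall>y\<in>T. Q x \<longrightarrow> Q y)"
      using opU by blast
  qed (use M x in auto)
  then show ?thesis unfolding Q_def by blast
qed

text \<open>The function \<open>f \<circ> \<phi>\<close> lives on \<open>span B\<close>, which is in
  general null in the ambient space. Composed with \<open>coord_proj B\<close> it becomes a function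
  on the open set \<open>U\<close>, where the line criterion applies; the null set then descends to
  \<open>coord_lborel B\<close> and to the density.\<close>

lemma chart_volume_null:
  fixes f :: "'a::euclidean_space \<Rightarrow> real"
  assumes lp: "local_parametrization p M (B, V, \<phi>)" and f: "germ_preserving f" "continuous_on UNIV f"
    and nz: "\<And>T. openin (top_of_set M) T \<Longrightarrow> T \<noteq> {} \<Longrightarrow> \<exists>x\<in>T. f x \<noteq> 0"
  shows "emeasure (chart_volume M (B, V, \<phi>)) {x\<in>M. f x = 0} = 0"
proof -
  note D = local_parametrizationD[OF lp]
  let ?P = "coord_proj B" and ?S = "V \<inter> span B"
  define U where "U = {y. ?P y \<in> V}"
  have U: "open U" unfolding U_def
    using open_vimage[OF D(2) continuous_on_coord_proj[of UNIV]] by (simp add: vimage_def)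
  have cont: "continuous_on U (\<lambda>y. f (\<phi> (?P y)))"
    by (intro continuous_on_compose2[OF f(2)] continuous_on_compose2[OF D(4)] continuous_on_coord_proj)
      (auto simp: U_def coord_proj_in_span)
  have null: "{y\<in>U. f (\<phi> (?P y)) = 0} \<in> null_sets lborel"
  proof (rule line_analytic_zero_set_null[OF U _ cont])
    show "line_analytic_on U (\<lambda>y. f (\<phi> (?P y)))"
      unfolding U_def by (rule chart_line_analytic[OF lp f(1)])
    fix T assume T: "open T" "T \<subseteq> U" "T \<noteq> {}"
    then obtain y where y: "y \<in> T" by blast
    \<comment> \<open>The slice of \<open>T\<close> through \<open>y\<close> parallel to
      \<open>span B\<close>, moved into \<open>span B\<close> by removing the normal component of
      \<open>y\<close>.\<close>
    define T' where "T' = {w. w + (y - ?P y) \<in> T}"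
    have "open T'" unfolding T'_def
      using continuous_open_vimage[OF T(1), of "\<lambda>w. w + (y - ?P y)"]
      by (auto simp: vimage_def intro!: continuous_intros)
    moreover have "?P y \<in> V \<inter> T' \<inter> span B"
      using y T coord_proj_in_span[of B y] by (auto simp: T'_def U_def)
    moreover from \<open>open T'\<close> have "openin (top_of_set M) (\<phi> ` (V \<inter> T' \<inter> span B))" by (rule D(6))
    ultimately obtain x where x: "x \<in> \<phi> ` (V \<inter> T' \<inter> span B)" "f x \<noteq> 0"
      using nz by (metis empty_iff imageI)
    from x(1) obtain w where w: "w \<in> V" "w \<in> T'" "w \<in> span B" "x = \<phi> w" by (elim imageE IntE)
    have "?P (w + (y - ?P y)) = w"
      using coord_proj_span[OF D(1) w(3)] coord_proj_span[OF D(1) coord_proj_in_span, of y]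
      by (simp add: linear_add[OF linear_coord_proj] linear_diff[OF linear_coord_proj])
    then show "\<exists>y\<in>T. f (\<phi> (?P y)) \<noteq> 0"
      using w x by (intro bexI[of _ "w + (y - ?P y)"]) (auto simp: T'_def)
  qed
  have S: "?S \<in> sets borel" using D(2) by (simp add: borel_closed closed_subspace)
  have sets_cl: "sets (coord_lborel B) = sets borel" by (simp add: coord_lborel_def)
  have space_cl: "space (coord_lborel B) = UNIV" by (simp add: coord_lborel_def)
  define N where "N = {y\<in>?S. f (\<phi> y) = 0}"
  have contS: "continuous_on ?S (\<lambda>y. f (\<phi> y))"
    by (intro continuous_on_compose2[OF f(2)] D(4)) auto
  have N: "N \<in> sets borel"
  proof -
    have "closedin (top_of_set ?S) N"
      unfolding N_def using continuous_closedin_preimage_constant[OF contS] by simp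
    then obtain T where "closed T" "N = ?S \<inter> T" by (auto simp: closedin_closed)
    then show ?thesis using S by auto
  qed
  have "{y. ?P y \<in> N} = {y\<in>U. f (\<phi> (?P y)) = 0}"
    by (auto simp: N_def U_def coord_proj_in_span)
  then have "emeasure lborel {y. ?P y \<in> N} = 0" using null by auto
  then have cl: "emeasure (coord_lborel B) N = 0" by (rule coord_lborel_null[OF D(1) N])
  define R where "R = restrict_space (coord_lborel B) ?S"
  have R0: "emeasure R N = 0"
    unfolding R_def using cl S by (subst emeasure_restrict_space) (auto simp: sets_cl N_def)
  have NR: "N \<in> sets R"
    unfolding R_def using S N by (auto simp: sets_restrict_space_iff sets_cl N_def)
  have sR: "sets R = sets (restrict_space borel ?S)"
    unfolding R_def by (rule sets_restrict_space_cong[OF sets_cl])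
  have m\<phi>: "\<phi> \<in> measurable R (restrict_space borel M)"
  proof (rule measurable_restrict_space2)
    show "\<phi> \<in> space R \<rightarrow> M" using D(5) by (auto simp: R_def space_restrict_space space_cl)
    show "\<phi> \<in> borel_measurable R"
      using borel_measurable_continuous_on_restrict[OF D(4)] measurable_cong_sets[OF sR refl] by blast
  qed
  have Z: "{x\<in>M. f x = 0} \<in> sets (restrict_space borel M)"
  proof -
    have "closed {x. f x = 0}" using f(2) by (intro closed_Collect_eq) auto
    then have "M \<inter> {x. f x = 0} \<in> sets (restrict_space borel M)"
      by (auto simp: sets_restrict_space)
    then show ?thesis by (simp add: Int_def)
  qed
  define g where "g y = ennreal (sqrt (gram_det B (frechet_derivative \<phi> (at y))))" for y
  have eq: "\<phi> -` {x\<in>M. f x = 0} \<inter> space (density R g) = N"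
    using D(5) by (auto simp: R_def space_restrict_space space_cl N_def)
  have "emeasure (density R g) N = 0"
  proof -
    have "(\<integral>\<^sup>+ x. g x * indicator N x \<partial>R) = (\<integral>\<^sup>+ x. 0 \<partial>R)"
    proof (rule nn_integral_cong_AE)
      have "N \<in> null_sets R" using R0 NR by (auto simp: null_sets_def)
      from AE_not_in[OF this] show "AE x in R. g x * indicator N x = 0" by eventually_elim simp
    qed
    \<comment> \<open>Whether or not \<open>g\<close> is measurable, \<open>density\<close> gives
      \<open>N\<close> either this integral or the default 0.\<close>
    then show ?thesis unfolding density_def by (simp add: emeasure_measure_of_conv)
  qed
  moreover have "chart_volume M (B, V, \<phi>) = distr (density R g) (restrict_space borel M) \<phi>"
    by (simp add: chart_volume_def R_def g_def[abs_def])
  ultimately show ?thesis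
    using m\<phi> Z eq by (simp add: emeasure_distr)
qed

text \<open>By the identity theorem, one nonzero value \<open>f x0\<close> prevents \<open>f\<close>
  from vanishing on any nonempty relatively open set, which is the condition required in every
  chart.\<close>

lemma AE_volume_measure_nonzero:
  fixes f :: "'a::euclidean_space \<Rightarrow> real"
  assumes M: "analytic_submanifold p M" "connected M" and f: "germ_preserving f" "continuous_on UNIV f"
    and x0: "x0 \<in> M" "f x0 \<noteq> 0"
  shows "AE x in volume_measure p M. f x \<noteq> 0"
proof -
  have "closed {x. f x = 0}" using f(2) by (intro closed_Collect_eq) auto
  then have Z: "{x\<in>M. f x = 0} \<in> sets (restrict_space borel M)"
    by (auto simp: sets_restrict_space)
  have "emeasure (volume_measure p M) {x\<in>M. f x = 0} = 0"
    unfolding volume_measure_def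
  proof (rule emeasure_SUP_null[OF sets_chart_volume Z])
    fix c :: "'a set \<times> 'a set \<times> ('a \<Rightarrow> 'a)" assume c: "c \<in> {c. local_parametrization p M c}"
    obtain B V \<phi> where "c = (B, V, \<phi>)" by (cases c)
    moreover have "\<exists>x\<in>T. f x \<noteq> 0" if "openin (top_of_set M) T" "T \<noteq> {}" for T
      using submanifold_identity[OF M f(1) that _ x0(1)] x0(2) by blast
    ultimately show "emeasure (chart_volume M c) {x\<in>M. f x = 0} = 0"
      using c f chart_volume_null[of p M B V \<phi> f] by simp
  qed
  moreover have "M \<noteq> {}" using x0 by blast
  ultimately show ?thesis
    by (intro AE_I[where N = "{x\<in>M. f x = 0}"])
      (simp_all add: sets_volume_measure[OF M(1)] space_volume_measure[OF M(1)] Z)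
qed

section \<open>Functions built from matrix entries by sums and products\<close>

definition poly_like :: "('a::euclidean_space \<Rightarrow> real) \<Rightarrow> bool" where
  "poly_like f \<longleftrightarrow> germ_preserving f \<and> continuous_on UNIV f"

lemma poly_like_germ:
  assumes "poly_like f" "\<And>e. e \<in> Basis \<Longrightarrow> analytic_germ (\<lambda>r. \<gamma> r \<bullet> e) s"
  shows "analytic_germ (\<lambda>r. f (\<gamma> r)) s"
proof -
  have "(\<forall>e\<in>Basis. analytic_germ (\<lambda>r. \<gamma> r \<bullet> e) s) \<longrightarrow> analytic_germ (\<lambda>r. f (\<gamma> r)) s"
    using assms(1) unfolding poly_like_def germ_preserving_def by (elim conjE allE)
  then show ?thesis using assms(2) by (rule mp[OF _ ballI])
qed

lemma poly_like_continuous: "poly_like f \<Longrightarrow> continuous_on UNIV f"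
  unfolding poly_like_def by simp

lemma poly_likeI:
  assumes "\<And>\<gamma> s. (\<And>e. e \<in> Basis \<Longrightarrow> analytic_germ (\<lambda>r. \<gamma> r \<bullet> e) s) \<Longrightarrow> analytic_germ (\<lambda>r. f (\<gamma> r)) s"
    and "continuous_on UNIV f"
  shows "poly_like f"
  unfolding poly_like_def germ_preserving_def
  using assms(2) by (intro conjI allI impI) (rule assms(1), erule (1) bspec)

lemma poly_like_const: "poly_like (\<lambda>_. c)"
  by (intro poly_likeI analytic_germ_const continuous_on_const)

lemma poly_like_add:
  assumes "poly_like f" "poly_like g"
  shows "poly_like (\<lambda>x. f x + g x)"
proof (rule poly_likeI)
  fix \<gamma> :: "real \<Rightarrow> 'a" and s
  assume *: "\<And>e. e \<in> Basis \<Longrightarrow> analytic_germ (\<lambda>r. \<gamma> r \<bullet> e) s"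
  show "analytic_germ (\<lambda>r. f (\<gamma> r) + g (\<gamma> r)) s"
    by (rule analytic_germ_add[OF poly_like_germ[OF assms(1) *] poly_like_germ[OF assms(2) *]])
qed (intro continuous_on_add poly_like_continuous assms)

lemma poly_like_mult:
  assumes "poly_like f" "poly_like g"
  shows "poly_like (\<lambda>x. f x * g x)"
proof (rule poly_likeI)
  fix \<gamma> :: "real \<Rightarrow> 'a" and s
  assume *: "\<And>e. e \<in> Basis \<Longrightarrow> analytic_germ (\<lambda>r. \<gamma> r \<bullet> e) s"
  show "analytic_germ (\<lambda>r. f (\<gamma> r) * g (\<gamma> r)) s"
    by (rule analytic_germ_mult[OF poly_like_germ[OF assms(1) *] poly_like_germ[OF assms(2) *]])
qed (intro continuous_on_mult poly_like_continuous assms)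

lemma poly_like_sum:
  assumes "\<And>i. i \<in> I \<Longrightarrow> poly_like (f i)"
  shows "poly_like (\<lambda>x. \<Sum>i\<in>I. f i x)"
  using assms by (induction I rule: infinite_finite_induct)
    (simp_all add: poly_like_const poly_like_add)

lemma poly_like_prod:
  assumes "\<And>i. i \<in> I \<Longrightarrow> poly_like (f i)"
  shows "poly_like (\<lambda>x. \<Prod>i\<in>I. f i x)"
  using assms by (induction I rule: infinite_finite_induct)
    (simp_all add: poly_like_const poly_like_mult)

lemma poly_like_component: "poly_like (\<lambda>x :: real ^ 'n::finite ^ 'm::finite. x $ i $ j)"
proof (rule poly_likeI)
  fix \<gamma> :: "real \<Rightarrow> real ^ 'n ^ 'm" and s
  assume *: "\<And>e. e \<in> Basis \<Longrightarrow> analytic_germ (\<lambda>r. \<gamma> r \<bullet> e) s"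
  have "axis i (axis j 1) \<in> (Basis :: (real ^ 'n ^ 'm) set)"
    by (auto simp: Basis_vec_def)
  from *[OF this] show "analytic_germ (\<lambda>r. \<gamma> r $ i $ j) s"
    by (simp add: inner_axis)
qed (intro continuous_intros)

lemma poly_like_det:
  fixes A :: "'a::euclidean_space \<Rightarrow> real ^ 'n::finite ^ 'n"
  assumes "\<And>i j. poly_like (\<lambda>x. A x $ i $ j)"
  shows "poly_like (\<lambda>x. det (A x))"
  unfolding det_def by (intro poly_like_mult poly_like_sum poly_like_prod poly_like_const assms)

section \<open>Blichfeldt's theorem and linear forms\<close>

text \<open>
  The library proves the volume formula for linear images only for well-ordered index types.
\<close>

instantiation sum :: (linorder, linorder) linorder
begin

definition less_eq_sum :: "'a + 'b \<Rightarrow> 'a + 'b \<Rightarrow> bool" where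
  "less_eq_sum x y = (case (x, y) of (Inl a, Inl b) \<Rightarrow> a \<le> b | (Inr a, Inr b) \<Rightarrow> a \<le> b
     | (Inl _, Inr _) \<Rightarrow> True | (Inr _, Inl _) \<Rightarrow> False)"

definition less_sum :: "'a + 'b \<Rightarrow> 'a + 'b \<Rightarrow> bool" where
  "less_sum x y \<longleftrightarrow> x \<le> y \<and> \<not> y \<le> x"

instance
  by standard (auto simp: less_eq_sum_def less_sum_def split: sum.splits)

end

instance sum :: ("{finite,linorder}", "{finite,linorder}") wellorder
proof
  fix P :: "'a + 'b \<Rightarrow> bool" and a
  assume step: "\<And>x. (\<And>y. y < x \<Longrightarrow> P y) \<Longrightarrow> P x"
  show "P a"
  proof (rule ccontr)
    assume "\<not> P a"
    then have "Min {x. \<not> P x} \<in> {x. \<not> P x}" by (intro Min_in) auto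
    moreover have "P (Min {x. \<not> P x})"
      by (rule step) (metis Min_le finite mem_Collect_eq not_le)
    ultimately show False by simp
  qed
qed

lemma integer_lattice_eq_range:
  "integer_lattice = range (\<lambda>f :: 'd::finite \<Rightarrow> int. \<chi> i. of_int (f i))"
proof (intro set_eqI iffI)
  fix v :: "real ^ 'd" assume "v \<in> integer_lattice"
  then have "v = (\<chi> i. of_int \<lfloor>v $ i\<rfloor>)"
    by (auto simp: integer_lattice_def vec_eq_iff)
  then show "v \<in> range (\<lambda>f :: 'd \<Rightarrow> int. \<chi> i. of_int (f i))"
    by (intro image_eqI[where x = "\<lambda>i. \<lfloor>v $ i\<rfloor>"]) auto
qed (auto simp: integer_lattice_def)

lemma countable_integer_lattice: "countable (integer_lattice :: (real ^ 'd::finite) set)"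
  unfolding integer_lattice_eq_range by simp

lemma integer_lattice_diff: "v \<in> integer_lattice \<Longrightarrow> w \<in> integer_lattice \<Longrightarrow> v - w \<in> integer_lattice"
  by (auto simp: integer_lattice_def)

text \<open>\<open>K\<close> is cut into the pieces \<open>Y z\<close> lying in the integer
  translates of the half-open cube \<open>C\<close>, and each piece is moved back into
  \<open>C\<close> as \<open>X z\<close>. If no two points of \<open>K\<close> differed by a lattice
  vector, the sets \<open>X z\<close> would be disjoint, and the volume of \<open>K\<close> would be
  at most 1.\<close>

lemma blichfeldt:
  fixes K :: "(real ^ 'd::finite) set"
  assumes K: "K \<in> sets borel" and vol: "emeasure lborel K > 1"
  shows "\<exists>x\<in>K. \<exists>y\<in>K. x \<noteq> y \<and> x - y \<in> integer_lattice"
proof (rule ccontr)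
  assume contr: "\<not> ?thesis"
  define C :: "(real ^ 'd) set" where "C = {v. \<forall>i. 0 \<le> v $ i \<and> v $ i < 1}"
  define X where "X z = {v\<in>C. z + v \<in> K}" for z
  define Y where "Y z = (\<lambda>v. z + v) ` X z" for z
  have C: "C \<in> sets borel"
  proof -
    have "C = (\<Inter>i. {v. 0 \<le> v $ i} \<inter> {v. v $ i < 1})" by (auto simp: C_def)
    also have "\<dots> \<in> sets borel"
      by (intro sets.countable_INT' sets.Int borel_closed borel_open closed_Collect_le open_Collect_less
            continuous_intros) auto
    finally show ?thesis .
  qed
  have X: "X z \<in> sets borel" for z
  proof -
    have "(\<lambda>v. z + v) -` K \<inter> space borel \<in> sets borel"
      by (rule measurable_sets[OF _ K]) measurable
    then show ?thesis using C unfolding X_def by (simp add: Collect_conj_eq vimage_def)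
  qed
  have Yeq: "Y z = {w. w - z \<in> X z}" for z
    by (auto simp: Y_def intro!: image_eqI[of _ _ "_ - z"])
  have Y: "Y z \<in> sets borel" and em: "emeasure lborel (Y z) = emeasure lborel (X z)" for z
  proof -
    have "(\<lambda>w. w - z) -` X z \<inter> space borel \<in> sets borel"
      by (rule measurable_sets[OF _ X]) measurable
    then show "Y z \<in> sets borel" by (simp add: Yeq vimage_def)
    have "emeasure lborel (X z) = emeasure (distr lborel borel ((+) (- z))) (X z)"
      by (simp add: lborel_distr_plus)
    also have "\<dots> = emeasure lborel (Y z)"
      using X by (subst emeasure_distr) (auto simp: Yeq vimage_def)
    finally show "emeasure lborel (Y z) = emeasure lborel (X z)" ..
  qed
  have frac: "v = w" if "v \<in> C" "w \<in> C" "v - w \<in> integer_lattice" for v w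
  proof -
    have "v $ i = w $ i" for i
    proof -
      have "v $ i - w $ i \<in> \<int>" using that by (auto simp: integer_lattice_def)
      moreover have "\<bar>v $ i - w $ i\<bar> < 1" 
      proof -
        have "0 \<le> v $ i" "v $ i < 1" "0 \<le> w $ i" "w $ i < 1" using that by (auto simp: C_def)
        then show ?thesis by linarith
      qed
      ultimately show ?thesis using Ints_nonzero_abs_less1 by fastforce
    qed
    then show ?thesis by (simp add: vec_eq_iff)
  qed
  have "K = (\<Union>z\<in>integer_lattice. Y z)"
  proof (intro set_eqI iffI)
    fix w assume "w \<in> K"
    define z :: "real ^ 'd" where "z = (\<chi> i. of_int \<lfloor>w $ i\<rfloor>)"
    have "z \<in> integer_lattice" by (simp add: z_def integer_lattice_def)
    moreover have "w - z \<in> X z" using \<open>w \<in> K\<close> by (auto simp: X_def C_def z_def) linarith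
    ultimately show "w \<in> (\<Union>z\<in>integer_lattice. Y z)" unfolding Yeq by blast
  qed (auto simp: Yeq X_def)
  moreover have "disjoint_family_on Y integer_lattice"
  proof (unfold disjoint_family_on_def, safe)
    fix z z' w assume *: "z \<in> integer_lattice" "z' \<in> integer_lattice" "z \<noteq> z'" "w \<in> Y z" "w \<in> Y z'"
    then have "(w - z) - (w - z') \<in> integer_lattice"
      using integer_lattice_diff[of z' z] by simp
    then have "w - z = w - z'" using * by (intro frac) (auto simp: Yeq X_def)
    then show "w \<in> {}" using * by simp
  qed
  ultimately have "emeasure lborel K = (\<integral>\<^sup>+z. emeasure lborel (Y z) \<partial>count_space integer_lattice)"
    using Y emeasure_UN_countable[of integer_lattice Y lborel] countable_integer_lattice by auto
  also have "\<dots> = (\<integral>\<^sup>+z. emeasure lborel (X z) \<partial>count_space integer_lattice)"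
    by (simp add: em)
  also have "\<dots> = emeasure lborel (\<Union>z\<in>integer_lattice. X z)"
  proof (rule emeasure_UN_countable[symmetric])
    show "disjoint_family_on X integer_lattice"
    proof (unfold disjoint_family_on_def, safe)
      fix z z' v assume *: "z \<in> integer_lattice" "z' \<in> integer_lattice" "z \<noteq> z'" "v \<in> X z" "v \<in> X z'"
      then have "z + v \<in> K" "z' + v \<in> K" "(z + v) - (z' + v) \<in> integer_lattice" "z + v \<noteq> z' + v"
        using integer_lattice_diff[of z z'] by (auto simp: X_def)
      with contr show "v \<in> {}" by blast
    qed
  qed (use X countable_integer_lattice in auto)
  also have "\<dots> \<le> emeasure lborel (cbox (0 :: real ^ 'd) (\<chi> i. 1))"
    by (intro emeasure_mono) (auto simp: X_def C_def mem_box_cart less_imp_le)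
  also have "\<dots> = 1"
  proof -
    have "(\<Prod>b\<in>Basis. ((\<chi> i. 1) :: real ^ 'd) \<bullet> b) = 1"
      by (intro prod.neutral) (auto simp: Basis_vec_def inner_axis)
    then show ?thesis
      by (subst emeasure_lborel_cbox) (auto simp: Basis_vec_def inner_axis)
  qed
  finally show False using vol by simp
qed

lemma linear_forms_box:
  fixes H :: "real ^ 'd::{finite,wellorder} ^ 'd::{finite,wellorder}" and a :: "'d::{finite,wellorder} \<Rightarrow> real"
  assumes a: "\<And>j. a j \<ge> 0" and vol: "\<bar>det H\<bar> * (\<Prod>j\<in>UNIV. a j) > 1"
  shows "\<exists>\<sigma>. \<sigma> \<noteq> 0 \<and> (\<forall>j. \<bar>\<sigma> $ j\<bar> \<le> a j) \<and> H *v \<sigma> \<in> integer_lattice"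
proof -
  \<comment> \<open>A one-sided box, so that differences of its points are bounded by
    \<open>a j\<close> and not by \<open>2 * a j\<close>.\<close>
  define Q where "Q = cbox (0 :: real ^ 'd::{finite,wellorder}) (\<chi> j. a j)"
  define K where "K = (*v) H ` Q"
  have "compact K" unfolding K_def Q_def
    by (intro compact_continuous_image compact_cbox linear_continuous_on matrix_vector_mul_bounded_linear)
  then have K: "K \<in> sets borel" by (simp add: borel_compact)
  have "measure lebesgue K = \<bar>det H\<bar> * measure lebesgue Q" and KL: "K \<in> lmeasurable"
    using measure_linear_image[of "(*v) H" Q] measurable_linear_image[of "(*v) H" Q]
    by (auto simp: K_def Q_def matrix_of_matrix_vector_mul)
  moreover have "measure lebesgue Q = (\<Prod>j\<in>UNIV. a j)"
  proof -
    have "measure lebesgue Q = measure lborel Q" by (simp add: Q_def measure_completion)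
    also have "\<dots> = (\<Prod>j\<in>UNIV. a j)"
      unfolding Q_def using a by (subst content_cbox_cart) (auto simp: interval_ne_empty_cart)
    finally show ?thesis .
  qed
  ultimately have "measure lebesgue K > 1" using vol by simp
  then have "measure lborel K > 1" using K by (simp add: measure_completion)
  moreover have "emeasure lborel K \<noteq> \<infinity>"
    using emeasure_compact_finite[OF \<open>compact K\<close>] by simp
  ultimately have "emeasure lborel K > 1"
    by (simp add: emeasure_eq_ennreal_measure one_less_ennreal)
  from blichfeldt[OF K this] obtain x y where "x \<in> Q" "y \<in> Q" "H *v x \<noteq> H *v y"
      "H *v x - H *v y \<in> integer_lattice"
    unfolding K_def by blast
  moreover have "\<bar>(x - y) $ j\<bar> \<le> a j" if "x \<in> Q" "y \<in> Q" for j x y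
    using that by (auto simp: Q_def mem_box_cart abs_le_iff) (smt (verit))+
  ultimately show ?thesis
    by (intro exI[of _ "x - y"]) (auto simp: matrix_vector_mult_diff_distrib)
qed

lemma det_column_bound:
  fixes A :: "real ^ 'd::finite ^ 'd"
  assumes "\<And>i j. \<bar>A $ i $ j\<bar> \<le> b j"
  shows "\<bar>det A\<bar> \<le> fact CARD('d) * (\<Prod>j\<in>UNIV. b j)"
proof -
  have "\<bar>det A\<bar> \<le> (\<Sum>p | p permutes (UNIV :: 'd set). \<bar>of_int (sign p) * (\<Prod>i\<in>UNIV. A $ i $ p i)\<bar>)"
    unfolding det_def by (rule sum_abs)
  also have "\<dots> \<le> (\<Sum>p | p permutes (UNIV :: 'd set). \<Prod>j\<in>UNIV. b j)"
  proof (rule sum_mono)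
    fix p assume "p \<in> {p. p permutes (UNIV :: 'd set)}"
    then have p: "p permutes UNIV" by simp
    have "\<bar>of_int (sign p) * (\<Prod>i\<in>UNIV. A $ i $ p i)\<bar> = (\<Prod>i\<in>UNIV. \<bar>A $ i $ p i\<bar>)"
      by (simp add: abs_mult sign_def abs_prod)
    also have "\<dots> \<le> (\<Prod>i\<in>UNIV. b (p i))"
      by (intro prod_mono) (use assms in auto)
    also have "\<dots> = (\<Prod>j\<in>UNIV. b j)"
      using prod.permute[OF p, of b] by (simp add: o_def)
    finally show "\<bar>of_int (sign p) * (\<Prod>i\<in>UNIV. A $ i $ p i)\<bar> \<le> (\<Prod>j\<in>UNIV. b j)" .
  qed
  also have "\<dots> = fact CARD('d) * (\<Prod>j\<in>UNIV. b j)"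
    by (simp add: card_permutations[OF refl])
  finally show ?thesis .
qed

lemma det_integer:
  fixes A :: "real ^ 'd::finite ^ 'd"
  assumes "\<And>i j. A $ i $ j \<in> \<int>" and "det A \<noteq> 0"
  shows "\<bar>det A\<bar> \<ge> 1"
proof -
  have "det A \<in> \<int>" unfolding det_def using assms(1) by (intro Ints_sum Ints_mult Ints_prod) auto
  then show ?thesis using assms(2) Ints_nonzero_abs_ge1 by blast
qed

lemma finite_lattice_box:
  fixes g :: "real ^ 'd::finite ^ 'd"
  assumes "invertible g"
  shows "finite {z\<in>integer_lattice. \<forall>i. \<bar>(g *v z) $ i\<bar> \<le> \<rho>}"
proof -
  obtain h where h: "h ** g = mat 1" using assms by (auto simp: invertible_def)
  define N where "N = (\<Sum>i\<in>UNIV. \<Sum>j\<in>UNIV. \<bar>h $ i $ j\<bar> * \<bar>\<rho>\<bar>)"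
  have "{z\<in>integer_lattice. \<forall>i. \<bar>(g *v z) $ i\<bar> \<le> \<rho>} \<subseteq>
      (\<lambda>f. \<chi> i. of_int (f i)) ` (PiE UNIV (\<lambda>_. {- \<lceil>N\<rceil> .. \<lceil>N\<rceil>}))"
  proof
    fix z assume "z \<in> {z\<in>integer_lattice. \<forall>i. \<bar>(g *v z) $ i\<bar> \<le> \<rho>}"
    then obtain f where f: "z = (\<chi> i. of_int (f i))" and b: "\<And>i. \<bar>(g *v z) $ i\<bar> \<le> \<rho>"
      by (auto simp: integer_lattice_eq_range)
    have "\<bar>z $ i\<bar> \<le> N" for i
    proof -
      have "h *v (g *v z) = z" by (simp add: matrix_vector_mul_assoc h)
      moreover have "(h *v (g *v z)) $ i = (\<Sum>j\<in>UNIV. h $ i $ j * (g *v z) $ j)"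
        by (simp add: matrix_vector_mult_def[of h])
      ultimately have "\<bar>z $ i\<bar> = \<bar>\<Sum>j\<in>UNIV. h $ i $ j * (g *v z) $ j\<bar>" by simp
      also have "\<dots> \<le> (\<Sum>j\<in>UNIV. \<bar>h $ i $ j * (g *v z) $ j\<bar>)" by (rule sum_abs)
      also have "\<dots> \<le> (\<Sum>j\<in>UNIV. \<bar>h $ i $ j\<bar> * \<bar>\<rho>\<bar>)"
        unfolding abs_mult by (intro sum_mono mult_left_mono order.trans[OF b]) auto
      also have "\<dots> \<le> N"
        unfolding N_def by (intro member_le_sum) (auto intro: sum_nonneg)
      finally show ?thesis .
    qed
    then have "f i \<in> {- \<lceil>N\<rceil> .. \<lceil>N\<rceil>}" for i
      using f by (auto simp: abs_le_iff) (smt (verit) le_of_int_ceiling of_int_minus of_int_le_iff)+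
    then show "z \<in> (\<lambda>f. \<chi> i. of_int (f i)) ` (PiE UNIV (\<lambda>_. {- \<lceil>N\<rceil> .. \<lceil>N\<rceil>}))"
      using f by (intro image_eqI[of _ _ f]) auto
  qed
  then show ?thesis by (rule finite_subset) (intro finite_imageI finite_PiE, auto)
qed

section \<open>Determinants of partial frames\<close>

lemma det_nz_iff_ker:
  fixes A :: "real ^ 'd::finite ^ 'd"
  shows "det A \<noteq> 0 \<longleftrightarrow> (\<forall>v. A *v v = 0 \<longrightarrow> v = 0)"
  by (metis invertible_det_nz invertible_left_inverse matrix_left_invertible_ker)

text \<open>Independence of an indexed family, in which a repeated vector counts as a dependence, as
  it does for the columns of a determinant.\<close>

definition free_family :: "'i set \<Rightarrow> ('i \<Rightarrow> 'v::real_vector) \<Rightarrow> bool" where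
  "free_family S z \<longleftrightarrow> (\<forall>c. (\<Sum>j\<in>S. c j *\<^sub>R z j) = 0 \<longrightarrow> (\<forall>j\<in>S. c j = 0))"

lemma free_family_independent:
  assumes "finite S" "free_family S z"
  shows "inj_on z S" "independent (z ` S)"
proof -
  show inj: "inj_on z S"
  proof (rule inj_onI, rule ccontr)
    fix i j assume ij: "i \<in> S" "j \<in> S" "z i = z j" "i \<noteq> j"
    define c :: "'a \<Rightarrow> real" where "c l = (if l = i then 1 else if l = j then - 1 else 0)" for l
    have "(\<Sum>l\<in>S. c l *\<^sub>R z l) = (\<Sum>l\<in>S. (if l = i then z i else 0) - (if l = j then z j else 0))"
      by (intro sum.cong refl) (use ij in \<open>auto simp: c_def\<close>)
    also have "\<dots> = 0" using ij assms(1) by (simp add: sum_subtractf)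
    finally have "c i = 0" using assms(2) ij(1) unfolding free_family_def by blast
    then show False by (simp add: c_def)
  qed
  show "independent (z ` S)"
  proof (rule independent_if_scalars_zero)
    fix f x assume "(\<Sum>x\<in>z ` S. f x *\<^sub>R x) = 0" and x: "x \<in> z ` S"
    then have "(\<Sum>j\<in>S. f (z j) *\<^sub>R z j) = 0" using inj by (simp add: sum.reindex)
    with assms(2) have "\<forall>j\<in>S. f (z j) = 0" unfolding free_family_def by (elim allE[of _ "\<lambda>j. f (z j)"]) blast
    then show "f x = 0" using x by blast
  qed (use assms in simp)
qed

lemma free_family_spans:
  fixes z :: "'i \<Rightarrow> 'v::euclidean_space"
  assumes S: "finite S" "free_family S z" "z ` S \<subseteq> W" "dim W = card S" and v: "v \<in> W"
  shows "\<exists>c. v = (\<Sum>j\<in>S. c j *\<^sub>R z j)"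
proof -
  note ind = free_family_independent[OF S(1,2)]
  have "W \<subseteq> span (z ` S)"
    using S by (intro card_ge_dim_independent ind) (auto simp: card_image[OF ind(1)])
  with v have "v \<in> range (\<lambda>u. \<Sum>v\<in>z ` S. u v *\<^sub>R v)"
    using span_finite[of "z ` S"] S(1) by auto
  then obtain u where "v = (\<Sum>v\<in>z ` S. u v *\<^sub>R v)" by blast
  then have "v = (\<Sum>j\<in>S. u (z j) *\<^sub>R z j)" using ind(1) by (simp add: sum.reindex)
  then show ?thesis by (rule exI[of _ "\<lambda>j. u (z j)"])
qed

lemma free_family_bij:
  fixes B :: "'v::euclidean_space set"
  assumes B: "independent B" and z: "bij_betw z S B"
  shows "free_family S z"
  unfolding free_family_def
proof (intro allI impI ballI)
  fix c j assume 0: "(\<Sum>j\<in>S. c j *\<^sub>R z j) = 0" and j: "j \<in> S"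
  have inv: "the_inv_into S z (z i) = i" if "i \<in> S" for i
    using z that by (simp add: the_inv_into_f_f bij_betw_def)
  have "(\<Sum>v\<in>B. c (the_inv_into S z v) *\<^sub>R v) = (\<Sum>j\<in>S. c (the_inv_into S z (z j)) *\<^sub>R z j)"
    by (rule sum.reindex_bij_betw[OF z, symmetric])
  also have "\<dots> = 0"
    using 0 by (simp add: inv)
  finally have "c (the_inv_into S z v) = 0" if "v \<in> B" for v
    using independentD[OF B finiteI_independent[OF B] order.refl _ that, where u = "\<lambda>v. c (the_inv_into S z v)"]
    by blast
  from this[OF bij_betw_apply[OF z j]] show "c j = 0" using inv[OF j] by simp
qed

text \<open>
  The determinant of this matrix is the Pluecker coordinate, for the rows \<open>S\<close>, of the wedge of the
  vectors \<open>u z\<^sub>j\<close>, \<open>j \<in> S\<close>; indexing these vectors by \<open>S\<close> itself makes the matrix square.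
\<close>

definition column_matrix :: "real ^ 'd::finite ^ 'd \<Rightarrow> 'd set \<Rightarrow> ('d \<Rightarrow> real ^ 'd) \<Rightarrow> real ^ 'd ^ 'd" where
  "column_matrix u S z = (\<chi> i j. if j \<in> S then (u *v z j) $ i else if i = j then 1 else 0)"

lemma column_matrix_mult:
  "column_matrix u S z *v v = u *v (\<Sum>j\<in>S. v $ j *\<^sub>R z j) + (\<chi> i. if i \<in> S then 0 else v $ i)"
proof -
  have "(column_matrix u S z *v v) $ i = (u *v (\<Sum>j\<in>S. v $ j *\<^sub>R z j)) $ i + (if i \<in> S then 0 else v $ i)" for i
  proof -
    have "(column_matrix u S z *v v) $ i =
        (\<Sum>j\<in>UNIV. (if j \<in> S then v $ j * (u *v z j) $ i else 0) + (if j \<in> S then 0 else if j = i then v $ i else 0))"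
      by (auto simp: column_matrix_def matrix_vector_mult_def[of "vec_lambda _"] intro!: sum.cong)
    also have "\<dots> = (\<Sum>j\<in>S. v $ j * (u *v z j) $ i) + (\<Sum>j\<in>- S. if j = i then v $ i else 0)"
      unfolding sum.distrib by (simp add: sum.If_cases Compl_eq)
    also have "(\<Sum>j\<in>- S. if j = i then v $ i else 0) = (if i \<in> S then 0 else v $ i)"
      by simp
    also have "(\<Sum>j\<in>S. v $ j * (u *v z j) $ i) = (u *v (\<Sum>j\<in>S. v $ j *\<^sub>R z j)) $ i"
      by (simp add: linear_sum[OF matrix_vector_mul_linear] linear_scale[OF matrix_vector_mul_linear])
    finally show ?thesis .
  qed
  then show ?thesis by (simp add: vec_eq_iff)
qed

lemma column_matrix_free:
  assumes "det (column_matrix u S z) \<noteq> 0"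
  shows "free_family S z"
  unfolding free_family_def
proof (intro allI impI ballI)
  fix c j assume 0: "(\<Sum>j\<in>S. c j *\<^sub>R z j) = 0" and j: "j \<in> S"
  define v where "v = (\<chi> j. if j \<in> S then c j else 0)"
  have "(\<Sum>j\<in>S. v $ j *\<^sub>R z j) = (\<Sum>j\<in>S. c j *\<^sub>R z j)" by (intro sum.cong) (simp_all add: v_def)
  from this[unfolded 0] have "column_matrix u S z *v v = 0"
    by (simp only: column_matrix_mult) (simp add: vec_eq_iff v_def)
  then have "v = 0" using assms by (simp add: det_nz_iff_ker)
  then have "v $ j = 0" by simp
  then show "c j = 0" using j by (simp add: v_def)
qed

text \<open>The unit columns outside \<open>S\<close> do not touch the rows in \<open>S\<close>. So
  a kernel vector gives a combination \<open>w\<close> of the frame with \<open>u *v w\<close> zero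
  in those rows, and \<open>tr\<close> says that projecting \<open>u W\<close> to the rows
  \<open>S\<close> is injective.\<close>

lemma column_matrix_nonsingular:
  assumes z: "free_family S z" and W: "subspace W" "\<And>j. j \<in> S \<Longrightarrow> z j \<in> W"
    and tr: "\<And>w. w \<in> W \<Longrightarrow> (\<And>i. i \<in> S \<Longrightarrow> (u *v w) $ i = 0) \<Longrightarrow> w = 0"
  shows "det (column_matrix u S z) \<noteq> 0"
  unfolding det_nz_iff_ker
proof (intro allI impI)
  fix v assume 0: "column_matrix u S z *v v = 0"
  define w where "w = (\<Sum>j\<in>S. v $ j *\<^sub>R z j)"
  have eq: "(u *v w) $ i + (if i \<in> S then 0 else v $ i) = 0" for i
    using 0 by (simp add: column_matrix_mult vec_eq_iff w_def)
  have "w \<in> W" unfolding w_def by (intro subspace_sum W subspace_scale)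
  moreover have "(u *v w) $ i = 0" if "i \<in> S" for i using eq[of i] that by simp
  ultimately have "w = 0" by (rule tr)
  then have "\<forall>j\<in>S. v $ j = 0" using z unfolding w_def free_family_def by (elim allE[of _ "($) v"]) blast
  moreover have "v $ i = 0" if "i \<notin> S" for i using eq[of i] that \<open>w = 0\<close> by simp
  ultimately show "v = 0" by (auto simp: vec_eq_iff)
qed

section \<open>Pluecker coordinates under a diagonal flow and on integer frames\<close>

definition diag_exp :: "('d::finite \<Rightarrow> real) \<Rightarrow> real \<Rightarrow> real ^ 'd ^ 'd" where
  "diag_exp s t = (\<chi> i j. if i = j then exp (s i * t) else 0)"

lemma diag_exp_mult: "(diag_exp s t *v v) $ i = exp (s i * t) * v $ i"
  by (simp add: diag_exp_def matrix_vector_mult_def if_distrib[of "\<lambda>x. x * _"] cong: if_cong)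

lemma det_diag_exp: "det (diag_exp s t) = exp ((\<Sum>i\<in>UNIV. s i) * t)"
proof -
  have "det (diag_exp s t) = (\<Prod>i\<in>UNIV. exp (s i * t))"
    by (subst det_diagonal) (auto simp: diag_exp_def)
  then show ?thesis by (simp add: exp_sum sum_distrib_right)
qed

text \<open>The flow scales all rows, and \<open>D\<close> undoes this on the unit columns outside
  \<open>S\<close>. As the exponents sum to 0, the flow has determinant 1, and \<open>det D\<close>
  is the exponential of minus the sum outside \<open>S\<close>, hence of the sum over
  \<open>S\<close>.\<close>

lemma det_column_matrix_flow:
  fixes u :: "real ^ 'd::finite ^ 'd"
  assumes "(\<Sum>i\<in>UNIV. s i) = 0"
  shows "det (column_matrix (diag_exp s t ** u) S z) = exp ((\<Sum>i\<in>S. s i) * t) * det (column_matrix u S z)"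
proof -
  define D :: "real ^ 'd ^ 'd" where
    "D = (\<chi> i j. if i = j then if j \<in> S then 1 else exp (- (s j * t)) else 0)"
  have Dv: "(D *v v) $ i = (if i \<in> S then v $ i else exp (- (s i * t)) * v $ i)" for v i
    by (simp add: D_def matrix_vector_mult_def if_distrib[of "\<lambda>x. x * _"] cong: if_cong)
  have "column_matrix (diag_exp s t ** u) S z *v v = (diag_exp s t ** (column_matrix u S z ** D)) *v v" for v
  proof -
    have "(\<Sum>j\<in>S. (D *v v) $ j *\<^sub>R z j) = (\<Sum>j\<in>S. v $ j *\<^sub>R z j)"
      by (intro sum.cong) (simp_all add: Dv)
    then show ?thesis
      unfolding matrix_vector_mul_assoc[symmetric] column_matrix_mult vec_eq_iff
      by (auto simp: diag_exp_mult Dv exp_minus field_simps)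
  qed
  then have "column_matrix (diag_exp s t ** u) S z = diag_exp s t ** (column_matrix u S z ** D)"
    unfolding matrix_eq by blast
  then have "det (column_matrix (diag_exp s t ** u) S z) = det (column_matrix u S z) * det D"
    using assms by (simp add: det_mul det_diag_exp)
  also have "det D = (\<Prod>j\<in>UNIV. exp (- (if j \<in> S then 0 else s j * t)))"
    by (subst det_diagonal) (auto simp: D_def intro!: prod.cong)
  also have "\<dots> = exp (- (\<Sum>j\<in>- S. s j * t))"
    by (subst exp_sum[symmetric]) (auto simp: sum_negf sum.If_cases Compl_eq)
  also have "- (\<Sum>j\<in>- S. s j * t) = (\<Sum>i\<in>S. s i) * t"
  proof -
    have "(\<Sum>i\<in>S. s i) + (\<Sum>i\<in>- S. s i) = 0"
      using assms sum.union_disjoint[of S "- S" s] by (simp add: Compl_partition)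
    then have "(\<Sum>i\<in>- S. s i) = - (\<Sum>i\<in>S. s i)" by linarith
    then show ?thesis by (simp add: sum_distrib_right[symmetric])
  qed
  finally show ?thesis by simp
qed

text \<open>All integer frames of \<open>span B\<close> arise from one frame \<open>y\<close> by a
  coefficient matrix \<open>A\<close>, and \<open>det A\<close> cannot be small: it is also the
  ratio of two nonzero integer determinants, one of which is fixed.\<close>

lemma column_matrix_lower_bound:
  fixes u :: "real ^ 'd::finite ^ 'd"
  assumes B: "B \<subseteq> integer_lattice" "independent B" "card B = card S"
  shows "\<exists>c>0. \<forall>z. (\<forall>j\<in>S. z j \<in> span B \<inter> integer_lattice) \<longrightarrow> det (column_matrix u S z) \<noteq> 0
           \<longrightarrow> c \<le> \<bar>det (column_matrix u S z)\<bar>"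
proof -
  \<comment> \<open>Completing \<open>B\<close> by unit vectors gives an integer basis of the whole
    space, though not necessarily one of the lattice.\<close>
  define E :: "(real ^ 'd) set" where "E = range (\<lambda>i. axis i 1)"
  have E: "E \<subseteq> integer_lattice" "span E = UNIV"
  proof -
    show "E \<subseteq> integer_lattice" by (auto simp: E_def integer_lattice_def axis_def)
    have "Basis \<subseteq> E" by (auto simp: E_def Basis_vec_def)
    then show "span E = UNIV" using span_mono span_Basis by blast
  qed
  obtain B' where B': "B \<subseteq> B'" "B' \<subseteq> B \<union> E" "independent B'" "B \<union> E \<subseteq> span B'"
    using maximal_independent_subset_extend[of B "B \<union> E"] B(2) by auto
  have "span B' = UNIV"
    using E(2) B'(4) by (metis le_sup_iff span_mono span_span top.extremum_unique)
  then have cardB': "card B' = CARD('d)"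
    using dim_eq_card_independent[OF B'(3)] dim_span[of B'] by simp
  have finB': "finite B'" using B'(3) by (rule finiteI_independent)
  obtain y1 where y1: "bij_betw y1 S B"
    using finite_same_card_bij[OF finite[of S] finite_subset[OF B'(1) finB']] B(3) by auto
  have "card (- S) = card (B' - B)"
    using cardB' B(3) B'(1) finB' by (simp add: Compl_eq_Diff_UNIV card_Diff_subset finite_subset)
  then obtain y2 where y2: "bij_betw y2 (- S) (B' - B)"
    using finite_same_card_bij finB' by (metis finite finite_Diff)
  define y where "y j = (if j \<in> S then y1 j else y2 j)" for j
  have yS: "bij_betw y S B" and yS': "bij_betw y (- S) (B' - B)"
    using y1 y2 bij_betw_cong[of S y y1 B] bij_betw_cong[of "- S" y y2 "B' - B"] by (simp_all add: y_def)
  have yB': "bij_betw y UNIV B'"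
    using bij_betw_combine[OF yS yS'] B'(1) by (simp add: Un_absorb1)
  have yint: "y j \<in> integer_lattice" for j
    using yB' B'(2) B(1) E(1) bij_betwE[OF yB'] by blast
  \<comment> \<open>\<open>Y z\<close> is an integer matrix, and \<open>det (Y z) / det (Y y)\<close> equals the quotient of the Pluecker coordinates.\<close>
  define Y where "Y z = (\<chi> i j. (if j \<in> S then z j else y j) $ i)" for z :: "'d \<Rightarrow> real ^ 'd"
  have freey: "free_family S y"
    by (rule free_family_bij[OF B(2) yS])
  \<comment> \<open>In the degenerate case every frame has coordinate 0, so any positive value will
    do. The \<open>+ 1\<close> makes the quotient positive before \<open>det (Y y)\<close> is known
    to be nonzero.\<close>
  define c where "c = (if det (column_matrix u S y) = 0 then 1 else \<bar>det (column_matrix u S y)\<bar> / (\<bar>det (Y y)\<bar> + 1))"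
  have "c > 0" by (auto simp: c_def intro!: divide_pos_pos add_nonneg_pos)
  moreover have "c \<le> \<bar>det (column_matrix u S z)\<bar>"
    if z: "\<And>j. j \<in> S \<Longrightarrow> z j \<in> span B \<inter> integer_lattice" and nz: "det (column_matrix u S z) \<noteq> 0" for z
  proof -
    have "\<exists>a. z j = (\<Sum>i\<in>S. a i *\<^sub>R y i)" if "j \<in> S" for j
    proof (rule free_family_spans[OF finite freey])
      show "y ` S \<subseteq> span B" using yS by (auto simp: bij_betw_def span_base)
      show "dim (span B) = card S" using B by (simp add: dim_eq_card_independent)
    qed (use z that in auto)
    then obtain a where a: "\<And>j. j \<in> S \<Longrightarrow> z j = (\<Sum>i\<in>S. a j i *\<^sub>R y i)" by metis
    \<comment> \<open>Coefficients of the frame \<open>z\<close> in terms of \<open>y\<close> on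
      \<open>S\<close> and the identity elsewhere, so that \<open>A\<close> is a common right factor
      for \<open>column_matrix\<close> and \<open>Y\<close>.\<close>
    define A :: "real ^ 'd ^ 'd" where
      "A = (\<chi> i j. if j \<in> S then (if i \<in> S then a j i else 0) else (if i = j then 1 else 0))"
    have swap: "(\<Sum>i\<in>S. (A *v v) $ i *\<^sub>R y i) = (\<Sum>j\<in>S. v $ j *\<^sub>R z j)" for v
    proof -
      have "(A *v v) $ i = (\<Sum>j\<in>S. v $ j * a j i)" if "i \<in> S" for i
      proof -
        have "(A *v v) $ i = (\<Sum>j\<in>UNIV. if j \<in> S then v $ j * a j i else 0)"
          using that by (auto simp: A_def matrix_vector_mult_def intro!: sum.cong)
        then show ?thesis by (simp add: sum.If_cases)
      qed
      then have "(\<Sum>i\<in>S. (A *v v) $ i *\<^sub>R y i) = (\<Sum>i\<in>S. \<Sum>j\<in>S. (v $ j * a j i) *\<^sub>R y i)"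
        by (simp add: scaleR_sum_left)
      also have "\<dots> = (\<Sum>j\<in>S. \<Sum>i\<in>S. (v $ j * a j i) *\<^sub>R y i)" by (rule sum.swap)
      also have "\<dots> = (\<Sum>j\<in>S. v $ j *\<^sub>R z j)"
        by (intro sum.cong refl) (simp add: a scaleR_sum_right)
      finally show ?thesis .
    qed
    have off: "(A *v v) $ i = v $ i" if "i \<notin> S" for v i
    proof -
      have "(A *v v) $ i = (\<Sum>j\<in>UNIV. A $ i $ j * v $ j)" by (simp add: matrix_vector_mult_def)
      also have "\<dots> = (\<Sum>j\<in>UNIV. if j = i then v $ i else 0)"
        by (rule sum.cong) (use that in \<open>auto simp: A_def\<close>)
      finally show ?thesis by simp
    qed
    have Yv: "Y z' *v v = (\<Sum>j\<in>S. v $ j *\<^sub>R z' j) + (\<Sum>j\<in>- S. v $ j *\<^sub>R y j)" for z' v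
    proof -
      have "(Y z' *v v) $ i = (\<Sum>j\<in>UNIV. if j \<in> S then v $ j * z' j $ i else v $ j * y j $ i)" for i
        by (auto simp: Y_def matrix_vector_mult_def intro!: sum.cong)
      then show ?thesis by (simp add: vec_eq_iff sum.If_cases Compl_eq)
    qed
    have "Y z *v v = (Y y ** A) *v v" for v
    proof -
      have "(\<Sum>j\<in>- S. (A *v v) $ j *\<^sub>R y j) = (\<Sum>j\<in>- S. v $ j *\<^sub>R y j)"
        by (intro sum.cong) (simp_all add: off)
      then show ?thesis
        unfolding matrix_vector_mul_assoc[symmetric] Yv swap by simp
    qed
    then have dY: "det (Y z) = det (Y y) * det A" by (metis matrix_eq det_mul)
    have "column_matrix u S z *v v = (column_matrix u S y ** A) *v v" for v
      unfolding matrix_vector_mul_assoc[symmetric] column_matrix_mult swap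
      by (simp add: vec_eq_iff off)
    then have dC: "det (column_matrix u S z) = det (column_matrix u S y) * det A" by (metis matrix_eq det_mul)
    have "det (Y y) \<noteq> 0"
      unfolding det_nz_iff_ker
    proof (intro allI impI)
      fix v assume "Y y *v v = 0"
      then have "(\<Sum>j\<in>UNIV. v $ j *\<^sub>R y j) = 0"
        unfolding Yv using sum.union_disjoint[of S "- S" "\<lambda>j. v $ j *\<^sub>R y j"] by (simp add: Compl_partition)
      then show "v = 0"
        using free_family_bij[OF B'(3) yB'] unfolding free_family_def by (auto simp: vec_eq_iff)
    qed
    moreover have "det A \<noteq> 0" "det (column_matrix u S y) \<noteq> 0" using nz dC by auto
    ultimately have "det (Y z) \<noteq> 0" using dY by simp
    moreover have "Y z $ i $ j \<in> \<int>" for i j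
      using z yint by (auto simp: Y_def integer_lattice_def)
    ultimately have "1 \<le> \<bar>det (Y z)\<bar>" by (intro det_integer) auto
    then have "1 \<le> \<bar>det (Y y)\<bar> * \<bar>det A\<bar>" by (simp add: dY abs_mult)
    also have "\<dots> \<le> (\<bar>det (Y y)\<bar> + 1) * \<bar>det A\<bar>" by (intro mult_right_mono) auto
    finally have "1 / (\<bar>det (Y y)\<bar> + 1) \<le> \<bar>det A\<bar>"
      by (simp add: divide_le_eq mult.commute add_nonneg_pos)
    then have "\<bar>det (column_matrix u S y)\<bar> * (1 / (\<bar>det (Y y)\<bar> + 1)) \<le> \<bar>det (column_matrix u S y)\<bar> * \<bar>det A\<bar>"
      by (rule mult_left_mono) simp
    then show ?thesis using \<open>det (column_matrix u S y) \<noteq> 0\<close> by (simp add: c_def dC abs_mult)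
  qed
  ultimately show ?thesis by blast
qed

section \<open>Gaps in the lattice\<close>

text \<open>\<open>W\<close> is the span of the vectors of the first \<open>k\<close> minima, pulled
  back by \<open>g\<close> to the integer lattice so that it can stay fixed while \<open>g\<close>
  moves. The radii are existential because they vary with \<open>g\<close>.\<close>

definition lattice_gap :: "real ^ 'd::finite ^ 'd \<Rightarrow> nat \<Rightarrow> (real ^ 'd) set \<Rightarrow> bool" where
  "lattice_gap g k W \<longleftrightarrow> dim W = k \<and> (\<exists>\<rho> \<rho>'. 0 < \<rho> \<and> \<rho> < \<rho>' \<and>
     W = span {z\<in>integer_lattice. \<forall>i. \<bar>(g *v z) $ i\<bar> \<le> \<rho>} \<and>
     {z\<in>integer_lattice. \<forall>i. \<bar>(g *v z) $ i\<bar> \<le> \<rho>'} \<subseteq> W)"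

text \<open>Spans of short vectors are nested according to their radii, and equal dimension turns
  inclusion into equality.\<close>

lemma lattice_gap_unique:
  assumes "lattice_gap g k W" "lattice_gap g k W'"
  shows "W = W'"
proof -
  have *: "W1 \<subseteq> W2"
    if "0 < \<rho>1" "\<rho>1 < \<rho>1'" "W1 = span {z\<in>integer_lattice. \<forall>i. \<bar>(g *v z) $ i\<bar> \<le> \<rho>1}"
      "\<rho>1 \<le> \<rho>2" "W2 = span {z\<in>integer_lattice. \<forall>i. \<bar>(g *v z) $ i\<bar> \<le> \<rho>2}" for W1 W2 \<rho>1 \<rho>1' \<rho>2
    unfolding that(3,5) by (intro span_mono) (use that(4) in \<open>auto intro: order.trans\<close>)
  obtain \<rho> \<rho>1 where \<rho>: "0 < \<rho>" "\<rho> < \<rho>1" "W = span {z\<in>integer_lattice. \<forall>i. \<bar>(g *v z) $ i\<bar> \<le> \<rho>}"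
    using assms(1) unfolding lattice_gap_def by blast
  obtain \<rho>' \<rho>1' where \<rho>': "0 < \<rho>'" "\<rho>' < \<rho>1'" "W' = span {z\<in>integer_lattice. \<forall>i. \<bar>(g *v z) $ i\<bar> \<le> \<rho>'}"
    using assms(2) unfolding lattice_gap_def by blast
  have sub: "subspace W" "subspace W'" using \<rho>(3) \<rho>'(3) by auto
  have dim: "dim W = dim W'" using assms by (simp add: lattice_gap_def)
  show ?thesis
  proof (cases "\<rho> \<le> \<rho>'")
    case True
    then have "W \<subseteq> W'" using * \<rho> \<rho>' by blast
    then show ?thesis using sub dim by (intro subspace_dim_equal) auto
  next
    case False
    then have "W' \<subseteq> W" using *[OF \<rho>'(1,2,3) _ \<rho>(3)] by simp
    then show ?thesis using sub dim by (intro subspace_dim_equal[symmetric]) auto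
  qed
qed

text \<open>A time change below \<open>\<delta>\<close> distorts every coordinate by a factor of at
  most \<open>?E = exp (c * \<delta>)\<close>, so the radii \<open>?E * \<rho>\<close> and
  \<open>?E * (?E * \<rho>)\<close> work at the new time with the same \<open>W\<close>.\<close>

lemma lattice_gap_stable:
  fixes s :: "'d::finite \<Rightarrow> real"
  assumes gap: "lattice_gap (diag_exp s t0 ** u) k W"
  shows "\<exists>\<delta>>0. \<forall>t. \<bar>t - t0\<bar> < \<delta> \<longrightarrow> lattice_gap (diag_exp s t ** u) k W"
proof -
  define Q where "Q t \<rho> = {z\<in>integer_lattice. \<forall>i. \<bar>((diag_exp s t ** u) *v z) $ i\<bar> \<le> \<rho>}" for t \<rho>
  obtain \<rho> \<rho>' where \<rho>: "0 < \<rho>" "\<rho> < \<rho>'" "W = span (Q t0 \<rho>)" "Q t0 \<rho>' \<subseteq> W" and dim: "dim W = k"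
    using gap unfolding lattice_gap_def Q_def by blast
  define c where "c = 1 + (\<Sum>i\<in>UNIV. \<bar>s i\<bar>)"
  have c: "c > 0" "\<And>i. \<bar>s i\<bar> \<le> c"
  proof -
    show "c > 0" by (auto simp: c_def intro!: add_pos_nonneg sum_nonneg)
    show "\<bar>s i\<bar> \<le> c" for i
      using member_le_sum[of i UNIV "\<lambda>i. \<bar>s i\<bar>"] by (simp add: c_def)
  qed
  \<comment> \<open>Gives \<open>?E ^ 3 = \<rho>' / \<rho>\<close>: one factor is lost at each end
    of the gap, and the third remains between the new radii.\<close>
  define \<delta> where "\<delta> = ln (\<rho>' / \<rho>) / (3 * c)"
  have "ln (\<rho>' / \<rho>) > 0" using \<rho> by simp
  then have \<delta>: "\<delta> > 0" using c by (simp add: \<delta>_def)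
  have shift: "Q t1 r \<subseteq> Q t2 (exp (c * \<delta>) * r)" if "\<bar>t2 - t1\<bar> < \<delta>" for t1 t2 r
  proof -
    have "\<bar>((diag_exp s t2 ** u) *v z) $ i\<bar> \<le> exp (c * \<delta>) * r"
      if b: "\<bar>((diag_exp s t1 ** u) *v z) $ i\<bar> \<le> r" for z i
    proof -
      have "s i * (t2 - t1) \<le> \<bar>s i * (t2 - t1)\<bar>" by simp
      also have "\<dots> \<le> c * \<delta>"
        unfolding abs_mult using c \<open>\<bar>t2 - t1\<bar> < \<delta>\<close> by (intro mult_mono) auto
      finally have e: "exp (s i * (t2 - t1)) \<le> exp (c * \<delta>)" by simp
      have "\<bar>((diag_exp s t2 ** u) *v z) $ i\<bar> = exp (s i * (t2 - t1)) * \<bar>((diag_exp s t1 ** u) *v z) $ i\<bar>"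
        by (simp add: matrix_vector_mul_assoc[symmetric] diag_exp_mult abs_mult mult.assoc[symmetric]
            exp_add[symmetric] algebra_simps)
      also have "\<dots> \<le> exp (c * \<delta>) * r"
        using b e by (intro mult_mono) auto
      finally show ?thesis .
    qed
    then show ?thesis unfolding Q_def by blast
  qed
  have mono: "Q t r \<subseteq> Q t r'" if "r \<le> r'" for t r r' using that unfolding Q_def by (auto intro: order.trans)
  have "lattice_gap (diag_exp s t ** u) k W" if t: "\<bar>t - t0\<bar> < \<delta>" for t
  proof -
    let ?E = "exp (c * \<delta>)"
    have t': "\<bar>t0 - t\<bar> < \<delta>" using t by (simp add: abs_minus_commute)
    have E3: "?E * (?E * (?E * \<rho>)) = \<rho>'"
    proof -
      have "?E * (?E * (?E * \<rho>)) = exp (3 * (c * \<delta>)) * \<rho>"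
        by (simp add: mult.assoc[symmetric] exp_add[symmetric])
      also have "3 * (c * \<delta>) = ln (\<rho>' / \<rho>)" using c by (simp add: \<delta>_def)
      finally show ?thesis using \<rho> by simp
    qed
    have E1: "?E > 1" using c \<delta> by simp
    define r where "r = ?E * \<rho>"
    define r' where "r' = ?E * (?E * \<rho>)"
    have r: "0 < r" "r < r'" using \<rho> E1 by (auto simp: r_def r'_def)
    have "Q t r' \<subseteq> Q t0 (?E * r')" by (rule shift[OF t'])
    also have "\<dots> \<subseteq> W" using \<rho>(4) E3 by (simp add: r'_def)
    finally have sub: "Q t r' \<subseteq> W" .
    have "span (Q t r) \<subseteq> W"
      using sub mono[of r r' t] r \<rho>(3) by (intro span_minimal) auto
    moreover have "W \<subseteq> span (Q t r)"
      unfolding \<rho>(3) r_def by (intro span_mono shift t)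
    ultimately have "W = span (Q t r)" by blast
    then show ?thesis
      unfolding lattice_gap_def using sub r dim unfolding Q_def by blast
  qed
  then show ?thesis using \<delta> by blast
qed

text \<open>Stability and uniqueness make the subspace locally constant in \<open>t\<close>, and a
  half-line is connected.\<close>

lemma lattice_gap_eventually_constant:
  fixes s :: "'d::finite \<Rightarrow> real"
  assumes "\<And>t. t \<ge> T \<Longrightarrow> \<exists>W. lattice_gap (diag_exp s t ** u) k W"
  shows "\<exists>W. \<forall>t\<ge>T. lattice_gap (diag_exp s t ** u) k W"
proof -
  obtain W where W: "lattice_gap (diag_exp s T ** u) k W" using assms by blast
  have "lattice_gap (diag_exp s t ** u) k W" if "t \<ge> T" for t
  proof (rule connected_induction_simple[of "{T..}" T t "\<lambda>t. lattice_gap (diag_exp s t ** u) k W"])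
    fix a assume a: "a \<in> {T..}"
    then obtain W' where W': "lattice_gap (diag_exp s a ** u) k W'" using assms by auto
    then obtain \<delta> where \<delta>: "\<delta> > 0" "\<And>t. \<bar>t - a\<bar> < \<delta> \<Longrightarrow> lattice_gap (diag_exp s t ** u) k W'"
      using lattice_gap_stable by blast
    let ?T = "{T..} \<inter> ball a \<delta>"
    have "lattice_gap (diag_exp s y ** u) k W"
      if "x \<in> ?T" "y \<in> ?T" "lattice_gap (diag_exp s x ** u) k W" for x y
    proof -
      have "lattice_gap (diag_exp s x ** u) k W'" "lattice_gap (diag_exp s y ** u) k W'"
        using that \<delta> by (auto simp: dist_real_def abs_minus_commute)
      then show ?thesis using lattice_gap_unique that(3) by blast
    qed
    moreover have "openin (top_of_set {T..}) ?T" by (rule openin_open_Int) simp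
    moreover have "a \<in> ?T" using a \<delta> by simp
    ultimately show "\<exists>T'. openin (top_of_set {T..}) T' \<and> a \<in> T' \<and>
        (\<forall>x\<in>T'. \<forall>y\<in>T'. lattice_gap (diag_exp s x ** u) k W \<longrightarrow> lattice_gap (diag_exp s y ** u) k W)"
      by (intro exI[of _ ?T] conjI ballI impI)
  next
    show "connected {T..}" by (intro convex_connected convex_real_interval)
  qed (use that W in simp_all)
  then show ?thesis by blast
qed

lemma lattice_gap_basis:
  assumes "lattice_gap g k W"
  shows "\<exists>B. B \<subseteq> integer_lattice \<and> independent B \<and> card B = k \<and> span B = W"
proof -
  obtain \<rho> where \<rho>: "W = span {z\<in>integer_lattice. \<forall>i. \<bar>(g *v z) $ i\<bar> \<le> \<rho>}" and dim: "dim W = k"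
    using assms unfolding lattice_gap_def by blast
  define X where "X = {z\<in>integer_lattice. \<forall>i. \<bar>(g *v z) $ i\<bar> \<le> \<rho>}"
  have X: "X \<subseteq> integer_lattice" "W = span X" "dim X = k" using \<rho> dim by (auto simp: X_def)
  obtain B where "B \<subseteq> X" "independent B" "X \<subseteq> span B" "card B = dim X" by (rule basis_exists)
  moreover from this have "span B = span X" by (intro antisym span_minimal span_mono subspace_span)
  ultimately show ?thesis using X by (intro exI[of _ B]) auto
qed

text \<open>If the sum were positive, then at a late time \<open>t\<close> every nonzero coordinate
  of a frame from the short vectors \<open>F\<close> would exceed \<open>C\<close>. Take a frame
  \<open>z\<close> with the least one. A box in the coordinates of its matrix has volume above 1 and
  yields a vector \<open>z0\<close> that is again in \<open>F\<close>, hence a combination of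
  \<open>z\<close> with coefficients at most 1/2 in absolute value. Exchanging a frame vector for
  \<open>z0\<close> then gives a smaller nonzero coordinate, a contradiction.\<close>

lemma gap_weight_nonpos:
  fixes s :: "'d::{finite,wellorder} \<Rightarrow> real" and u :: "real ^ 'd::{finite,wellorder} ^ 'd::{finite,wellorder}"
  assumes s: "(\<Sum>i\<in>UNIV. s i) = 0" and u: "det u = 1"
    and gap: "\<And>t. t \<ge> T \<Longrightarrow> lattice_gap (diag_exp s t ** u) (card S) W"
    and tr: "\<And>w. w \<in> W \<Longrightarrow> (\<And>i. i \<in> S \<Longrightarrow> (u *v w) $ i = 0) \<Longrightarrow> w = 0"
  shows "(\<Sum>i\<in>S. s i) \<le> 0"
proof (rule ccontr)
  assume "\<not> ?thesis"
  then have spos: "(\<Sum>i\<in>S. s i) > 0" by simp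
  let ?d = "real CARD('d)"
  define G where "G t z = column_matrix (diag_exp s t ** u) S z" for t z
  obtain B where B: "B \<subseteq> integer_lattice" "independent B" "card B = card S" "span B = W"
    using lattice_gap_basis[OF gap[OF order.refl]] by blast
  obtain c where c: "c > 0" "\<And>z. (\<And>j. j \<in> S \<Longrightarrow> z j \<in> W \<inter> integer_lattice) \<Longrightarrow>
      det (column_matrix u S z) \<noteq> 0 \<Longrightarrow> c \<le> \<bar>det (column_matrix u S z)\<bar>"
    using column_matrix_lower_bound[OF B(1-3), of u] B(4) by blast
  have detG: "\<bar>det (G t z)\<bar> = exp ((\<Sum>i\<in>S. s i) * t) * \<bar>det (column_matrix u S z)\<bar>" for t z
    unfolding G_def det_column_matrix_flow[OF s] by (simp add: abs_mult)
  \<comment> \<open>The first entry, compared with the column bound of the determinant, forces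
    \<open>\<rho> \<ge> 2\<close>. The second compensates for a box whose sides are at least
    \<open>1 / (2 * ?d)\<close>.\<close>
  define C where "C = max (fact CARD('d) * 2 ^ CARD('d)) ((2 * ?d) ^ CARD('d))"
  obtain t where t: "t \<ge> T" "exp ((\<Sum>i\<in>S. s i) * t) * c > C"
  proof -
    have "filterlim (\<lambda>t. exp ((\<Sum>i\<in>S. s i) * t) * c) at_top at_top"
      using spos c(1)
      by (intro filterlim_at_top_mult_tendsto_pos[OF tendsto_const] filterlim_compose[OF exp_at_top]
          filterlim_tendsto_pos_mult_at_top[OF tendsto_const] filterlim_ident)
    then have "\<forall>\<^sub>F t in at_top. exp ((\<Sum>i\<in>S. s i) * t) * c > C"
      by (simp add: filterlim_at_top_dense)
    with eventually_ge_at_top[of T] have "\<forall>\<^sub>F t in at_top. t \<ge> T \<and> exp ((\<Sum>i\<in>S. s i) * t) * c > C"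
      by (rule eventually_conj)
    from eventually_happens[OF this] show thesis using that by auto
  qed
  define g where "g = diag_exp s t ** u"
  have detg: "det g = 1" by (simp add: g_def det_mul det_diag_exp s u)
  then have invg: "invertible g" by (simp add: invertible_det_nz)
  obtain \<rho> \<rho>' where \<rho>: "0 < \<rho>" "\<rho> < \<rho>'"
      "W = span {z\<in>integer_lattice. \<forall>i. \<bar>(g *v z) $ i\<bar> \<le> \<rho>}" and dimW: "dim W = card S"
    using gap[OF t(1)] unfolding lattice_gap_def g_def by blast
  define F where "F = {z\<in>integer_lattice. \<forall>i. \<bar>(g *v z) $ i\<bar> \<le> \<rho>}"
  have finF: "finite F" unfolding F_def by (rule finite_lattice_box[OF invg])
  have FW: "F \<subseteq> W" "W = span F" using \<rho>(3) by (auto simp: F_def span_base)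
  have subW: "subspace W" using FW by simp
  \<comment> \<open>Extensional functions into the finite set \<open>F\<close> form a finite set, so
    a least coordinate is attained.\<close>
  define Z where "Z = {z \<in> S \<rightarrow>\<^sub>E F. det (G t z) \<noteq> 0}"
  have Zlarge: "\<bar>det (G t z)\<bar> > C" if "z \<in> Z" for z
  proof -
    have "det (column_matrix u S z) \<noteq> 0" using that detG[of t z] by (auto simp: Z_def)
    moreover have "z j \<in> W \<inter> integer_lattice" if "j \<in> S" for j
      using that \<open>z \<in> Z\<close> FW(1) by (auto simp: Z_def F_def)
    ultimately have "c \<le> \<bar>det (column_matrix u S z)\<bar>" by (intro c(2))
    then have "exp ((\<Sum>i\<in>S. s i) * t) * c \<le> \<bar>det (G t z)\<bar>" unfolding detG by simp
    with t(2) show ?thesis by linarith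
  qed
  have "finite (S \<rightarrow>\<^sub>E F)" by (intro finite_PiE finF) simp
  then have finZ: "finite Z" unfolding Z_def by simp
  have "Z \<noteq> {}"
  proof -
    obtain B' where B': "B' \<subseteq> F" "independent B'" "F \<subseteq> span B'" "card B' = dim F" by (rule basis_exists)
    have "card S = card B'" using B'(4) dimW FW(2) by simp
    then obtain z where z: "bij_betw z S B'"
      using finite_same_card_bij[OF finite[of S] finite_subset[OF B'(1) finF]] by blast
    let ?z = "restrict z S"
    have z': "bij_betw ?z S B'" using z by (simp add: bij_betw_def inj_on_def cong: image_cong)
    have "det (column_matrix u S ?z) \<noteq> 0"
    proof (rule column_matrix_nonsingular[OF free_family_bij[OF B'(2) z'] subW])
      show "?z j \<in> W" if "j \<in> S" for j using bij_betw_apply[OF z' that] B'(1) FW(1) by blast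
    qed (use tr in blast)
    then have "det (G t ?z) \<noteq> 0" using detG[of t ?z] by auto
    moreover have "?z \<in> S \<rightarrow>\<^sub>E F" using bij_betw_apply[OF z] B'(1) by auto
    ultimately show ?thesis unfolding Z_def by blast
  qed
  then obtain z where z: "z \<in> Z" and zmin: "\<And>z'. z' \<in> Z \<Longrightarrow> \<bar>det (G t z)\<bar> \<le> \<bar>det (G t z')\<bar>"
    using ex_is_arg_min_if_finite[OF finZ, of "\<lambda>z. \<bar>det (G t z)\<bar>"]
    by (auto simp: is_arg_min_linorder)
  let ?A = "G t z"
  have zF: "z j \<in> F" if "j \<in> S" for j using z that by (auto simp: Z_def)
  have nz: "det ?A \<noteq> 0" using z by (simp add: Z_def)
  have entry: "\<bar>?A $ i $ j\<bar> \<le> (if j \<in> S then \<rho> else if i = j then 1 else 0)" for i j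
    using zF by (auto simp: G_def column_matrix_def F_def g_def)
  have \<rho>2: "\<rho> \<ge> 2"
  proof (rule ccontr)
    assume "\<not> ?thesis"
    then have "\<rho> \<le> 2" by simp
    have "\<bar>?A $ i $ j\<bar> \<le> (if j \<in> S then \<rho> else 1)" for i j
      using entry[of i j] by (auto split: if_splits)
    then have "\<bar>det ?A\<bar> \<le> fact CARD('d) * (\<Prod>j\<in>UNIV. if j \<in> S then \<rho> else 1)"
      by (rule det_column_bound)
    also have "\<dots> \<le> fact CARD('d) * (\<Prod>j\<in>(UNIV::'d set). 2)"
      using \<open>\<rho> \<le> 2\<close> \<rho>(1) by (intro mult_left_mono prod_mono) auto
    also have "\<dots> \<le> C" by (simp add: C_def)
    finally show False using Zlarge[OF z] by simp
  qed
  \<comment> \<open>The minimality of \<open>z\<close> excludes that the short vector \<open>z0\<close> found in this box lies in \<open>W\<close>, while the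
    gap puts it there.\<close>
  define a where "a j = (if j \<in> S then 1 / (2 * ?d) else \<rho> / 2)" for j
  have d1: "1 \<le> ?d" by (simp add: Suc_leI)
  have a0: "a j \<ge> 0" for j using \<rho>(1) by (simp add: a_def)
  have apart: "(1 / (2 * ?d)) ^ CARD('d) \<le> (\<Prod>j\<in>UNIV. a j)"
  proof -
    have "(1 / (2 * ?d)) ^ CARD('d) = (\<Prod>j\<in>(UNIV::'d set). 1 / (2 * ?d))" by simp
    also have "\<dots> \<le> (\<Prod>j\<in>UNIV. a j)"
    proof (intro prod_mono conjI)
      have "1 / (2 * ?d) \<le> 1" using d1 by (subst divide_le_eq_1) linarith
      also have "1 \<le> \<rho> / 2" using \<rho>2 by simp
      finally show "1 / (2 * ?d) \<le> a j" for j unfolding a_def by (cases "j \<in> S") simp_all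
    qed simp
    finally show ?thesis .
  qed
  obtain h where h: "g ** h = mat 1" using invg unfolding invertible_def by blast
  have deth: "det h = 1"
  proof -
    have "det g * det h = 1" unfolding det_mul[symmetric] h by simp
    then show ?thesis using detg by simp
  qed
  have "1 < \<bar>det (h ** ?A)\<bar> * (\<Prod>j\<in>UNIV. a j)"
  proof -
    have "2 * ?d * (1 / (2 * ?d)) = 1" using d1 by simp
    then have "1 = (2 * ?d) ^ CARD('d) * (1 / (2 * ?d)) ^ CARD('d)"
      unfolding power_mult_distrib[symmetric] by simp
    also have "\<dots> < \<bar>det ?A\<bar> * (1 / (2 * ?d)) ^ CARD('d)"
      using Zlarge[OF z] by (intro mult_strict_right_mono) (auto simp: C_def)
    also have "\<dots> \<le> \<bar>det ?A\<bar> * (\<Prod>j\<in>UNIV. a j)"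
      using apart by (intro mult_left_mono) auto
    finally show ?thesis by (simp add: det_mul deth)
  qed
  from linear_forms_box[of a "h ** ?A", OF a0 this]
  obtain \<sigma> where \<sigma>: "\<sigma> \<noteq> 0" "\<And>j. \<bar>\<sigma> $ j\<bar> \<le> a j" "(h ** ?A) *v \<sigma> \<in> integer_lattice"
    by blast
  define z0 where "z0 = (h ** ?A) *v \<sigma>"
  have gz0: "g *v z0 = ?A *v \<sigma>"
    unfolding z0_def by (simp add: matrix_vector_mul_assoc matrix_mul_assoc h)
  have "z0 \<in> F"
  proof -
    have "\<bar>(g *v z0) $ i\<bar> \<le> \<rho>" for i
    proof -
      have "\<bar>(g *v z0) $ i\<bar> = \<bar>\<Sum>j\<in>UNIV. ?A $ i $ j * \<sigma> $ j\<bar>"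
        unfolding gz0 by (simp add: matrix_vector_mult_def)
      also have "\<dots> \<le> (\<Sum>j\<in>UNIV. \<bar>?A $ i $ j * \<sigma> $ j\<bar>)" by (rule sum_abs)
      \<comment> \<open>This explains the side lengths: at most \<open>?d\<close> columns in
        \<open>S\<close> contribute \<open>\<rho> / (2 * ?d)\<close> each, and of the unit columns
        only column \<open>i\<close> can contribute, at most \<open>\<rho> / 2\<close>. The total is
        the radius defining \<open>F\<close>.\<close>
      also have "\<dots> \<le> (\<Sum>j\<in>UNIV. \<rho> / (2 * ?d) + (if j = i then \<rho> / 2 else 0))"
      proof (rule sum_mono)
        fix j
        have "\<bar>?A $ i $ j * \<sigma> $ j\<bar> \<le> (if j \<in> S then \<rho> else if i = j then 1 else 0) * a j"
          unfolding abs_mult using entry[of i j] \<sigma>(2)[of j] \<rho>(1) by (intro mult_mono) auto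
        also have "\<dots> \<le> \<rho> / (2 * ?d) + (if j = i then \<rho> / 2 else 0)"
          using \<rho>(1) by (auto simp: a_def)
        finally show "\<bar>?A $ i $ j * \<sigma> $ j\<bar> \<le> \<rho> / (2 * ?d) + (if j = i then \<rho> / 2 else 0)" .
      qed
      also have "\<dots> = \<rho>" by (simp add: sum.distrib)
      finally show ?thesis .
    qed
    then show ?thesis using \<sigma>(3) by (simp add: F_def z0_def)
  qed
  have dim_eq: "z ` S \<subseteq> W" using zF FW(1) by blast
  obtain \<tau> where \<tau>: "z0 = (\<Sum>j\<in>S. \<tau> j *\<^sub>R z j)"
    using free_family_spans[OF finite column_matrix_free[OF nz[unfolded G_def]] dim_eq dimW] \<open>z0 \<in> F\<close> FW(1)
    by blast
  define v where "v = (\<chi> j. if j \<in> S then \<tau> j else 0)"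
  have sumv: "(\<Sum>j\<in>S. v $ j *\<^sub>R z j) = z0" unfolding \<tau> by (intro sum.cong) (auto simp: v_def)
  have "?A *v v = g *v z0"
    unfolding G_def column_matrix_mult sumv by (simp add: vec_eq_iff v_def g_def)
  then have "?A *v (\<sigma> - v) = 0" by (simp add: gz0 matrix_vector_mult_diff_distrib)
  then have "\<sigma> - v = 0" using nz unfolding det_nz_iff_ker by blast
  then have \<sigma>v: "\<sigma> = v" by simp
  then obtain j0 where j0: "j0 \<in> S" "\<sigma> $ j0 \<noteq> 0"
    using \<sigma>(1) by (auto simp: vec_eq_iff v_def split: if_splits)
  define z' where "z' = z(j0 := z0)"
  \<comment> \<open>Exchanging \<open>z j0\<close> for \<open>z0\<close> replaces column
    \<open>j0\<close> by \<open>?A *v \<sigma>\<close>, so Cramer's rule gives the factor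
    \<open>\<sigma> $ j0\<close>.\<close>
  have "G t z' = (\<chi> i j. if j = j0 then (?A *v \<sigma>) $ i else ?A $ i $ j)"
    using j0(1) unfolding gz0[symmetric] by (simp add: G_def z'_def column_matrix_def vec_eq_iff g_def)
  then have det': "det (G t z') = \<sigma> $ j0 * det ?A" by (simp add: cramer_lemma)
  then have "det (G t z') \<noteq> 0" using nz j0 by simp
  moreover have "z' \<in> S \<rightarrow>\<^sub>E F" using z j0(1) \<open>z0 \<in> F\<close> by (auto simp: Z_def z'_def PiE_def extensional_def)
  ultimately have "\<bar>det ?A\<bar> \<le> \<bar>\<sigma> $ j0\<bar> * \<bar>det ?A\<bar>"
    using zmin[of z'] det' by (simp add: Z_def abs_mult)
  then have "1 \<le> \<bar>\<sigma> $ j0\<bar>" using nz by simp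
  moreover have "\<bar>\<sigma> $ j0\<bar> \<le> 1 / 2"
  proof -
    have "\<bar>\<sigma> $ j0\<bar> \<le> 1 / (2 * ?d)" using \<sigma>(2)[of j0] j0(1) by (simp add: a_def)
    also have "\<dots> \<le> 1 / 2"
      using d1 by (intro divide_left_mono) auto
    finally show ?thesis .
  qed
  ultimately show False by simp
qed

section \<open>Successive minima\<close>

lemma scaled_unit_cube:
  assumes "r > 0"
  shows "(*\<^sub>R) r ` unit_cube = {v :: real ^ 'd::finite. \<forall>j. \<bar>v $ j\<bar> \<le> r / 2}"
proof (intro set_eqI iffI)
  fix v :: "real ^ 'd" assume "v \<in> (*\<^sub>R) r ` unit_cube"
  then obtain w where w: "v = r *\<^sub>R w" "w \<in> unit_cube" by blast
  from w(2) have w2: "\<bar>w $ j\<bar> \<le> 1 / 2" for j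
    by (auto simp: unit_cube_def mem_box_cart abs_le_iff dest!: spec[of _ j])
  have "\<bar>v $ j\<bar> \<le> r / 2" for j
    using mult_left_mono[OF w2[of j], of r] assms by (simp add: w(1) abs_mult)
  then show "v \<in> {v. \<forall>j. \<bar>v $ j\<bar> \<le> r / 2}" by blast
next
  fix v :: "real ^ 'd" assume v: "v \<in> {v. \<forall>j. \<bar>v $ j\<bar> \<le> r / 2}"
  have "\<bar>(inverse r *\<^sub>R v) $ j\<bar> \<le> 1 / 2" for j
  proof -
    have "\<bar>(inverse r *\<^sub>R v) $ j\<bar> = inverse r * \<bar>v $ j\<bar>" using assms by (simp add: abs_mult)
    also have "\<dots> \<le> inverse r * (r / 2)" using v assms by (intro mult_left_mono) auto
    finally show ?thesis using assms by simp
  qed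
  then have "- 1 / 2 \<le> (inverse r *\<^sub>R v) $ j \<and> (inverse r *\<^sub>R v) $ j \<le> 1 / 2" for j
    using abs_le_iff[of "(inverse r *\<^sub>R v) $ j" "1 / 2"] by auto
  then have "inverse r *\<^sub>R v \<in> unit_cube"
    unfolding unit_cube_def mem_box_cart by simp
  moreover have "v = r *\<^sub>R (inverse r *\<^sub>R v)" using assms by simp
  ultimately show "v \<in> (*\<^sub>R) r ` unit_cube" by blast
qed

text \<open>The bound is \<open>r / 2\<close> because \<open>unit_cube\<close> has side 1 and is
  centred at 0.\<close>

definition short_vectors :: "real ^ 'd::finite ^ 'd \<Rightarrow> real \<Rightarrow> (real ^ 'd) set" where
  "short_vectors g r = {z\<in>integer_lattice. \<forall>j. \<bar>(g *v z) $ j\<bar> \<le> r / 2}"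

lemma short_vectors_mono: "r \<le> r' \<Longrightarrow> short_vectors g r \<subseteq> short_vectors g r'"
  by (auto simp: short_vectors_def intro: order.trans)

lemma independent_set_in_cube_iff:
  fixes g :: "real ^ 'd::finite ^ 'd"
  assumes g: "invertible g" and r: "r > 0"
  shows "(\<exists>S. S \<subseteq> (*\<^sub>R) r ` unit_cube \<inter> (*v) g ` integer_lattice \<and> independent S \<and> finite S \<and> card S = i)
    \<longleftrightarrow> i \<le> dim (short_vectors g r)"
proof
  have inj: "inj ((*v) g)"
    using g by (metis invertible_left_inverse matrix_left_invertible_injective)
  have lin: "linear ((*v) g)" by simp
  have eq: "(*\<^sub>R) r ` unit_cube \<inter> (*v) g ` integer_lattice = (*v) g ` short_vectors g r"
    unfolding scaled_unit_cube[OF r] by (auto simp: short_vectors_def)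
  {
    assume "\<exists>S. S \<subseteq> (*\<^sub>R) r ` unit_cube \<inter> (*v) g ` integer_lattice \<and> independent S \<and> finite S \<and> card S = i"
    then obtain S where S: "S \<subseteq> (*v) g ` short_vectors g r" "independent S" "card S = i"
      unfolding eq by blast
    then have "i \<le> dim ((*v) g ` short_vectors g r)" using independent_card_le_dim by blast
    also have "\<dots> \<le> dim (short_vectors g r)" by (rule dim_image_le[OF lin])
    finally show "i \<le> dim (short_vectors g r)" .
  }
  assume "i \<le> dim (short_vectors g r)"
  moreover obtain B where B: "B \<subseteq> short_vectors g r" "independent B" "card B = dim (short_vectors g r)"
    by (rule basis_exists)
  ultimately obtain B' where B': "B' \<subseteq> B" "card B' = i"
    using obtain_subset_with_card_n by metis
  have ind: "independent B'" using B(2) B'(1) independent_mono by blast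
  have "independent ((*v) g ` B')"
    using inj by (intro linear_independent_injective_image[OF lin ind]) (rule inj_on_subset, auto)
  moreover have "card ((*v) g ` B') = i" using B'(2) inj by (simp add: card_image inj_on_subset)
  moreover have "finite ((*v) g ` B')" using finiteI_independent[OF ind] by simp
  ultimately show "\<exists>S. S \<subseteq> (*\<^sub>R) r ` unit_cube \<inter> (*v) g ` integer_lattice \<and> independent S \<and> finite S \<and> card S = i"
    unfolding eq using B(1) B'(1) by (intro exI[of _ "(*v) g ` B'"]) auto
qed

text \<open>\<open>LEAST\<close> over the reals has the intended value only if a least element
  exists. The rank of \<open>?E r\<close> changes only when \<open>r\<close> passes a value
  \<open>N z\<close>, so the search can be confined to the finite set \<open>R\<close> of such
  values up to \<open>r1\<close>.\<close>

lemma successive_minimum_attained: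
  fixes g :: "real ^ 'd::finite ^ 'd"
  assumes g: "invertible g" and i: "1 \<le> i" "i \<le> CARD('d)"
  defines "r0 \<equiv> successive_minimum i ((*v) g ` integer_lattice)"
  shows "r0 > 0" "i \<le> dim (short_vectors g r0)" "\<And>r. i \<le> dim (short_vectors g r) \<Longrightarrow> r0 \<le> r"
proof -
  let ?E = "short_vectors g"
  define N where "N z = Max (range (\<lambda>j. 2 * \<bar>(g *v z) $ j\<bar>))" for z
  have N: "N z \<le> r \<longleftrightarrow> (\<forall>j. \<bar>(g *v z) $ j\<bar> \<le> r / 2)" for z r
    unfolding N_def by (subst Max_le_iff) (simp_all add: le_divide_eq mult.commute)
  have E: "?E r = {z\<in>integer_lattice. N z \<le> r}" for r
    by (simp add: short_vectors_def N)
  have fin: "finite (?E r)" for r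
    unfolding short_vectors_def by (rule finite_lattice_box[OF g])
  have pos: "r > 0" if "i \<le> dim (?E r)" for r
  proof (rule ccontr)
    assume "\<not> r > 0"
    have "z = 0" if "z \<in> ?E r" for z
    proof -
      have "g *v z = 0" using that \<open>\<not> r > 0\<close> by (auto simp: short_vectors_def vec_eq_iff) (smt (verit) abs_le_zero_iff field_sum_of_halves)
      then show ?thesis using g by (metis invertible_left_inverse matrix_left_invertible_ker)
    qed
    then have "?E r \<subseteq> {0}" by blast
    then have "dim (?E r) = 0" by (metis dim_eq_0)
    then show False using that i(1) by linarith
  qed
  \<comment> \<open>Large enough for all unit vectors to be short, so that the rank is full at
    \<open>r1\<close>.\<close>
  define r1 where "r1 = Max (range (\<lambda>j. N (axis j 1)))"
  have "range (\<lambda>j. axis j 1) \<subseteq> ?E r1"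
    unfolding E r1_def by (auto simp: integer_lattice_def axis_def)
  moreover have "(Basis :: (real ^ 'd) set) \<subseteq> range (\<lambda>j. axis j 1)" by (auto simp: Basis_vec_def)
  ultimately have "dim (Basis :: (real ^ 'd) set) \<le> dim (?E r1)" by (intro dim_subset) blast
  moreover have "dim (Basis :: (real ^ 'd) set) = CARD('d)"
    by (subst dim_eq_card_independent[OF independent_Basis]) simp
  ultimately have r1: "i \<le> dim (?E r1)" using i by linarith
  define R where "R = {r \<in> N ` ?E r1. i \<le> dim (?E r)}"
  have finR: "finite R" unfolding R_def using fin by simp
  have below: "\<exists>\<rho>\<in>R. \<rho> \<le> r" if r: "i \<le> dim (?E r)" "r \<le> r1" for r
  proof -
    have ne: "?E r \<noteq> {}" using r(1) i by auto
    \<comment> \<open>Lowering \<open>r\<close> to the largest norm that occurs loses no vector and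
      lands in \<open>R\<close>.\<close>
    define \<rho> where "\<rho> = Max (N ` ?E r)"
    have "\<rho> \<in> N ` ?E r" unfolding \<rho>_def using ne fin by (intro Max_in) auto
    then obtain z where z: "z \<in> ?E r" "\<rho> = N z" by blast
    have "?E r \<subseteq> ?E \<rho>" using fin[of r] by (auto simp: E \<rho>_def)
    then have "i \<le> dim (?E \<rho>)" using r(1) dim_subset order.trans by blast
    moreover have "z \<in> ?E r1" using z(1) short_vectors_mono[OF r(2)] by blast
    ultimately have "\<rho> \<in> R" using z(2) by (auto simp: R_def)
    moreover have "\<rho> \<le> r" using z by (simp add: E)
    ultimately show ?thesis by blast
  qed
  define m where "m = Min R"
  have "R \<noteq> {}" using below[OF r1] by blast
  then have mR: "m \<in> R" unfolding m_def using finR by (intro Min_in)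
  have m1: "m \<le> r1" using below[OF r1] finR by (auto simp: m_def intro: order.trans[OF Min_le])
  have least: "m \<le> r" if "i \<le> dim (?E r)" for r
  proof (cases "r \<le> r1")
    case True
    then show ?thesis using below[OF that] finR by (auto simp: m_def intro: order.trans[OF Min_le])
  qed (use m1 in simp)
  have mE: "i \<le> dim (?E m)" using mR by (simp add: R_def)
  have "r0 = m"
    unfolding r0_def successive_minimum_def
  proof (rule Least_equality)
    show "m > 0 \<and> (\<exists>S. S \<subseteq> (*\<^sub>R) m ` unit_cube \<inter> (*v) g ` integer_lattice \<and> independent S \<and> finite S \<and> card S = i)"
      using pos[OF mE] independent_set_in_cube_iff[OF g pos[OF mE]] mE by blast
  next
    fix r assume "r > 0 \<and> (\<exists>S. S \<subseteq> (*\<^sub>R) r ` unit_cube \<inter> (*v) g ` integer_lattice \<and> independent S \<and> finite S \<and> card S = i)"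
    then show "m \<le> r" using independent_set_in_cube_iff[OF g] least by blast
  qed
  then show "r0 > 0" "i \<le> dim (?E r0)" "\<And>r. i \<le> dim (?E r) \<Longrightarrow> r0 \<le> r"
    using pos[OF mE] mE least by auto
qed

lemma lattice_gap_of_minima:
  fixes g :: "real ^ 'd::finite ^ 'd"
  assumes g: "invertible g" and k: "1 \<le> k" "Suc k \<le> CARD('d)"
    and ne: "ln (successive_minimum k ((*v) g ` integer_lattice)) \<noteq> ln (successive_minimum (Suc k) ((*v) g ` integer_lattice))"
  shows "\<exists>W. lattice_gap g k W"
proof -
  let ?E = "short_vectors g"
  define a where "a = successive_minimum k ((*v) g ` integer_lattice)"
  define b where "b = successive_minimum (Suc k) ((*v) g ` integer_lattice)"
  have a: "a > 0" "k \<le> dim (?E a)" "\<And>r. k \<le> dim (?E r) \<Longrightarrow> a \<le> r"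
    unfolding a_def using successive_minimum_attained[OF g, of k] k by simp_all
  have b: "b > 0" "Suc k \<le> dim (?E b)" "\<And>r. Suc k \<le> dim (?E r) \<Longrightarrow> b \<le> r"
    unfolding b_def using successive_minimum_attained[OF g, of "Suc k"] k by simp_all
  have "a \<le> b" using a(3)[of b] b(2) by simp
  moreover have "a \<noteq> b" using ne unfolding a_def b_def by auto
  ultimately have ab: "a < b" by simp
  \<comment> \<open>Strictly below \<open>b\<close>, where the rank first exceeds \<open>k\<close>,
    and strictly above \<open>a\<close>, to leave room for a gap.\<close>
  define r where "r = (a + b) / 2"
  have r: "a < r" "r < b" using ab by (auto simp: r_def)
  have dr: "dim (?E r) \<le> k" using b(3)[of r] r by (meson not_less not_less_eq_eq)
  have sub: "?E a \<subseteq> ?E r" using r by (intro short_vectors_mono) simp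
  then have da: "dim (?E a) = k" using a(2) dr dim_subset[OF sub] by simp
  have "span (?E a) = span (?E r)"
    using span_mono[OF sub] da dr dim_subset[OF sub] by (intro subspace_dim_equal) auto
  then have "?E r \<subseteq> span (?E a)" by (simp add: span_superset)
  then have "lattice_gap g k (span (?E a))"
    unfolding lattice_gap_def short_vectors_def
    using a(1) r da[unfolded short_vectors_def] by (intro conjI exI[of _ "a / 2"] exI[of _ "r / 2"]) auto
  then show ?thesis ..
qed

section \<open>The minima along the flow\<close>

definition flow_exponent :: "real ^ ('m::finite + 'n::finite) \<Rightarrow> 'm + 'n \<Rightarrow> real" where
  "flow_exponent \<omega> i = (case i of Inl _ \<Rightarrow> \<omega> $ i | Inr _ \<Rightarrow> - \<omega> $ i)"

lemma diag_flow_eq_diag_exp: "diag_flow \<omega> t = diag_exp (flow_exponent \<omega>) t"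
  by (auto simp: diag_flow_def diag_exp_def flow_exponent_def vec_eq_iff split: sum.splits)

lemma sum_UNIV_sum:
  "(\<Sum>i\<in>UNIV. f i) = (\<Sum>i\<in>UNIV. f (Inl i)) + (\<Sum>j\<in>UNIV. f (Inr j))"
  for f :: "'m::finite + 'n::finite \<Rightarrow> 'b::comm_monoid_add"
  unfolding UNIV_sum by (subst sum.union_disjoint) (auto simp: sum.reindex)

lemma sum_flow_exponent: "weight_vector \<omega> \<Longrightarrow> (\<Sum>i\<in>UNIV. flow_exponent \<omega> i) = 0"
  by (simp add: sum_UNIV_sum flow_exponent_def weight_vector_def sum_negf)

lemma det_u_mat: "det (u_mat (x :: real ^ 'n::{finite,linorder} ^ 'm::{finite,linorder})) = 1"
proof -
  have "det (u_mat x) = (\<Prod>i\<in>UNIV. u_mat x $ i $ i)"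
    by (rule det_upperdiagonal) (auto simp: u_mat_def less_sum_def less_eq_sum_def split: sum.splits)
  also have "\<dots> = 1"
    by (intro prod.neutral) (auto simp: u_mat_def split: sum.splits)
  finally show ?thesis .
qed

lemma not_connected_at_gap:
  fixes \<omega> :: "real ^ ('m::{finite,linorder} + 'n::{finite,linorder})"
  assumes \<omega>: "weight_vector \<omega>" and k: "1 \<le> k" "k \<le> CARD('m + 'n) - 1"
    and nc: "\<not> connected_at (L_fun \<omega> (Lambda x)) k"
  shows "\<exists>T W. \<forall>t\<ge>T. lattice_gap (diag_exp (flow_exponent \<omega>) t ** u_mat x) k W"
proof -
  obtain T where T: "\<And>t. t \<ge> 0 \<Longrightarrow> L_fun \<omega> (Lambda x) k t = L_fun \<omega> (Lambda x) (Suc k) t \<Longrightarrow> t \<le> T"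
    using nc unfolding connected_at_def bdd_above_def by blast
  have "\<exists>W. lattice_gap (diag_exp (flow_exponent \<omega>) t ** u_mat x) k W" if t: "t \<ge> max 0 T + 1" for t
  proof (rule lattice_gap_of_minima)
    show "invertible (diag_exp (flow_exponent \<omega>) t ** u_mat x)"
      by (simp add: invertible_det_nz det_mul det_diag_exp det_u_mat)
    show "Suc k \<le> CARD('m + 'n)" using k by linarith
    have "(*v) (diag_exp (flow_exponent \<omega>) t ** u_mat x) ` integer_lattice = (*v) (diag_flow \<omega> t) ` Lambda x"
      by (simp add: Lambda_def diag_flow_eq_diag_exp image_image matrix_vector_mul_assoc)
    then show "ln (successive_minimum k ((*v) (diag_exp (flow_exponent \<omega>) t ** u_mat x) ` integer_lattice)) \<noteq>
        ln (successive_minimum (Suc k) ((*v) (diag_exp (flow_exponent \<omega>) t ** u_mat x) ` integer_lattice))"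
      using T[of t] t by (simp add: L_fun_def) linarith
  qed (use k in simp)
  then show ?thesis using lattice_gap_eventually_constant by blast
qed

section \<open>Dimension jumps\<close>

lemma complement_subspace:
  fixes V N :: "'a::euclidean_space set"
  assumes "subspace V" "subspace N" "N \<subseteq> V"
  obtains V1 where "subspace V1" "V1 \<subseteq> V" "V1 \<inter> N = {0}" "dim V1 + dim N = dim V"
    "\<And>v. v \<in> V \<Longrightarrow> \<exists>y\<in>N. \<exists>z\<in>V1. v = y + z"
proof
  let ?V1 = "{y \<in> V. \<forall>x \<in> N. orthogonal x y}"
  show "subspace ?V1"
    using assms(1) by (auto simp: subspace_def orthogonal_def inner_add_right)
  show "?V1 \<inter> N = {0}"
    using assms by (auto simp: orthogonal_def subspace_0)
  show "dim ?V1 + dim N = dim V"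
    by (rule dim_subspace_orthogonal_to_vectors[OF assms(2,1,3)])
  fix v assume v: "v \<in> V"
  obtain y z where yz: "y \<in> span N" "\<And>w. w \<in> span N \<Longrightarrow> orthogonal z w" "v = y + z"
    using orthogonal_subspace_decomp_exists[of N v] by blast
  have y: "y \<in> N" using yz(1) assms(2) by (simp add: span_eq_iff[THEN iffD2])
  have "z = v - y" using yz(3) by simp
  then have "z \<in> V" using v y assms(3) by (auto intro: subspace_diff[OF assms(1)])
  then have "z \<in> ?V1" using yz(2) by (auto simp: span_base orthogonal_commute)
  then show "\<exists>y\<in>N. \<exists>z\<in>?V1. v = y + z" using y yz(3) by blast
qed blast

lemma subspace_kernel_on:
  assumes "linear f" "subspace V"
  shows "subspace {v\<in>V. f v = 0}"
  using assms by (auto simp: subspace_def linear_0 linear_add linear_scale)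

lemma dim_image_kernel:
  fixes f :: "'a::euclidean_space \<Rightarrow> 'b::euclidean_space"
  assumes f: "linear f" and V: "subspace V"
  shows "dim (f ` V) + dim {v\<in>V. f v = 0} = dim V"
proof -
  let ?N = "{v\<in>V. f v = 0}"
  obtain V1 where V1: "subspace V1" "V1 \<subseteq> V" "V1 \<inter> ?N = {0}" "dim V1 + dim ?N = dim V"
    "\<And>v. v \<in> V \<Longrightarrow> \<exists>y\<in>?N. \<exists>z\<in>V1. v = y + z"
    using complement_subspace[OF V subspace_kernel_on[OF f V]] by (metis (no_types, lifting) mem_Collect_eq subsetI)
  have "f ` V = f ` V1"
  proof
    show "f ` V \<subseteq> f ` V1"
    proof
      fix w assume "w \<in> f ` V"
      then obtain v where v: "v \<in> V" "w = f v" by blast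
      with V1(5) obtain y z where "y \<in> ?N" "z \<in> V1" "v = y + z" by blast
      then show "w \<in> f ` V1" using v f by (auto simp: linear_add)
    qed
  qed (use V1 in blast)
  moreover have "inj_on f V1"
  proof (rule inj_onI)
    fix x y assume xy: "x \<in> V1" "y \<in> V1" "f x = f y"
    then have "x - y \<in> V1 \<inter> ?N"
      using V1(1,2) f by (auto simp: linear_diff subspace_diff)
    then show "x = y" using V1(3) by auto
  qed
  then have "dim (f ` V1) = dim V1"
    using V1(1) f by (intro dim_image_eq) (auto simp: span_eq_iff[THEN iffD2])
  ultimately show ?thesis using V1(4) by simp
qed

lemma dim_le_Suc_kernel:
  fixes f :: "'a::euclidean_space \<Rightarrow> real"
  assumes "linear f" "subspace V"
  shows "dim V \<le> Suc (dim {v\<in>V. f v = 0})"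
proof -
  have "dim (f ` V) \<le> 1" using dim_subset_UNIV[of "f ` V"] by simp
  then show ?thesis using dim_image_kernel[OF assms] by simp
qed

lemma coord_span_iff: "v \<in> coord_span S \<longleftrightarrow> (\<forall>i. i \<notin> S \<longrightarrow> v $ i = 0)"
proof
  assume "v \<in> coord_span S"
  then show "\<forall>i. i \<notin> S \<longrightarrow> v $ i = 0"
    unfolding coord_span_def by (induction rule: span_induct_alt) (auto simp: axis_def split: if_splits)
next
  assume "\<forall>i. i \<notin> S \<longrightarrow> v $ i = 0"
  then have "v = (\<Sum>i\<in>S. v $ i *\<^sub>R axis i 1)"
    by (auto simp: vec_eq_iff axis_def if_distrib[of "\<lambda>x. _ * x"] cong: if_cong)
  also have "\<dots> \<in> coord_span S"
    unfolding coord_span_def by (intro span_sum span_scale span_base) auto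
  finally show "v \<in> coord_span S" .
qed

lemma subspace_coord_span: "subspace (coord_span S)"
  by (simp add: coord_span_def)

lemma dim_coord_span_insert:
  assumes "subspace V"
  shows "dim (V \<inter> coord_span (insert b A)) \<le> Suc (dim (V \<inter> coord_span A))"
proof -
  have "dim (V \<inter> coord_span (insert b A)) \<le> Suc (dim {v \<in> V \<inter> coord_span (insert b A). v $ b = 0})"
    using assms by (intro dim_le_Suc_kernel subspace_inter linearI subspace_coord_span) auto
  also have "{v \<in> V \<inter> coord_span (insert b A). v $ b = 0} \<subseteq> V \<inter> coord_span A"
    by (auto simp: coord_span_iff)
  then have "dim {v \<in> V \<inter> coord_span (insert b A). v $ b = 0} \<le> dim (V \<inter> coord_span A)"
    by (rule dim_subset)
  finally show ?thesis by simp
qed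

lemma coord_span_mono: "A \<subseteq> A' \<Longrightarrow> coord_span A \<subseteq> coord_span A'"
  unfolding coord_span_def by (intro span_mono image_mono)

text \<open>When the elements of \<open>A\<close> are added in increasing order, each raises
  \<open>g\<close> by 0 or 1, so the telescoping sum of the increments counts the jumps.\<close>

lemma card_jumps:
  fixes g :: "'a::linorder set \<Rightarrow> nat"
  assumes "finite A" and mono: "\<And>b A. g A \<le> g (insert b A)" and step: "\<And>b A. g (insert b A) \<le> Suc (g A)"
  shows "card {j\<in>A. g (A \<inter> {..<j}) < g (A \<inter> {..j})} + g {} = g A"
proof -
  define J where "J A = {j\<in>A. g (A \<inter> {..<j}) < g (A \<inter> {..j})}" for A
  have "card (J A) + g {} = g A"
    using assms(1)
  proof (induction A rule: finite_linorder_max_induct)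
    case empty
    show ?case by (simp add: J_def)
  next
    case (insert b A)
    have b: "b \<notin> A" using insert.hyps(2) by (meson less_irrefl)
    have eq: "insert b A \<inter> {..<j} = A \<inter> {..<j}" "insert b A \<inter> {..j} = A \<inter> {..j}" if "j \<in> A" for j
    proof -
      have "j < b" using that insert.hyps by blast
      then have "b \<notin> {..<j}" "b \<notin> {..j}" by auto
      then show "insert b A \<inter> {..<j} = A \<inter> {..<j}" "insert b A \<inter> {..j} = A \<inter> {..j}" by simp_all
    qed
    have eqb: "insert b A \<inter> {..<b} = A" "insert b A \<inter> {..b} = insert b A"
      using insert.hyps by auto
    define Q where "Q j \<longleftrightarrow> g (insert b A \<inter> {..<j}) < g (insert b A \<inter> {..j})" for j
    have "{j\<in>A. Q j} = J A" unfolding J_def Q_def by (intro Collect_cong conj_cong refl) (simp only: eq)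
    moreover have "Q b \<longleftrightarrow> g A < g (insert b A)" unfolding Q_def eqb ..
    moreover have "J (insert b A) = {j\<in>A. Q j} \<union> (if Q b then {b} else {})"
      unfolding J_def Q_def by auto
    ultimately have "J (insert b A) = J A \<union> (if g A < g (insert b A) then {b} else {})" by simp
    moreover have "finite (J A)" "b \<notin> J A" using b insert.hyps(1) by (auto simp: J_def)
    ultimately have "card (J (insert b A)) = card (J A) + (if g A < g (insert b A) then 1 else 0)"
      by simp
    then show ?case using insert.IH mono[of A b] step[of b A] by auto
  qed
  then show ?thesis by (simp add: J_def)
qed

text \<open>\<open>I_set\<close> sees only jumps at the last coordinates; a trivial intersection
  with the span of the first ones ensures that no dimension is missed.\<close>

lemma card_I_set:
  fixes V :: "(real ^ ('m::finite + 'n::{finite,linorder})) set"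
  assumes V: "subspace V" "V \<inter> coord_span (range Inl) = {0}"
  shows "card (I_set V \<inter> {..i}) = dim (V \<inter> coord_span (range Inl \<union> Inr ` {..i}))" (is ?th1)
    and "card (I_set V) = dim V" (is ?th2)
proof -
  define g where "g A = dim (V \<inter> coord_span (range Inl \<union> Inr ` A))" for A :: "'n set"
  have mono: "g A \<le> g (insert b A)" for b A
    unfolding g_def by (intro dim_subset Int_mono coord_span_mono) auto
  have step: "g (insert b A) \<le> Suc (g A)" for b A
    unfolding g_def using dim_coord_span_insert[OF V(1), of "Inr b" "range Inl \<union> Inr ` A"] by simp
  have g0: "g {} = 0" using V(2) by (simp add: g_def)
  note card = card_jumps[of _ g, OF finite mono step, unfolded g0 add_0_right]
  have I: "I_set V = {j. g {..<j} < g {..j}}" by (simp add: I_set_def g_def)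
  have "I_set V \<inter> {..i} = {j\<in>{..i}. g ({..i} \<inter> {..<j}) < g ({..i} \<inter> {..j})}"
  proof -
    have "{..i} \<inter> {..<j} = {..<j}" "{..i} \<inter> {..j} = {..j}" if "j \<le> i" for j using that by auto
    then show ?thesis unfolding I by auto
  qed
  with card[of "{..i}"] show ?th1 by (simp add: g_def)
  have "I_set V = {j\<in>UNIV. g (UNIV \<inter> {..<j}) < g (UNIV \<inter> {..j})}" unfolding I by simp
  with card[of UNIV] have "card (I_set V) = g UNIV" by simp
  also have "\<dots> = dim V" by (simp add: g_def UNIV_sum[symmetric] coord_span_iff Int_def)
  finally show ?th2 .
qed

text \<open>The jumps are those of the codimension in \<open>V\<close> of the subspace whose
  coordinates in \<open>A\<close> vanish, as \<open>A\<close> grows.\<close>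

lemma card_J_set:
  fixes V :: "(real ^ 'm::{finite,linorder}) set"
  assumes V: "subspace V"
  shows "card (J_set V \<inter> {..i}) = dim V - dim (V \<inter> coord_span {i<..})" (is ?th1)
    and "card (J_set V) = dim V" (is ?th2)
proof -
  define f where "f A = dim (V \<inter> coord_span (- A))" for A :: "'m set"
  have f: "f A \<le> dim V" for A unfolding f_def by (intro dim_subset) auto
  define g where "g A = dim V - f A" for A
  have anti: "f (insert b A) \<le> f A" for b A
    unfolding f_def by (intro dim_subset Int_mono coord_span_mono) auto
  have step: "f A \<le> Suc (f (insert b A))" for b A
  proof (cases "b \<in> A")
    case False
    then have "insert b (- insert b A) = - A" by auto
    then show ?thesis
      unfolding f_def using dim_coord_span_insert[OF V, of b "- insert b A"] by simp
  qed (simp add: insert_absorb)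
  have g: "g A \<le> g (insert b A)" "g (insert b A) \<le> Suc (g A)" for b A
    using anti[of b A] step[of A b] f[of A] by (auto simp: g_def)
  have g0: "g {} = 0" by (simp add: g_def f_def coord_span_iff Int_def)
  note card = card_jumps[of _ g, OF finite g, unfolded g0 add_0_right]
  have J: "J_set V = {j. g {..<j} < g {..j}}"
  proof -
    have "- {..<j} = {j..}" "- {..j} = {j<..}" for j :: 'm by auto
    then have "J_set V = {j. f {..j} < f {..<j}}" by (simp add: J_set_def f_def)
    also have "\<dots> = {j. g {..<j} < g {..j}}"
      using f by (auto simp: g_def) (metis diff_less_mono2 order_less_le_trans)
    finally show ?thesis .
  qed
  have "J_set V \<inter> {..i} = {j\<in>{..i}. g ({..i} \<inter> {..<j}) < g ({..i} \<inter> {..j})}"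
  proof -
    have "{..i} \<inter> {..<j} = {..<j}" "{..i} \<inter> {..j} = {..j}" if "j \<le> i" for j using that by auto
    then show ?thesis unfolding J by auto
  qed
  moreover have "- {..i} = {i<..}" by auto
  ultimately show ?th1 using card[of "{..i}"] by (simp add: g_def f_def)
  have "J_set V = {j\<in>UNIV. g (UNIV \<inter> {..<j}) < g (UNIV \<inter> {..j})}" unfolding J by simp
  with card[of UNIV] have "card (J_set V) = g UNIV" by simp
  also have "\<dots> = dim V"
  proof -
    have "V \<inter> coord_span {} \<subseteq> {0}" by (auto simp: coord_span_iff vec_eq_iff)
    then have "f UNIV = 0" by (simp add: f_def)
    then show ?thesis by (simp add: g_def)
  qed
  finally show ?th2 .
qed

text \<open>Abel summation: a decreasing nonnegative weight is a nonnegative combination of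
  indicators of initial segments. The induction splits off the constant \<open>w b\<close>, the
  least weight, and continues with \<open>w - w b\<close>.\<close>

lemma sum_antimono_le:
  fixes w :: "'a::linorder \<Rightarrow> real"
  assumes "finite A" "J \<subseteq> A" "J' \<subseteq> A"
    and "\<And>i j. i \<in> A \<Longrightarrow> j \<in> A \<Longrightarrow> i \<le> j \<Longrightarrow> w j \<le> w i" "\<And>i. i \<in> A \<Longrightarrow> 0 \<le> w i"
    and "\<And>j. j \<in> A \<Longrightarrow> card (J \<inter> {..j}) \<le> card (J' \<inter> {..j})"
  shows "sum w J \<le> sum w J'"
  using assms
proof (induction A arbitrary: J J' w rule: finite_linorder_max_induct)
  case empty
  then show ?case by simp
next
  case (insert b A)
  define v where "v i = w i - w b" for i
  have fin: "finite J" "finite J'" using insert.prems insert.hyps by (auto intro: finite_subset)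
  have b: "b \<notin> A" using insert.hyps by auto
  have "sum v (J - {b}) \<le> sum v (J' - {b})"
  proof (rule insert.IH)
    fix i assume i: "i \<in> A"
    then have "b \<notin> {..i}" using insert.hyps by auto
    then have "(J - {b}) \<inter> {..i} = J \<inter> {..i}" "(J' - {b}) \<inter> {..i} = J' \<inter> {..i}" by auto
    then show "card ((J - {b}) \<inter> {..i}) \<le> card ((J' - {b}) \<inter> {..i})"
      using insert.prems(5)[of i] i by simp
    show "0 \<le> v i" using insert.prems(3)[of i b] insert.hyps i by (auto simp: v_def less_imp_le)
  qed (use insert.prems insert.hyps in \<open>auto simp: v_def\<close>)
  moreover have "sum v (K - {b}) = sum v K" if "finite K" for K
    using that by (cases "b \<in> K") (auto simp: sum.remove[of K b] v_def)
  ultimately have le: "sum v J \<le> sum v J'" using fin by simp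
  have "sum w K = sum v K + w b * card K" for K
    by (simp add: v_def sum_subtractf)
  moreover have "w b * card J \<le> w b * card J'"
  proof (intro mult_left_mono)
    have "insert b A \<subseteq> {..b}" using insert.hyps by (auto intro: less_imp_le)
    then have "J \<inter> {..b} = J" "J' \<inter> {..b} = J'" using insert.prems(1,2) by auto
    then show "real (card J) \<le> real (card J')" using insert.prems(5)[of b] by simp
    show "0 \<le> w b" using insert.prems by simp
  qed
  ultimately show ?case using le by (smt (verit))
qed

section \<open>Generic ranks and pencils\<close>

text \<open>Let \<open>x0\<close> in \<open>M\<close> have the smallest kernel, of dimension
  \<open>q\<close>. Injectivity of \<open>A x0\<close> on a complement \<open>V1\<close> of that
  kernel in \<open>V\<close> is the nonvanishing of \<open>det (D x0)\<close>, and this persists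
  almost everywhere. A kernel meeting \<open>V1\<close> only in 0 has dimension at most
  \<open>dim V - dim V1 = q\<close>.\<close>

lemma generic_kernel_dim:
  fixes A :: "real ^ 'n::finite ^ 'm::finite \<Rightarrow> real ^ 'd::finite ^ 'c::finite" and V :: "(real ^ 'd) set"
  assumes M: "analytic_submanifold p M" "connected M" "M \<noteq> {}"
    and A: "\<And>i j. poly_like (\<lambda>x. A x $ i $ j)" and V: "subspace V"
  shows "\<exists>q. (\<forall>x\<in>M. q \<le> dim {v\<in>V. A x *v v = 0}) \<and>
             (AE x in volume_measure p M. dim {v\<in>V. A x *v v = 0} \<le> q)"
proof -
  define N where "N x = {v\<in>V. A x *v v = 0}" for x
  have subN: "subspace (N x)" for x
    unfolding N_def using V by (intro subspace_kernel_on) auto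
  obtain x0 where x0: "x0 \<in> M" "\<And>x. x \<in> M \<Longrightarrow> dim (N x0) \<le> dim (N x)"
    using ex_has_least_nat[of "\<lambda>x. x \<in> M" _ "\<lambda>x. dim (N x)"] M(3) by blast
  have NV: "N x0 \<subseteq> V" by (auto simp: N_def)
  obtain V1 where V1: "subspace V1" "V1 \<subseteq> V" "V1 \<inter> N x0 = {0}" "dim V1 + dim (N x0) = dim V"
    using complement_subspace[OF V subN NV] by metis
  obtain g where g: "range g \<subseteq> V1" "linear g" "\<And>v. v \<in> V1 \<Longrightarrow> g v = v"
    using linear_exists_left_inverse_on[OF linear_id V1(1)] by auto
  define P where "P = matrix g"
  have P: "P *v v = g v" for v unfolding P_def using g(2) by (simp add: matrix_works)
  \<comment> \<open>As \<open>P\<close> is a projection onto \<open>V1\<close>, \<open>D x\<close> is singular iff \<open>A x\<close> has a kernel on \<open>V1\<close>.\<close>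
  define D where "D x = transpose (A x ** P) ** (A x ** P) + transpose (mat 1 - P) ** (mat 1 - P)" for x
  have inner_transpose: "v \<bullet> (transpose B *v w) = (B *v v) \<bullet> w" for v w and B :: "real ^ 'd ^ 'b::finite"
    by (metis dot_lmul_matrix inner_commute transpose_matrix_vector)
  have D_inner: "v \<bullet> (D x *v v) = (norm (A x *v g v))\<^sup>2 + (norm (v - g v))\<^sup>2" for x v
  proof -
    have "v \<bullet> (D x *v v) = ((A x ** P) *v v) \<bullet> ((A x ** P) *v v) + ((mat 1 - P) *v v) \<bullet> ((mat 1 - P) *v v)"
      unfolding D_def matrix_vector_mult_add_rdistrib inner_add_right
      by (simp only: matrix_vector_mul_assoc[of "transpose _", symmetric] inner_transpose)
    also have "(mat 1 - P) *v v = v - g v" by (simp add: matrix_vector_mult_diff_rdistrib P)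
    also have "(A x ** P) *v v = A x *v g v" by (simp add: matrix_vector_mul_assoc[symmetric] P)
    finally show ?thesis by (simp add: power2_norm_eq_inner)
  qed
  have "det (D x0) \<noteq> 0"
    unfolding det_nz_iff_ker
  proof (intro allI impI)
    fix v assume "D x0 *v v = 0"
    then have "(norm (A x0 *v g v))\<^sup>2 + (norm (v - g v))\<^sup>2 = 0"
      unfolding D_inner[symmetric] by (simp only: inner_zero_right)
    then have "norm (A x0 *v g v) = 0 \<and> norm (v - g v) = 0" by (simp only: sum_power2_eq_zero_iff)
    then have 1: "A x0 *v g v = 0" and 2: "v = g v" by (metis norm_eq_zero, metis norm_eq_zero right_minus_eq)
    have "g v \<in> V1" using g(1) by blast
    then have "g v \<in> V1 \<inter> N x0" unfolding N_def using 1 V1(2) by blast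
    then have "g v = 0" using V1(3) by blast
    with 2 show "v = 0" by (rule trans)
  qed
  moreover have "poly_like (\<lambda>x. det (D x))"
  proof (rule poly_like_det)
    fix i j
    have AP: "poly_like (\<lambda>x. (A x ** P) $ k $ i)" for k i
      unfolding matrix_matrix_mult_def by (simp add: poly_like_sum poly_like_mult poly_like_const A)
    have "poly_like (\<lambda>x. (\<Sum>k\<in>UNIV. (A x ** P) $ k $ i * (A x ** P) $ k $ j) + (transpose (mat 1 - P) ** (mat 1 - P)) $ i $ j)"
      by (intro poly_like_add poly_like_sum poly_like_mult poly_like_const AP)
    moreover have "(transpose B ** B) $ i $ j = (\<Sum>k\<in>UNIV. B $ k $ i * B $ k $ j)" for B :: "real ^ 'd ^ 'c"
      by (simp add: matrix_matrix_mult_def transpose_def)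
    ultimately show "poly_like (\<lambda>x. D x $ i $ j)" by (simp only: D_def vector_add_component)
  qed
  ultimately have "AE x in volume_measure p M. det (D x) \<noteq> 0"
    by (intro AE_volume_measure_nonzero[OF M(1,2) _ _ x0(1)]) (auto simp: poly_like_def)
  then have "AE x in volume_measure p M. dim (N x) \<le> dim (N x0)"
  proof eventually_elim
    case (elim x)
    have "V1 \<inter> N x \<subseteq> {0}"
    proof
      fix v assume v: "v \<in> V1 \<inter> N x"
      have inner: "w \<bullet> (D x *v v) = 0" for w
      proof -
        have "(A x ** P) *v v = 0" "(mat 1 - P) *v v = 0"
          using v by (auto simp: matrix_vector_mul_assoc[symmetric] P g(3) N_def matrix_vector_mult_diff_rdistrib)
        then show ?thesis
          unfolding D_def matrix_vector_mult_add_rdistrib matrix_vector_mul_assoc[symmetric] by simp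
      qed
      then have "D x *v v = 0" using inner_eq_zero_iff by blast
      then show "v \<in> {0}" using elim by (simp add: det_nz_iff_ker)
    qed
    then have "dim (V1 \<inter> N x) = 0" by (simp only: dim_eq_0)
    moreover have "dim {v + w |v w. v \<in> V1 \<and> w \<in> N x} + dim (V1 \<inter> N x) = dim V1 + dim (N x)"
      by (rule dim_sums_Int[OF V1(1) subN])
    moreover have "{v + w |v w. v \<in> V1 \<and> w \<in> N x} \<subseteq> V"
      using V1(2) V by (auto simp: N_def intro!: subspace_add)
    then have "dim {v + w |v w. v \<in> V1 \<and> w \<in> N x} \<le> dim V" by (rule dim_subset)
    ultimately show ?case using V1(4) by linarith
  qed
  then show ?thesis using x0(2) unfolding N_def by blast
qed

section \<open>Jumps of the image and the kernel as functions of \<open>x\<close>\<close>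

lemma u_mat_component:
  "(u_mat x *v v) $ Inl i = (x_tilde x *v v) $ i" "(u_mat x *v v) $ Inr j = v $ Inr j"
  by (simp_all add: matrix_vector_mult_def x_tilde_def sum_UNIV_sum u_mat_def if_distrib[of "\<lambda>x. x * _"] cong: if_cong)

lemma x_tilde_component: "(x_tilde x *v v) $ i = v $ Inl i + (\<Sum>j\<in>UNIV. x $ i $ j * v $ Inr j)"
  by (simp add: matrix_vector_mult_def x_tilde_def sum_UNIV_sum u_mat_def if_distrib[of "\<lambda>x. x * _"] cong: if_cong)

lemma poly_like_x_tilde: "poly_like (\<lambda>x. x_tilde x $ i $ l)"
  by (cases l) (simp_all add: x_tilde_def u_mat_def poly_like_const poly_like_component)

lemma x_tilde_eq_0_iff:
  assumes "\<And>j. v $ Inr j = 0"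
  shows "x_tilde x *v v = 0 \<longleftrightarrow> v = 0"
proof
  assume "x_tilde x *v v = 0"
  then have "v $ Inl i = 0" for i using x_tilde_component[of x v i] assms by simp
  then show "v = 0" using assms by (simp add: vec_eq_iff split_sum_all)
qed simp

text \<open>\<open>J_set\<close> involves intersections with the image of \<open>W\<close>, which
  moves with \<open>x\<close>. Killing the rows above \<open>j\<close> turns them into kernels on
  the fixed space \<open>W\<close>, to which \<open>generic_kernel_dim\<close> applies.\<close>

definition truncated_x_tilde ::
    "'m::{finite,linorder} \<Rightarrow> real ^ 'n::finite ^ 'm::{finite,linorder} \<Rightarrow> real ^ ('m + 'n) ^ 'm::{finite,linorder}" where
  "truncated_x_tilde j x = (\<chi> i. if i \<le> j then x_tilde x $ i else 0)"

lemma truncated_x_tilde_eq_0: "truncated_x_tilde j x *v w = 0 \<longleftrightarrow> (\<forall>i\<le>j. (x_tilde x *v w) $ i = 0)"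
proof -
  have "(truncated_x_tilde j x *v w) $ i = (if i \<le> j then (x_tilde x *v w) $ i else 0)" for i
    by (simp add: truncated_x_tilde_def matrix_vector_mult_def)
  then show ?thesis by (auto simp: vec_eq_iff)
qed

lemma poly_like_truncated_x_tilde: "poly_like (\<lambda>x. truncated_x_tilde j x $ i $ l)"
  by (cases "i \<le> j") (simp_all add: truncated_x_tilde_def poly_like_x_tilde poly_like_const)

text \<open>The rows of the Pluecker coordinate of \<open>u(x) W\<close> that dominates under the flow.\<close>

definition jump_coordinates ::
    "(real ^ ('m::{finite,linorder} + 'n::{finite,linorder})) set
      \<Rightarrow> real ^ 'n::{finite,linorder} ^ 'm::{finite,linorder} \<Rightarrow> ('m + 'n) set" where
  "jump_coordinates W x = Inl ` J_set ((*v) (x_tilde x) ` W) \<union> Inr ` I_set ({v. x_tilde x *v v = 0} \<inter> W)"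

context
  fixes W :: "(real ^ ('m::{finite,linorder} + 'n::{finite,linorder})) set"
  assumes W: "subspace W"
begin

lemma subspace_kernel: "subspace ({v. x_tilde x *v v = 0} \<inter> W)"
  using subspace_kernel_on[OF matrix_vector_mul_linear W, of "x_tilde x"] by (simp add: Int_def conj_commute)

lemma kernel_Int_Inl: "{v. x_tilde x *v v = 0} \<inter> W \<inter> coord_span (range Inl) = {0}"
proof -
  have "v = 0" if "x_tilde x *v v = 0" "v \<in> coord_span (range Inl)" for v :: "real ^ ('m + 'n)"
  proof -
    have "v $ Inr j = 0" for j using that(2) by (auto simp: coord_span_iff)
    then show ?thesis using that(1) x_tilde_eq_0_iff by blast
  qed
  then show ?thesis using subspace_0[OF W] by (auto simp: coord_span_iff)
qed

lemma rank_nullity: "dim ((*v) (x_tilde x) ` W) + dim ({v. x_tilde x *v v = 0} \<inter> W) = dim W"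
  using dim_image_kernel[OF matrix_vector_mul_linear W, of "x_tilde x"] by (simp add: Int_def conj_commute)

text \<open>Rank-nullity for \<open>x_tilde x\<close> on \<open>W\<close> and on \<open>?K\<close>:
  both have the same kernel, whose dimension cancels in the difference.\<close>

lemma card_J_set_image:
  "card (J_set ((*v) (x_tilde x) ` W) \<inter> {..j}) = dim W - dim {w\<in>W. truncated_x_tilde j x *v w = 0}"
proof -
  let ?X = "(*v) (x_tilde x)" and ?K = "{w\<in>W. truncated_x_tilde j x *v w = 0}"
  have subK: "subspace ?K" by (rule subspace_kernel_on[OF matrix_vector_mul_linear W])
  have "?X ` W \<inter> coord_span {j<..} = ?X ` ?K"
    by (auto simp: truncated_x_tilde_eq_0 coord_span_iff not_less)
  moreover have "dim (?X ` ?K) + dim {v\<in>?K. ?X v = 0} = dim ?K"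
    by (rule dim_image_kernel[OF matrix_vector_mul_linear subK])
  moreover have "{v\<in>?K. ?X v = 0} = {v. ?X v = 0} \<inter> W"
    by (auto simp: truncated_x_tilde_eq_0)
  moreover have "card (J_set (?X ` W) \<inter> {..j}) = dim (?X ` W) - dim (?X ` W \<inter> coord_span {j<..})"
    by (intro card_J_set linear_subspace_image matrix_vector_mul_linear W)
  ultimately show ?thesis using rank_nullity[of x] by simp
qed

text \<open>Smaller truncated kernels mean at least as many jumps in each initial segment, where the
  weights are largest.\<close>

lemma phi_mono:
  assumes \<omega>: "weight_vector \<omega>"
    and le: "\<And>j. dim {w\<in>W. truncated_x_tilde j y *v w = 0} \<le> dim {w\<in>W. truncated_x_tilde j x *v w = 0}"
  shows "phi \<omega> ((*v) (x_tilde x) ` W) \<le> phi \<omega> ((*v) (x_tilde y) ` W)"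
  unfolding phi_def
  by (rule sum_antimono_le[of UNIV])
    (use \<omega> le in \<open>auto simp: weight_vector_def card_J_set_image less_imp_le intro!: diff_le_mono2\<close>)

lemma psi_mono:
  assumes \<omega>: "weight_vector \<omega>"
    and le: "\<And>i. dim {v\<in>W \<inter> coord_span (range Inl \<union> Inr ` {..i}). x_tilde x *v v = 0}
        \<le> dim {v\<in>W \<inter> coord_span (range Inl \<union> Inr ` {..i}). x_tilde y *v v = 0}"
  shows "psi \<omega> ({v. x_tilde x *v v = 0} \<inter> W) \<le> psi \<omega> ({v. x_tilde y *v v = 0} \<inter> W)"
  unfolding psi_def
proof (rule sum_antimono_le[of UNIV])
  fix i :: 'n
  have eq: "{v. x_tilde x *v v = 0} \<inter> W \<inter> coord_span (range Inl \<union> Inr ` {..i}) =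
      {v\<in>W \<inter> coord_span (range Inl \<union> Inr ` {..i}). x_tilde x *v v = 0}" for x
    by blast
  show "card (I_set ({v. x_tilde x *v v = 0} \<inter> W) \<inter> {..i}) \<le> card (I_set ({v. x_tilde y *v v = 0} \<inter> W) \<inter> {..i})"
    unfolding card_I_set(1)[OF subspace_kernel kernel_Int_Inl] eq by (rule le)
qed (use \<omega> in \<open>auto simp: weight_vector_def less_imp_le\<close>)

lemma card_jump_coordinates: "card (jump_coordinates W x) = dim W"
proof -
  have "card (jump_coordinates W x) = card (J_set ((*v) (x_tilde x) ` W)) + card (I_set ({v. x_tilde x *v v = 0} \<inter> W))"
    unfolding jump_coordinates_def by (subst card_Un_disjoint) (auto simp: card_image)
  also have "\<dots> = dim ((*v) (x_tilde x) ` W) + dim ({v. x_tilde x *v v = 0} \<inter> W)"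
    by (simp only: card_J_set(2)[OF linear_subspace_image[OF matrix_vector_mul_linear W]]
        card_I_set(2)[OF subspace_kernel kernel_Int_Inl])
  finally show ?thesis using rank_nullity by simp
qed

lemma sum_jump_coordinates:
  "(\<Sum>i\<in>jump_coordinates W x. flow_exponent \<omega> i) =
     phi \<omega> ((*v) (x_tilde x) ` W) - psi \<omega> ({v. x_tilde x *v v = 0} \<inter> W)"
  unfolding jump_coordinates_def phi_def psi_def
  by (subst sum.union_disjoint) (auto simp: sum.reindex flow_exponent_def sum_negf)

text \<open>If the image of \<open>w\<close> is nonzero, its first nonzero coordinate is a jump in
  \<open>J_set\<close>. Otherwise \<open>w\<close> lies in the kernel, and if it is nonzero its last
  nonzero coordinate is a jump in \<open>I_set\<close>. Either way a row of the selection detects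
  \<open>w\<close>.\<close>

lemma jump_coordinates_transversal:
  assumes w: "w \<in> W" and 0: "\<And>i. i \<in> jump_coordinates W x \<Longrightarrow> (u_mat x *v w) $ i = 0"
  shows "w = 0"
proof -
  let ?X = "(*v) (x_tilde x)"
  have ker: "x_tilde x *v w = 0"
  proof (rule ccontr)
    assume "x_tilde x *v w \<noteq> 0"
    then have ne: "{i. (x_tilde x *v w) $ i \<noteq> 0} \<noteq> {}" by (auto simp: vec_eq_iff)
    define j where "j = Min {i. (x_tilde x *v w) $ i \<noteq> 0}"
    have j: "(x_tilde x *v w) $ j \<noteq> 0" "\<And>i. i < j \<Longrightarrow> (x_tilde x *v w) $ i = 0"
      using Min_in[OF _ ne] Min_le[OF finite, of _ "{i. (x_tilde x *v w) $ i \<noteq> 0}"]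
      by (auto simp: j_def[symmetric]) (metis leD)
    have sub: "subspace (?X ` W \<inter> coord_span T)" for T
      by (intro subspace_inter linear_subspace_image matrix_vector_mul_linear W subspace_coord_span)
    have "?X w \<in> ?X ` W \<inter> coord_span {j..}" using w j(2) by (auto simp: coord_span_iff not_le)
    moreover have "?X w \<notin> ?X ` W \<inter> coord_span {j<..}" using j(1) by (auto simp: coord_span_iff)
    moreover have "?X ` W \<inter> coord_span {j<..} \<subseteq> ?X ` W \<inter> coord_span {j..}"
      by (intro Int_mono coord_span_mono) auto
    ultimately have "?X ` W \<inter> coord_span {j<..} \<subset> ?X ` W \<inter> coord_span {j..}" by blast
    then have "dim (?X ` W \<inter> coord_span {j<..}) < dim (?X ` W \<inter> coord_span {j..})"
      using sub by (intro dim_psubset) (simp add: span_eq_iff[THEN iffD2])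
    then have "Inl j \<in> jump_coordinates W x" by (simp add: jump_coordinates_def J_set_def)
    then show False using 0[of "Inl j"] j(1) by (simp add: u_mat_component)
  qed
  have "w $ Inr i = 0" for i
  proof (rule ccontr)
    assume "w $ Inr i \<noteq> 0"
    then have ne: "{i. w $ Inr i \<noteq> 0} \<noteq> {}" by blast
    define j where "j = Max {i. w $ Inr i \<noteq> 0}"
    have j: "w $ Inr j \<noteq> 0" "\<And>i. j < i \<Longrightarrow> w $ Inr i = 0"
      using Max_in[OF _ ne] Max_ge[OF finite, of _ "{i. w $ Inr i \<noteq> 0}"]
      by (auto simp: j_def[symmetric]) (metis leD)
    let ?N = "{v. x_tilde x *v v = 0} \<inter> W"
    let ?C = "\<lambda>T. coord_span (range Inl \<union> Inr ` T) :: (real ^ ('m + 'n)) set"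
    have sub: "subspace (?N \<inter> ?C T)" for T by (intro subspace_inter subspace_kernel subspace_coord_span)
    have "w $ l = 0" if "l \<notin> range Inl \<union> Inr ` {..j}" for l
    proof (cases l)
      case (Inr i)
      then have "j < i" using that by (auto simp: not_le[symmetric])
      then show ?thesis using j(2) Inr by simp
    qed (use that in auto)
    then have "w \<in> ?N \<inter> ?C {..j}" using w ker by (simp add: coord_span_iff)
    moreover have "w \<notin> ?N \<inter> ?C {..<j}" using j(1) by (auto simp: coord_span_iff)
    moreover have "?N \<inter> ?C {..<j} \<subseteq> ?N \<inter> ?C {..j}" by (intro Int_mono coord_span_mono) auto
    ultimately have "?N \<inter> ?C {..<j} \<subset> ?N \<inter> ?C {..j}" by blast
    then have "dim (?N \<inter> ?C {..<j}) < dim (?N \<inter> ?C {..j})"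
      using sub by (intro dim_psubset) (simp add: span_eq_iff[THEN iffD2])
    then have "Inr j \<in> jump_coordinates W x" by (simp add: jump_coordinates_def I_set_def)
    then show False using 0[of "Inr j"] j(1) by (simp add: u_mat_component)
  qed
  then show "w = 0" using ker by (simp add: x_tilde_eq_0_iff)
qed

end

section \<open>Connectedness almost everywhere\<close>

text \<open>Obtained at an \<open>x\<close> of maximal rank on \<open>W\<close>; it is the source of
  properness of the pencils.\<close>

lemma exists_full_rank:
  fixes W :: "(real ^ ('m::{finite,linorder} + 'n::{finite,linorder})) set"
  assumes W: "subspace W"
  shows "\<exists>x. {v. x_tilde x *v v = 0} \<inter> W = {0} \<or> (*v) (x_tilde x) ` W = UNIV"
proof -
  define r where "r x = dim ((*v) (x_tilde x) ` W)" for x :: "real ^ 'n::{finite,linorder} ^ 'm::{finite,linorder}"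
  obtain x where max: "\<And>y. r y \<le> r x"
  proof -
    have "r y < Suc CARD('m)" for y
      using dim_subset_UNIV[of "(*v) (x_tilde y) ` W"] by (simp add: r_def)
    then have "\<forall>y. True \<longrightarrow> r y < Suc CARD('m)" by blast
    from ex_has_greatest_nat[OF TrueI this] show thesis using that by auto
  qed
  show ?thesis
  proof (rule ccontr)
    assume "\<not> ?thesis"
    then have N: "{v. x_tilde x *v v = 0} \<inter> W \<noteq> {0}" and "(*v) (x_tilde x) ` W \<noteq> UNIV" by auto
    then obtain w c where w: "w \<in> W" "x_tilde x *v w = 0" "w \<noteq> 0" and c: "c \<notin> (*v) (x_tilde x) ` W"
      using subspace_0[OF W] by auto
    \<comment> \<open>A functional that depends only on the last coordinates, so that it can be
      realized by changing \<open>x\<close>. It is nonzero at \<open>w\<close>, because a kernel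
      vector is zero once these coordinates vanish.\<close>
    define \<eta> where "\<eta> v = (\<Sum>j\<in>UNIV. w $ Inr j * v $ Inr j)" for v :: "real ^ ('m + 'n)"
    have \<eta>: "linear \<eta>"
      unfolding \<eta>_def by (intro linear_compose_sum ballI linearI) (auto simp: algebra_simps)
    have "\<eta> w \<noteq> 0"
    proof
      assume "\<eta> w = 0"
      then have "\<forall>j. w $ Inr j = 0" by (simp add: \<eta>_def sum_nonneg_eq_0_iff)
      then show False using w x_tilde_eq_0_iff by blast
    qed
    \<comment> \<open>A rank-one perturbation that maps \<open>w\<close> to a multiple of \<open>c\<close> raises the rank.\<close>
    define y where "y = (\<chi> i j. x $ i $ j + c $ i * w $ Inr j)"
    have y: "x_tilde y *v v = x_tilde x *v v + \<eta> v *\<^sub>R c" for v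
      by (simp add: vec_eq_iff x_tilde_component y_def \<eta>_def sum.distrib sum_distrib_left algebra_simps)
    have sub: "{v. x_tilde y *v v = 0} \<inter> W \<subseteq> {v\<in>{v. x_tilde x *v v = 0} \<inter> W. \<eta> v = 0}"
    proof
      fix v assume v: "v \<in> {v. x_tilde y *v v = 0} \<inter> W"
      then have eq: "x_tilde x *v v + \<eta> v *\<^sub>R c = 0" by (simp add: y)
      have "\<eta> v = 0"
      proof (rule ccontr)
        assume "\<eta> v \<noteq> 0"
        have "\<eta> v *\<^sub>R c = - (x_tilde x *v v)" using eq by (simp add: eq_neg_iff_add_eq_0 add.commute)
        then have "inverse (\<eta> v) *\<^sub>R (\<eta> v *\<^sub>R c) = inverse (\<eta> v) *\<^sub>R (- (x_tilde x *v v))" by simp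
        then have "c = x_tilde x *v ((- inverse (\<eta> v)) *\<^sub>R v)"
          using \<open>\<eta> v \<noteq> 0\<close>
          by (simp add: linear_neg[OF matrix_vector_mul_linear] linear_scale[OF matrix_vector_mul_linear])
        moreover have "(- inverse (\<eta> v)) *\<^sub>R v \<in> W" using v by (intro subspace_scale[OF W]) blast
        ultimately show False using c by blast
      qed
      then show "v \<in> {v\<in>{v. x_tilde x *v v = 0} \<inter> W. \<eta> v = 0}" using v eq by simp
    qed
    also have "\<dots> \<subset> {v. x_tilde x *v v = 0} \<inter> W"
      using w \<open>\<eta> w \<noteq> 0\<close> by blast
    finally have "dim ({v. x_tilde y *v v = 0} \<inter> W) < dim ({v. x_tilde x *v v = 0} \<inter> W)"
      using subspace_kernel[OF W] by (intro dim_psubset) (simp add: span_eq_iff[THEN iffD2])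
    then have "r x < r y" using rank_nullity[OF W, of x] rank_nullity[OF W, of y] by (simp add: r_def)
    then show False using max[of y] by simp
  qed
qed

text \<open>At an \<open>x\<close> of full rank, either the kernel is trivial, so \<psi> = 0, while
  \<phi> > 0 because \<open>dim W\<close> is at least 1; or the image is everything, so \<phi> = 1,
  while the kernel has dimension \<open>dim W - m\<close> below \<open>n\<close>, so \<psi> misses a
  positive weight.\<close>

lemma psi_less_phi_exists:
  fixes W :: "(real ^ ('m::{finite,linorder} + 'n::{finite,linorder})) set"
  assumes \<omega>: "weight_vector \<omega>" and W: "subspace W" "1 \<le> dim W" "dim W \<le> CARD('m + 'n) - 1"
  shows "\<exists>x. psi \<omega> ({v. x_tilde x *v v = 0} \<inter> W) < phi \<omega> ((*v) (x_tilde x) ` W)"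
proof -
  obtain x where x: "{v. x_tilde x *v v = 0} \<inter> W = {0} \<or> (*v) (x_tilde x) ` W = UNIV"
    using exists_full_rank[OF W(1)] by blast
  let ?N = "{v. x_tilde x *v v = 0} \<inter> W" and ?X = "(*v) (x_tilde x) ` W"
  have pos: "\<And>i. \<omega> $ Inl i > 0" "\<And>j. \<omega> $ Inr j > 0" and sums: "(\<Sum>i\<in>UNIV. \<omega> $ Inl i) = 1" "(\<Sum>j\<in>UNIV. \<omega> $ Inr j) = 1"
    using \<omega> by (auto simp: weight_vector_def)
  have cJ: "card (J_set ?X) = dim ?X"
    by (intro card_J_set linear_subspace_image matrix_vector_mul_linear W)
  have cI: "card (I_set ?N) = dim ?N"
    by (rule card_I_set(2)[OF subspace_kernel kernel_Int_Inl]) (rule W)+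
  from x have "psi \<omega> ?N < phi \<omega> ?X"
  proof
    assume N: "?N = {0}"
    then have "dim ?X = dim W" using rank_nullity[OF W(1), of x] by simp
    then have "card (J_set ?X) \<ge> 1" using cJ W(2) by linarith
    then have "J_set ?X \<noteq> {}" by auto
    then have "phi \<omega> ?X > 0" unfolding phi_def using pos by (intro sum_pos) auto
    moreover have "I_set ?N = {}" using cI N by simp
    then have "psi \<omega> ?N = 0" by (simp add: psi_def)
    ultimately show ?thesis by simp
  next
    assume X: "?X = UNIV"
    then have "card (J_set ?X) = CARD('m)" using cJ by simp
    then have "J_set ?X = UNIV" by (intro card_subset_eq) auto
    then have "phi \<omega> ?X = 1" using sums by (simp add: phi_def)
    moreover have "psi \<omega> ?N < 1"
    proof -
      have "dim ?N = dim W - CARD('m)" using rank_nullity[OF W(1), of x] X by simp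
      moreover have "0 < CARD('n)" by simp
      moreover have "CARD('m + 'n) = CARD('m) + CARD('n)" by simp
      ultimately have "card (I_set ?N) < CARD('n)" using cI W(3) by linarith
      then have "I_set ?N \<noteq> UNIV" by auto
      then obtain j where "j \<notin> I_set ?N" by blast
      then have "sum (\<lambda>j. \<omega> $ Inr j) (I_set ?N) < sum (\<lambda>j. \<omega> $ Inr j) UNIV"
        using pos by (intro sum_strict_mono2[where b = j]) (simp_all add: less_imp_le)
      then show ?thesis using sums by (simp add: psi_def)
    qed
    ultimately show ?thesis by simp
  qed
  then show ?thesis by (intro exI[of _ x])
qed

lemma AE_psi_less_phi:
  fixes \<omega> :: "real ^ ('m::{finite,linorder} + 'n::{finite,linorder})"
    and M :: "(real ^ 'n::{finite,linorder} ^ 'm::{finite,linorder}) set"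
  assumes \<omega>: "weight_vector \<omega>" and M: "analytic_submanifold p M" "connected M"
    and W: "subspace W" "1 \<le> dim W" "dim W \<le> CARD('m + 'n) - 1"
    and pencil: "\<And>a b. b \<le> a \<Longrightarrow> pencil \<omega> W a b \<noteq> UNIV \<Longrightarrow> \<not> M \<subseteq> pencil \<omega> W a b"
  shows "AE x in volume_measure p M.
    psi \<omega> ({v. x_tilde x *v v = 0} \<inter> W) < phi \<omega> ((*v) (x_tilde x) ` W)"
proof (rule ccontr)
  let ?\<psi> = "\<lambda>x. psi \<omega> ({v. x_tilde x *v v = 0} \<inter> W)" and ?\<phi> = "\<lambda>x. phi \<omega> ((*v) (x_tilde x) ` W)"
  assume contr: "\<not> (AE x in volume_measure p M. ?\<psi> x < ?\<phi> x)"
  have proper: "pencil \<omega> W a b \<noteq> UNIV" if "b \<le> a" for a b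
  proof -
    from psi_less_phi_exists[OF \<omega> W] obtain x where "?\<psi> x < ?\<phi> x" ..
    then have "x \<notin> pencil \<omega> W a b" using that by (auto simp: pencil_def)
    then show ?thesis by blast
  qed
  \<comment> \<open>The empty set would lie in the proper pencil with bounds 0 and 0.\<close>
  have "M \<noteq> {}" using pencil[of 0 0] proper[of 0 0] by auto
  note generic = generic_kernel_dim[OF M this]
  define V where "V i = W \<inter> coord_span (range Inl \<union> Inr ` {..i})" for i
  have V: "subspace (V i)" for i unfolding V_def by (intro subspace_inter W subspace_coord_span)
  have "\<forall>j. \<exists>q. (\<forall>x\<in>M. q \<le> dim {w\<in>W. truncated_x_tilde j x *v w = 0}) \<and>
      (AE x in volume_measure p M. dim {w\<in>W. truncated_x_tilde j x *v w = 0} \<le> q)"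
    by (intro allI generic poly_like_truncated_x_tilde W(1))
  from choice[OF this] obtain q where
    q: "\<And>j x. x \<in> M \<Longrightarrow> q j \<le> dim {w\<in>W. truncated_x_tilde j x *v w = 0}"
      "\<And>j. AE x in volume_measure p M. dim {w\<in>W. truncated_x_tilde j x *v w = 0} \<le> q j"
    by auto
  have "\<forall>i. \<exists>q. (\<forall>x\<in>M. q \<le> dim {v\<in>V i. x_tilde x *v v = 0}) \<and>
      (AE x in volume_measure p M. dim {v\<in>V i. x_tilde x *v v = 0} \<le> q)"
    by (intro allI generic poly_like_x_tilde V)
  from choice[OF this] obtain q' where
    q': "\<And>i x. x \<in> M \<Longrightarrow> q' i \<le> dim {v\<in>V i. x_tilde x *v v = 0}"
      "\<And>i. AE x in volume_measure p M. dim {v\<in>V i. x_tilde x *v v = 0} \<le> q' i"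
    by auto
  have "AE x in volume_measure p M. \<forall>j. dim {w\<in>W. truncated_x_tilde j x *v w = 0} \<le> q j"
    using q(2) by (simp add: AE_all_countable)
  moreover have "AE x in volume_measure p M. \<forall>i. dim {v\<in>V i. x_tilde x *v v = 0} \<le> q' i"
    using q'(2) by (simp add: AE_all_countable)
  ultimately have gen: "AE x in volume_measure p M.
      (\<forall>j. dim {w\<in>W. truncated_x_tilde j x *v w = 0} \<le> q j) \<and> (\<forall>i. dim {v\<in>V i. x_tilde x *v v = 0} \<le> q' i)"
    by eventually_elim simp
  \<comment> \<open>If the claim fails, some \<open>x\<close> with generic ranks has \<phi> at most
    \<psi>. By monotonicity in the ranks its values bound \<phi> from above and \<psi> from below on
    all of \<open>M\<close>.\<close>
  obtain x where x: "\<And>j. dim {w\<in>W. truncated_x_tilde j x *v w = 0} \<le> q j"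
      "\<And>i. dim {v\<in>V i. x_tilde x *v v = 0} \<le> q' i" "?\<phi> x \<le> ?\<psi> x"
  proof (rule ccontr)
    assume "\<not> thesis"
    then have *: "\<And>x. (\<forall>j. dim {w\<in>W. truncated_x_tilde j x *v w = 0} \<le> q j) \<and>
        (\<forall>i. dim {v\<in>V i. x_tilde x *v v = 0} \<le> q' i) \<Longrightarrow> ?\<psi> x < ?\<phi> x"
      using that by (meson not_less)
    from gen have "AE x in volume_measure p M. ?\<psi> x < ?\<phi> x" by eventually_elim (rule *)
    with contr show False ..
  qed
  have "M \<subseteq> pencil \<omega> W (?\<psi> x) (?\<phi> x)"
  proof
    fix y assume y: "y \<in> M"
    have "?\<phi> y \<le> ?\<phi> x" using q(1)[OF y] x(1) order.trans by (intro phi_mono[OF W(1) \<omega>]) blast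
    moreover have "?\<psi> x \<le> ?\<psi> y"
      using q'(1)[OF y] x(2) order.trans unfolding V_def by (intro psi_mono[OF W(1) \<omega>]) blast
    ultimately show "y \<in> pencil \<omega> W (?\<psi> x) (?\<phi> x)" by (simp add: pencil_def)
  qed
  with pencil[OF x(3) proper[OF x(3)]] show False by (rule notE)
qed

theorem theorem1p11:
  fixes \<omega> :: "real ^ ('m::{finite,linorder} + 'n::{finite,linorder})"
    and k p :: nat
    and M :: "(real ^ 'n::{finite,linorder} ^ 'm::{finite,linorder}) set"
  assumes "weight_vector \<omega>"
    and "1 \<le> k" and "k \<le> CARD('m + 'n) - 1"
    and "analytic_submanifold p M" and "connected M"
    and "\<And>W a b. subspace W \<Longrightarrow> dim W = k \<Longrightarrow> rational_subspace W \<Longrightarrow> b \<le> a \<Longrightarrow>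
           pencil \<omega> W a b \<noteq> UNIV \<Longrightarrow> \<not> M \<subseteq> pencil \<omega> W a b"
  shows "AE x in volume_measure p M. connected_at (L_fun \<omega> (Lambda x)) k"
proof -
  \<comment> \<open>Described by finite integer bases, because this is what a gap provides and it
    makes countability immediate.\<close>
  define \<W> :: "(real ^ ('m + 'n)) set set" where "\<W> = {W. \<exists>B. B \<subseteq> integer_lattice \<and> independent B \<and> card B = k \<and> span B = W}"
  have "\<W> \<subseteq> span ` {B. finite B \<and> B \<subseteq> (integer_lattice :: (real ^ ('m + 'n)) set)}"
    using finiteI_independent by (auto simp: \<W>_def)
  then have count: "countable \<W>"
    using countable_Collect_finite_subset[OF countable_integer_lattice] countable_image countable_subset by blast
  have "AE x in volume_measure p M. psi \<omega> ({v. x_tilde x *v v = 0} \<inter> W) < phi \<omega> ((*v) (x_tilde x) ` W)"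
    if W: "W \<in> \<W>" for W
  proof -
    obtain B where B: "B \<subseteq> integer_lattice" "independent B" "card B = k" "span B = W"
      using W by (auto simp: \<W>_def)
    have sub: "subspace W" and dim: "dim W = k" using B by (auto simp: dim_eq_card_independent)
    have "(integer_lattice :: (real ^ ('m + 'n)) set) \<subseteq> {v. \<forall>i. v $ i \<in> \<rat>}"
      using Ints_subset_Rats by (auto simp: integer_lattice_def)
    then have rat: "rational_subspace W" unfolding rational_subspace_def using B by blast
    show ?thesis
      using assms(2,3) dim
      by (intro AE_psi_less_phi[OF assms(1,4,5) sub] assms(6)[OF sub dim rat]) auto
  qed
  then have "AE x in volume_measure p M. \<forall>W\<in>\<W>. psi \<omega> ({v. x_tilde x *v v = 0} \<inter> W) < phi \<omega> ((*v) (x_tilde x) ` W)"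
    using count by (simp add: AE_ball_countable)
  then show ?thesis
  proof eventually_elim
    case (elim x)
    show ?case
    proof (rule ccontr)
      assume "\<not> ?case"
      then obtain T W where gap: "\<And>t. t \<ge> T \<Longrightarrow> lattice_gap (diag_exp (flow_exponent \<omega>) t ** u_mat x) k W"
        using not_connected_at_gap[OF assms(1-3)] by blast
      obtain B where "B \<subseteq> integer_lattice" "independent B" "card B = k" "span B = W"
        using lattice_gap_basis[OF gap[OF order.refl]] by blast
      then have W: "W \<in> \<W>" "subspace W" "dim W = k" by (auto simp: \<W>_def dim_eq_card_independent)
      \<comment> \<open>The selection depends on \<open>x\<close>, which is fixed here, while
        \<open>W\<close> ranges over the countable family; the sum is \<phi> - \<psi>, which
        \<open>elim\<close> makes positive.\<close>
      have "(\<Sum>i\<in>jump_coordinates W x. flow_exponent \<omega> i) \<le> 0"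
        by (rule gap_weight_nonpos[OF sum_flow_exponent[OF assms(1)] det_u_mat])
          (use gap W card_jump_coordinates[OF W(2), of x] jump_coordinates_transversal[OF W(2)] in auto)
      then show False
        using elim W(1) by (auto simp: sum_jump_coordinates[OF W(2)])
    qed
  qed
qed

end
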